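(* Let $b:\mathbb{R}^d\to\mathbb{R}^d$, $Z:\mathscr{C}\to\mathbb{R}^d$, $\sigma$ a non-singular real $d\times d$ matrix and $\xi\in\mathscr{C}$ satisfy the following. (i) There is $L_1$ with $|b(x)-b(y)|\le L_1|x-y|$ for all $x,y\in\mathbb{R}^d$, and there are constants $C>0$, $\beta\in\mathbb{R}$ with $2\langle x,b(x)\rangle\le C+\beta|x|^2$ for all $x\in\mathbb{R}^d$. (ii) There are $\alpha\in(0,1]$ and $L_2$ with $|Z(\zeta)-Z(\eta)|\le L_2\|\zeta-\eta\|_\infty^\alpha$ for all $\zeta,\eta\in\mathscr{C}$. (iii) There is $L_3>0$ with $|\xi(t)-\xi(s)|\le L_3|t-s|$ for all $s,t\in[-\tau,0]$. Let $X$ be the (unique in law) weak solution of $$\mathrm{d}X(t)=\{b(X(t))+Z(X_t)\}\,\mathrm{d}t+\sigma\,\mathrm{d}W(t),\quad t>0,\qquad X_0=\xi,$$ and let $X^{(\delta)}$ be its Euler–Maruyama scheme with stepsize $\delta$ (defined in the context). Then for any $\kappa\in(0,\alpha/2)$ and any $T>0$ such that $$2\,\|\sigma\|_{\rm HS}^2\,\|\sigma^{-1}\|_{\rm HS}^2\,\{(4L_1^2+L_2^2)\mathbf{1}_{\{\alpha=1\}}+L_1^2\mathbf{1}_{\{\alpha\in(0,1)\}}\}<\mathrm{e}^{-(1+\beta T)}/T^2,$$ there exists a constant $C_{1,T}>0$ (independent of $\delta$, $t$, $f$) such that $$|\mathbb{E}f(X(t))-\mathbb{E}f(X^{(\delta)}(t))|\le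 C_{1,T}\,\sup_{x\in\mathbb{R}^d}|f(x)|\;\delta^{\kappa}$$ for all bounded measurable $f:\mathbb{R}^d\to\mathbb{R}$, all $t\in[0,T]$ and all admissible stepsizes $\delta$.
   Context: $\tau>0$ is fixed and $\mathscr{C}=C([-\tau,0];\mathbb{R}^d)$ with the uniform norm $\|\cdot\|_\infty$. For $f\in C([-\tau,\infty);\mathbb{R}^d)$ and $t\ge0$, the segment $f_t\in\mathscr{C}$ is $f_t(\theta)=f(t+\theta)$, $\theta\in[-\tau,0]$. $W$ is a $d$-dimensional Brownian motion on a filtered probability space; $\|\cdot\|_{\rm HS}$ is the Hilbert–Schmidt norm of a matrix. Under (i) and (ii) the path-dependent SDE has a unique weak solution. Admissible stepsizes: $\delta\in(0,1)$ of the form $\delta=\tau/M$, $M\in\mathbb{N}$. Put $t_\delta:=\lfloor t/\delta\rfloor\delta$. The Euler–Maruyama scheme is $$\mathrm{d}X^{(\delta)}(t)=\{b(X^{(\delta)}(t_\delta))+Z(\hat X^{(\delta)}_{t_\delta})\}\,\mathrm{d}t+\sigma\,\mathrm{d}W(t),\ t>0,\qquad X^{(\delta)}(\theta)=\xi(\theta),\ \theta\in[-\tau,0],$$ where, for integers $k\ge0$, $\hat X^{(\delta)}_{k\delta}\in\mathscr{C}$ is the linear interpolation $$\hat X^{(\delta)}_{k\delta}(\theta)=\frac{\theta+(1+i)\delta}{\delta}X^{(\delta)}((k-i)\delta)-\frac{\theta+i\delta}{\delta}X^{(\delta)}((k-i-1)\delta),\quad \theta\in[-(i+1)\delta,-i\delta],\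 i\in\{0,1,\dots,M-1\}.$$ *)

theory Defs
  imports "HOL-Probability.Probability"
begin

section \<open>The path space\<close>

text \<open>
  The space $C([-\tau,0];R^d)$ with the uniform metric. Its elements are functions on the reals
  that are \<^const>\<open>undefined\<close> outside $[-\tau,0]$, so that they are determined by their
  restriction to $[-\tau,0]$.
\<close>

definition path_space :: "real \<Rightarrow> (real \<Rightarrow> real ^ 'd) metric" where
  "path_space \<tau> = cfunspace (top_of_set {-\<tau>..0}) euclidean_metric"

lemma mspace_path_space:
  "mspace (path_space \<tau>) = {\<zeta> \<in> extensional {-\<tau>..0}. continuous_on {-\<tau>..0} \<zeta>}"
proof -
  have "bounded (\<zeta> ` {-\<tau>..0})" if "continuous_on {-\<tau>..0} \<zeta>" for \<zeta> :: "real \<Rightarrow> real ^ 'd"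
    using that by (intro compact_imp_bounded compact_continuous_image) auto
  then show ?thesis
    by (auto simp: path_space_def compactin_mspace_cfunspace)
qed

lemma mdist_path_space:
  assumes "\<zeta> \<in> mspace (path_space \<tau>)" "\<eta> \<in> mspace (path_space \<tau>)"
  shows "mdist (path_space \<tau>) \<zeta> \<eta> = (if \<tau> < 0 then 0 else SUP \<theta>\<in>{-\<tau>..0}. norm (\<zeta> \<theta> - \<eta> \<theta>))"
  using assms
  by (auto simp: path_space_def mdist_cfunspace_eq_mdist_funspace Met_TC.fdist_def
      Met_TC.fspace_def dist_norm)

definition segment :: "real \<Rightarrow> (real \<Rightarrow> real ^ 'd) \<Rightarrow> real \<Rightarrow> real \<Rightarrow> real ^ 'd" where
  "segment \<tau> x t = restrict (\<lambda>\<theta>. x (t + \<theta>)) {-\<tau>..0}"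

section \<open>Brownian motion on a filtered probability space\<close>

text \<open>
  The filtration is indexed by all reals in order to use the library locale; only its members
  at times $t \ge 0$ matter.
\<close>

definition filtered_prob_space :: "'a measure \<Rightarrow> (real \<Rightarrow> 'a measure) \<Rightarrow> bool" where
  "filtered_prob_space M F \<longleftrightarrow>
     prob_space M \<and> filtration (space M) F \<and> (\<forall>t. sets (F t) \<subseteq> sets M)"

definition adapted_process :: "(real \<Rightarrow> 'a measure) \<Rightarrow> (real \<Rightarrow> 'a \<Rightarrow> real ^ 'd) \<Rightarrow> bool" where
  "adapted_process F X \<longleftrightarrow> (\<forall>t\<ge>0. X t \<in> borel_measurable (F t))"

definition brownian_motion ::
    "'a measure \<Rightarrow> (real \<Rightarrow> 'a measure) \<Rightarrow> (real \<Rightarrow> 'a \<Rightarrow> real ^ 'd) \<Rightarrow> bool" where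
  "brownian_motion M F W \<longleftrightarrow>
     adapted_process F W \<and>
     (AE \<omega> in M. W 0 \<omega> = 0) \<and>
     (AE \<omega> in M. continuous_on {0..} (\<lambda>t. W t \<omega>)) \<and>
     (\<forall>s t. 0 \<le> s \<and> s < t \<longrightarrow>
        distributed M lborel (\<lambda>\<omega>. W t \<omega> - W s \<omega>)
          (\<lambda>x. ennreal (\<Prod>i\<in>UNIV. normal_density 0 (sqrt (t - s)) (x $ i))) \<and>
        prob_space.indep_set M (sets (F s))
          (sets (vimage_algebra (space M) (\<lambda>\<omega>. W t \<omega> - W s \<omega>) borel)))"

section \<open>Stochastic equations with additive noise\<close>

text \<open>
  The integrated form of $dX(t) = D(X,t)\,dt + \sigma\,dW(t)$, $t > 0$, $X = \xi$ on
  $[-\tau,0]$. As $\sigma$ is constant, the stochastic integral is $\sigma W(t)$.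
\<close>

definition additive_noise_solution ::
    "'a measure \<Rightarrow> (real \<Rightarrow> 'a measure) \<Rightarrow> (real \<Rightarrow> 'a \<Rightarrow> real ^ 'd) \<Rightarrow> real
      \<Rightarrow> ((real \<Rightarrow> real ^ 'd) \<Rightarrow> real \<Rightarrow> real ^ 'd) \<Rightarrow> real ^ 'd ^ 'd \<Rightarrow> (real \<Rightarrow> real ^ 'd)
      \<Rightarrow> (real \<Rightarrow> 'a \<Rightarrow> real ^ 'd) \<Rightarrow> bool" where
  "additive_noise_solution M F W \<tau> D \<sigma> \<xi> X \<longleftrightarrow>
     adapted_process F X \<and>
     (AE \<omega> in M.
        continuous_on {-\<tau>..} (\<lambda>t. X t \<omega>) \<and>
        (\<forall>\<theta>\<in>{-\<tau>..0}. X \<theta> \<omega> = \<xi> \<theta>) \<and>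
        (\<forall>t\<ge>0. set_integrable lborel {0..t} (D (\<lambda>r. X r \<omega>)) \<and>
           X t \<omega> = \<xi> 0 + (LINT s:{0..t}|lborel. D (\<lambda>r. X r \<omega>) s) + \<sigma> *v W t \<omega>))"

definition weak_solution ::
    "'a measure \<Rightarrow> (real \<Rightarrow> 'a measure) \<Rightarrow> (real \<Rightarrow> 'a \<Rightarrow> real ^ 'd) \<Rightarrow> real
      \<Rightarrow> (real ^ 'd \<Rightarrow> real ^ 'd) \<Rightarrow> ((real \<Rightarrow> real ^ 'd) \<Rightarrow> real ^ 'd) \<Rightarrow> real ^ 'd ^ 'd
      \<Rightarrow> (real \<Rightarrow> real ^ 'd) \<Rightarrow> (real \<Rightarrow> 'a \<Rightarrow> real ^ 'd) \<Rightarrow> bool" where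
  "weak_solution M F W \<tau> b Z \<sigma> \<xi> X \<longleftrightarrow>
     filtered_prob_space M F \<and> brownian_motion M F W \<and>
     additive_noise_solution M F W \<tau> (\<lambda>x s. b (x s) + Z (segment \<tau> x s)) \<sigma> \<xi> X"

section \<open>The Euler--Maruyama scheme\<close>

definition admissible_stepsize :: "real \<Rightarrow> real \<Rightarrow> bool" where
  "admissible_stepsize \<tau> \<delta> \<longleftrightarrow> \<delta> \<in> {0<..<1} \<and> (\<exists>m::nat. m > 0 \<and> \<delta> = \<tau> / real m)"

text \<open>
  The index \<open>i\<close> is the one with $\theta \in [-(i+1)\delta, -i\delta)$, and $0$ for $\theta = 0$;
  see \<open>interp_segment_eq\<close> below for the formula on the closed intervals.
\<close>

definition interp_segment ::
    "real \<Rightarrow> real \<Rightarrow> (real \<Rightarrow> real ^ 'd) \<Rightarrow> int \<Rightarrow> real \<Rightarrow> real ^ 'd" where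
  "interp_segment \<tau> \<delta> x k = restrict (\<lambda>\<theta>.
     let i = nat (\<lceil>- \<theta> / \<delta>\<rceil> - 1) in
       ((\<theta> + (1 + real i) * \<delta>) / \<delta>) *\<^sub>R x ((of_int k - real i) * \<delta>)
       - ((\<theta> + real i * \<delta>) / \<delta>) *\<^sub>R x ((of_int k - real i - 1) * \<delta>)) {-\<tau>..0}"

lemma interp_segment_eq:
  assumes \<delta>: "\<delta> > 0" "\<delta> = \<tau> / real m" and "i < m"
    and \<theta>: "\<theta> \<in> {- (real i + 1) * \<delta> .. - real i * \<delta>}"
  shows "interp_segment \<tau> \<delta> x k \<theta> =
       ((\<theta> + (1 + real i) * \<delta>) / \<delta>) *\<^sub>R x ((of_int k - real i) * \<delta>)
       - ((\<theta> + real i * \<delta>) / \<delta>) *\<^sub>R x ((of_int k - real i - 1) * \<delta>)"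
proof -
  have \<tau>: "\<tau> = real m * \<delta>"
    using assms by (auto simp: field_simps)
  have "(real i + 1) * \<delta> \<le> real m * \<delta>"
    using \<open>i < m\<close> \<delta>(1) by (intro mult_right_mono) auto
  moreover have "- real i * \<delta> \<le> 0"
    using \<delta>(1) by simp
  ultimately have mem: "\<theta> \<in> {-\<tau>..0}"
    using \<theta> unfolding \<tau> atLeastAtMost_iff
    by (metis (no_types, lifting) minus_mult_left neg_le_iff_le order_trans)
  have lo: "real i \<le> - \<theta> / \<delta>" and hi: "- \<theta> / \<delta> \<le> real i + 1"
    using \<theta> \<delta>(1) by (auto simp: field_simps)
  show ?thesis
  proof (cases "- \<theta> / \<delta> = real i")
    case False
    then have "\<lceil>- \<theta> / \<delta>\<rceil> = int i + 1"
      using lo hi by (intro ceiling_unique) auto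
    then show ?thesis
      using mem by (simp add: interp_segment_def)
  next
    case True
    then have \<theta>': "\<theta> = - real i * \<delta>"
      using \<delta>(1) by (simp add: field_simps)
    have c: "\<lceil>- \<theta> / \<delta>\<rceil> = int i"
      unfolding True by simp
    show ?thesis
    proof (cases i)
      case 0
      then show ?thesis
        using mem c by (simp add: interp_segment_def)
    next
      case (Suc j)
      have j: "nat (\<lceil>- \<theta> / \<delta>\<rceil> - 1) = j"
        unfolding c by (simp add: Suc)
      have e: "(\<theta> + (1 + real j) * \<delta>) / \<delta> = 0" "(\<theta> + real j * \<delta>) / \<delta> = - 1"
        "(\<theta> + (1 + real i) * \<delta>) / \<delta> = 1" "(\<theta> + real i * \<delta>) / \<delta> = 0"
        using \<delta>(1) by (auto simp: \<theta>' Suc field_simps)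
      have "interp_segment \<tau> \<delta> x k \<theta> = x ((of_int k - real j - 1) * \<delta>)"
        using mem unfolding interp_segment_def by (simp only: restrict_apply' Let_def j e) simp
      also have "\<dots> = x ((of_int k - real i) * \<delta>)"
        by (simp add: Suc algebra_simps)
      finally show ?thesis
        unfolding e by simp
    qed
  qed
qed

definition euler_maruyama ::
    "'a measure \<Rightarrow> (real \<Rightarrow> 'a measure) \<Rightarrow> (real \<Rightarrow> 'a \<Rightarrow> real ^ 'd) \<Rightarrow> real
      \<Rightarrow> (real ^ 'd \<Rightarrow> real ^ 'd) \<Rightarrow> ((real \<Rightarrow> real ^ 'd) \<Rightarrow> real ^ 'd) \<Rightarrow> real ^ 'd ^ 'd
      \<Rightarrow> (real \<Rightarrow> real ^ 'd) \<Rightarrow> real \<Rightarrow> (real \<Rightarrow> 'a \<Rightarrow> real ^ 'd) \<Rightarrow> bool" where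
  "euler_maruyama M F W \<tau> b Z \<sigma> \<xi> \<delta> X \<longleftrightarrow>
     additive_noise_solution M F W \<tau>
       (\<lambda>x s. b (x (of_int \<lfloor>s / \<delta>\<rfloor> * \<delta>)) + Z (interp_segment \<tau> \<delta> x \<lfloor>s / \<delta>\<rfloor>)) \<sigma> \<xi> X"

section \<open>The Hilbert--Schmidt norm\<close>

definition hs_norm :: "real ^ 'n ^ 'm \<Rightarrow> real" where
  "hs_norm A = sqrt (\<Sum>i\<in>UNIV. \<Sum>j\<in>UNIV. (A $ i $ j)\<^sup>2)"

lemma hs_norm_eq_norm: "hs_norm A = norm A"
  by (simp add: hs_norm_def norm_vec_def L2_set_def sum_nonneg)

end

theory Submission
  imports Defs
begin

text \<open>
  Both \<open>X\<close> and the scheme are driven by the same additive noise, so their laws can be compared by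
  shifting the noise. To avoid stochastic calculus this is done on a grid of width \<open>h = \<delta>/N\<close>.
  Freezing the drift of \<open>X\<close> on that grid gives a process that converges to \<open>X\<close> as \<open>h\<close> tends to $0$;
  it is the scheme of step \<open>\<delta>\<close> driven by Gaussian increments shifted by adapted vectors \<open>h u\<^sub>j\<close>.
  A discrete Girsanov theorem, whose density \<open>R\<close> always has mean one, and a Pinsker inequality
  (from $((1-R)^+)^2 \le 2(R - 1 - \ln R)$) bound the total variation distance by a multiple of the
  square root of the sum over \<open>j\<close> of \<open>h E|u\<^sub>j|\<^sup>2\<close>, uniformly in \<open>h\<close>. Here \<open>\<sigma> u\<^sub>j\<close> is the difference
  between the two drifts, which is at most a constant times \<open>(1 + H) \<delta>\<^sup>\<kappa>\<close>, where \<open>H\<close> is the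
  square integrable Hoelder constant of \<open>W\<close> for the exponent \<open>\<kappa>/\<alpha> < 1/2\<close>.
\<close>

section \<open>Gaussian measures\<close>

definition gauss :: "real \<Rightarrow> (real ^ 'd) measure" where
  "gauss h = density lborel (\<lambda>x. ennreal (\<Prod>i\<in>UNIV. normal_density 0 (sqrt h) (x $ i)))"

lemma sets_gauss [measurable_cong, simp]: "sets (gauss h) = sets borel"
  by (simp add: gauss_def)

lemma space_gauss [simp]: "space (gauss h) = UNIV"
  by (simp add: gauss_def)

text \<open>The product formula for \<open>lborel\<close> runs over \<open>Basis\<close>. The map
  sending \<open>i\<close> to \<open>axis i 1\<close> is a bijection onto \<open>Basis\<close>,
  which turns that product into one over coordinates.\<close>

lemma nn_integral_lborel_vec_prod:
  fixes g :: "'d::finite \<Rightarrow> real \<Rightarrow> real"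
  assumes [measurable]: "\<And>i. g i \<in> borel_measurable borel" and nonneg: "\<And>i x. 0 \<le> g i x"
  shows "(\<integral>\<^sup>+x. ennreal (\<Prod>i\<in>UNIV. g i (x $ i)) \<partial>(lborel :: (real ^ 'd) measure))
       = (\<Prod>i\<in>UNIV. \<integral>\<^sup>+x. ennreal (g i x) \<partial>lborel)"
proof -
  have inj: "inj (\<lambda>i::'d. axis i (1::real))"
    by (auto simp: inj_on_def axis_eq_axis)
  have B: "Basis = range (\<lambda>i::'d. axis i (1::real))"
    by (auto simp: Basis_vec_def)
  define f where "f b x = ennreal (g (inv (\<lambda>i::'d. axis i (1::real)) b) x)" for b x
  have f: "f (axis i 1) = (\<lambda>x. ennreal (g i x))" for i
    using inv_f_f[OF inj, of i] by (simp add: f_def fun_eq_iff)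
  have "(\<integral>\<^sup>+x. (\<Prod>b\<in>Basis. f b (x \<bullet> b)) \<partial>(lborel :: (real ^ 'd) measure)) = (\<Prod>b\<in>Basis. \<integral>\<^sup>+x. f b x \<partial>lborel)"
    by (intro nn_integral_lborel_prod) (auto simp: f_def[abs_def])
  then show ?thesis
    using nonneg by (simp add: B prod.reindex[OF inj] f inner_axis prod_ennreal)
qed

text \<open>Every coordinate other than \<open>i\<close> contributes the total mass one of a normal
  density, so that only a one-dimensional integral is left.\<close>

lemma nn_integral_gauss_component:
  fixes i :: "'d::finite"
  assumes h: "h > 0" and g[measurable]: "g \<in> borel_measurable borel" and nonneg: "\<And>x. 0 \<le> g x"
  shows "(\<integral>\<^sup>+z. ennreal (g (z $ i)) \<partial>gauss h)
       = (\<integral>\<^sup>+x. ennreal (normal_density 0 (sqrt h) x * g x) \<partial>lborel)"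
proof -
  have n1: "(\<integral>\<^sup>+x. ennreal (normal_density 0 (sqrt h) x) \<partial>lborel) = 1"
    using prob_space.emeasure_space_1[OF prob_space_normal_density[of "sqrt h" 0]] h
    by (simp add: emeasure_density)
  let ?f = "\<lambda>j x. normal_density 0 (sqrt h) x * (if j = i then g x else 1)"
  have "(\<integral>\<^sup>+z. ennreal (g (z $ i)) \<partial>gauss h)
      = (\<integral>\<^sup>+z. ennreal (\<Prod>j\<in>UNIV. ?f j (z $ j)) \<partial>(lborel :: (real ^ 'd) measure))"
    unfolding gauss_def
    by (subst nn_integral_density)
       (auto intro!: nn_integral_cong simp: prod.distrib ennreal_mult prod_nonneg nonneg)
  also have "\<dots> = (\<Prod>j\<in>UNIV. \<integral>\<^sup>+x. ennreal (?f j x) \<partial>lborel)"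
    by (intro nn_integral_lborel_vec_prod) (auto simp: nonneg)
  also have "\<dots> = (\<Prod>j\<in>UNIV. if j = i
      then \<integral>\<^sup>+x. ennreal (normal_density 0 (sqrt h) x * g x) \<partial>lborel else 1)"
    using n1 by (intro prod.cong) (auto simp: mult_ac)
  finally show ?thesis
    by simp
qed

lemma prob_space_gauss:
  assumes "h > 0"
  shows "prob_space (gauss h :: (real ^ 'd) measure)"
proof
  \<comment> \<open>Any coordinate will do: index types are nonempty, and the marginal formula for
    the constant 1 gives the total mass.\<close>
  obtain i :: 'd where True
    by auto
  have "emeasure (gauss h :: (real ^ 'd) measure) (space (gauss h))
      = (\<integral>\<^sup>+z. ennreal ((\<lambda>_. 1) (z $ i)) \<partial>(gauss h :: (real ^ 'd) measure))"
    by simp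
  also have "\<dots> = (\<integral>\<^sup>+x. ennreal (normal_density 0 (sqrt h) x) \<partial>lborel)"
    using nn_integral_gauss_component[OF assms, of "\<lambda>_. 1" i] by simp
  also have "\<dots> = 1"
    using prob_space.emeasure_space_1[OF prob_space_normal_density[of "sqrt h" 0]] assms
    by (simp add: emeasure_density)
  finally show "emeasure (gauss h :: (real ^ 'd) measure) (space (gauss h)) = 1" .
qed

text \<open>Completing the square: the exponential is the ratio of the Gaussian densities at
  \<open>z + h *\<^sub>R u\<close> and at \<open>z\<close>. What remains is the translation
  invariance of Lebesgue measure. This is the Girsanov formula for one step.\<close>

lemma gauss_shift:
  fixes u :: "real ^ 'd"
  assumes h: "h > 0" and g[measurable]: "g \<in> borel_measurable borel"
  shows "(\<integral>\<^sup>+z. ennreal (exp (- (u \<bullet> z) - h * (norm u)\<^sup>2 / 2)) * g (z + h *\<^sub>R u) \<partial>gauss h)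
       = (\<integral>\<^sup>+z. g z \<partial>gauss h)"
proof -
  let ?p = "\<lambda>z::real ^ 'd. \<Prod>i\<in>UNIV. normal_density 0 (sqrt h) (z $ i)"
  have p: "?p z * exp (- (u \<bullet> z) - h * (norm u)\<^sup>2 / 2) = ?p (z + h *\<^sub>R u)" for z
  proof -
    have "exp (- (u \<bullet> z) - h * (norm u)\<^sup>2 / 2) = (\<Prod>i\<in>UNIV. exp (- (u $ i * z $ i) - h * (u $ i)\<^sup>2 / 2))"
      unfolding power2_norm_eq_inner inner_vec_def
      by (simp add: exp_sum[symmetric] sum_subtractf sum_negf sum_distrib_left sum_divide_distrib
          power2_eq_square)
    moreover have "normal_density 0 (sqrt h) (z $ i) * exp (- (u $ i * z $ i) - h * (u $ i)\<^sup>2 / 2)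
        = normal_density 0 (sqrt h) ((z + h *\<^sub>R u) $ i)" for i
      using h by (simp add: normal_density_def exp_add[symmetric] power2_eq_square field_simps)
    ultimately show ?thesis
      by (simp only: prod.distrib[symmetric])
  qed
  have "(\<integral>\<^sup>+z. ennreal (exp (- (u \<bullet> z) - h * (norm u)\<^sup>2 / 2)) * g (z + h *\<^sub>R u) \<partial>gauss h)
      = (\<integral>\<^sup>+z. ennreal (?p (h *\<^sub>R u + z)) * g (h *\<^sub>R u + z) \<partial>lborel)"
    unfolding gauss_def
    by (subst nn_integral_density)
       (auto intro!: nn_integral_cong simp: mult.assoc[symmetric] ennreal_mult'[symmetric] p prod_nonneg add.commute)
  also have "\<dots> = (\<integral>\<^sup>+z. ennreal (?p z) * g z \<partial>distr lborel borel ((+) (h *\<^sub>R u)))"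
    by (subst nn_integral_distr) auto
  also have "\<dots> = (\<integral>\<^sup>+z. g z \<partial>gauss h)"
    by (simp add: lborel_distr_plus gauss_def nn_integral_density)
  finally show ?thesis .
qed

text \<open>The norm is at most the sum of the absolute coordinates, hence at most the dimension
  times the largest one, whose \<open>n\<close>-th power is among the summands.\<close>

lemma norm_power_le_sum_components:
  fixes z :: "real ^ 'd"
  shows "norm z ^ n \<le> real CARD('d) ^ n * (\<Sum>i\<in>UNIV. \<bar>z $ i\<bar> ^ n)"
proof -
  obtain j where j: "\<And>i. \<bar>z $ i\<bar> \<le> \<bar>z $ j\<bar>"
  proof -
    have "Max (range (\<lambda>i. \<bar>z $ i\<bar>)) \<in> range (\<lambda>i. \<bar>z $ i\<bar>)"
      by (intro Max_in) auto
    then obtain j where j: "Max (range (\<lambda>i. \<bar>z $ i\<bar>)) = \<bar>z $ j\<bar>"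
      by (elim rangeE)
    show ?thesis
      by (rule that[of j]) (simp add: j[symmetric])
  qed
  have "norm z \<le> (\<Sum>i\<in>UNIV. \<bar>z $ i\<bar>)"
    by (rule norm_le_l1_cart)
  also have "\<dots> \<le> real CARD('d) * \<bar>z $ j\<bar>"
    using sum_bounded_above[of UNIV "\<lambda>i. \<bar>z $ i\<bar>", OF j] by simp
  finally have "norm z ^ n \<le> (real CARD('d) * \<bar>z $ j\<bar>) ^ n"
    by (intro power_mono) auto
  also have "\<dots> \<le> real CARD('d) ^ n * (\<Sum>i\<in>UNIV. \<bar>z $ i\<bar> ^ n)"
    unfolding power_mult_distrib by (intro mult_left_mono member_le_sum) auto
  finally show ?thesis .
qed

text \<open>The scaling \<open>h ^ m\<close> of the moment of order \<open>2 * m\<close> is what the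
  Hoelder theorem consumes. The constant combines the normal moment
  \<open>fact (2 * m) / (2 ^ m * fact m)\<close> with powers of the dimension from the passage to
  coordinates.\<close>

lemma gauss_moment_even:
  "\<exists>c\<ge>0. \<forall>h>0. (\<integral>\<^sup>+z. ennreal (norm z ^ (2 * m)) \<partial>(gauss h :: (real ^ 'd) measure)) \<le> ennreal (c * h ^ m)"
proof (intro exI conjI allI impI)
  let ?d = "real CARD('d)"
  let ?c = "fact (2 * m) / (2 ^ m * fact m) :: real"
  show "0 \<le> ?d ^ (2 * m) * (?d * ?c)"
    by simp
  fix h :: real assume h: "h > 0"
  have comp: "(\<integral>\<^sup>+z. ennreal (\<bar>z $ i\<bar> ^ (2 * m)) \<partial>gauss h) = ennreal (?c * h ^ m)" for i :: 'd
  proof -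
    have "(\<integral>\<^sup>+z. ennreal (\<bar>z $ i\<bar> ^ (2 * m)) \<partial>gauss h)
        = (\<integral>\<^sup>+x. ennreal (normal_density 0 (sqrt h) x * \<bar>x\<bar> ^ (2 * m)) \<partial>lborel)"
      using nn_integral_gauss_component[OF h, of "\<lambda>x. \<bar>x\<bar> ^ (2 * m)" i] by simp
    also have "\<dots> = ennreal (fact (2 * m) / ((2 / (sqrt h)\<^sup>2) ^ m * fact m))"
      using normal_moment_even[of "sqrt h" 0 m] h
      by (subst nn_integral_eq_integral) (auto simp: has_bochner_integral_iff power_even_abs)
    also have "fact (2 * m) / ((2 / (sqrt h)\<^sup>2) ^ m * fact m) = ?c * h ^ m"
      using h by (simp add: field_simps)
    finally show ?thesis .
  qed
  have "(\<integral>\<^sup>+z. ennreal (norm z ^ (2 * m)) \<partial>(gauss h :: (real ^ 'd) measure))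
      \<le> (\<integral>\<^sup>+z. ennreal (?d ^ (2 * m)) * (\<Sum>i\<in>UNIV. ennreal (\<bar>z $ i\<bar> ^ (2 * m)))
          \<partial>(gauss h :: (real ^ 'd) measure))"
    using norm_power_le_sum_components
    by (intro nn_integral_mono) (auto simp: sum_ennreal ennreal_mult'[symmetric] sum_nonneg)
  also have "\<dots> = ennreal (?d ^ (2 * m)) * (\<Sum>i\<in>(UNIV::'d set). ennreal (?c * h ^ m))"
    by (subst nn_integral_cmult, simp, subst nn_integral_sum) (auto simp: comp)
  also have "\<dots> = ennreal (?d ^ (2 * m) * (?d * ?c) * h ^ m)"
    using h by (simp add: ennreal_mult'[symmetric] ennreal_of_nat_eq_real_of_nat mult_ac)
  finally show "(\<integral>\<^sup>+z. ennreal (norm z ^ (2 * m)) \<partial>(gauss h :: (real ^ 'd) measure))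
      \<le> ennreal (?d ^ (2 * m) * (?d * ?c) * h ^ m)" .
qed

section \<open>A discrete Girsanov theorem\<close>

text \<open>The properties of Brownian increments over a uniform grid that the change of measure
  uses: \<open>G j\<close> is the information at the start of step \<open>j\<close>, and
  \<open>e j\<close> is the increment over that step, revealed at its end.\<close>

locale gaussian_noise = prob_space M for M :: "'a measure" +
  fixes G :: "nat \<Rightarrow> 'a measure" and e :: "nat \<Rightarrow> 'a \<Rightarrow> real ^ 'd" and h :: real
  assumes h_pos: "h > 0"
    and space_G: "\<And>j. space (G j) = space M"
    and sets_G: "\<And>j. sets (G j) \<subseteq> sets M"
    and G_mono: "\<And>i j. i \<le> j \<Longrightarrow> sets (G i) \<subseteq> sets (G j)"
    and e_measurable: "\<And>j. e j \<in> borel_measurable (G (Suc j))"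
    and e_law: "\<And>j. distr M borel (e j) = gauss h"
    and e_indep: "\<And>j. indep_set (sets (G j)) (sets (vimage_algebra (space M) (e j) borel))"
begin

lemma G_measurable_mono:
  "f \<in> measurable (G i) N \<Longrightarrow> i \<le> j \<Longrightarrow> f \<in> measurable (G j) N"
  using measurable_mono[of N N "G i" "G j"] G_mono[of i j] space_G by auto

lemma G_measurable_M: "f \<in> measurable (G i) N \<Longrightarrow> f \<in> measurable M N"
  using measurable_mono[of N N "G i" M] sets_G space_G by auto

lemma e_measurable_M [measurable]: "e j \<in> borel_measurable M"
  using e_measurable by (rule G_measurable_M)

lemma emeasure_Int_noise:
  assumes A: "A \<in> sets (G j)" and B: "B \<in> sets borel"
  shows "emeasure M (A \<inter> (e j -` B \<inter> space M)) = emeasure M A * emeasure (gauss h) B"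
proof -
  have "e j -` B \<inter> space M \<in> sets (vimage_algebra (space M) (e j) borel)"
    using B by (intro in_vimage_algebra)
  then have "prob (A \<inter> (e j -` B \<inter> space M)) = prob A * prob (e j -` B \<inter> space M)"
    using e_indep[of j] A by (intro indep_setD)
  moreover have "emeasure M (e j -` B \<inter> space M) = emeasure (gauss h) B"
    using B by (simp flip: e_law[of j] add: emeasure_distr)
  ultimately show ?thesis
    by (metis emeasure_eq_measure ennreal_mult' measure_nonneg)
qed

text \<open>This is the freezing lemma. By independence the joint law of the sample point, seen
  through \<open>G j\<close>, and of \<open>e j\<close> is a product measure; rectangles determine
  it, and Tonelli gives the iterated integral.\<close>

lemma nn_integral_indep_noise:
  assumes Psi: "(\<lambda>(\<omega>, z). \<Psi> \<omega> z) \<in> borel_measurable (G j \<Otimes>\<^sub>M borel)"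
  shows "(\<integral>\<^sup>+\<omega>. \<Psi> \<omega> (e j \<omega>) \<partial>M) = (\<integral>\<^sup>+\<omega>. (\<integral>\<^sup>+z. \<Psi> \<omega> z \<partial>gauss h) \<partial>M)"
proof -
  interpret gs: prob_space "gauss h :: (real ^ 'd) measure"
    using h_pos by (rule prob_space_gauss)
  have id: "(\<lambda>\<omega>. \<omega>) \<in> measurable M (G j)"
    by (rule G_measurable_M[of _ j]) simp
  \<comment> \<open>The restriction of \<open>M\<close> to \<open>G j\<close>, written as an image
    under the identity. The first factor must carry exactly the sigma-algebra for which
    \<open>\<Psi>\<close> is jointly measurable.\<close>
  let ?N = "distr M (G j) (\<lambda>\<omega>. \<omega>)"
  interpret N: prob_space ?N
    using id by (rule prob_space_distr)
  have Psi': "(\<lambda>(\<omega>, z). \<Psi> \<omega> z) \<in> borel_measurable (?N \<Otimes>\<^sub>M gauss h)"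
    using Psi by (simp cong: measurable_cong_sets sets_pair_measure_cong)
  have pr: "(\<lambda>\<omega>. (\<omega>, e j \<omega>)) \<in> measurable M (G j \<Otimes>\<^sub>M borel)"
    using id by simp
  have D: "?N \<Otimes>\<^sub>M gauss h = distr M (G j \<Otimes>\<^sub>M borel) (\<lambda>\<omega>. (\<omega>, e j \<omega>))"
  proof (rule pair_measure_eqI)
    fix A B assume A: "A \<in> sets ?N" and "B \<in> sets (gauss h :: (real ^ 'd) measure)"
    then have B: "B \<in> sets borel"
      by simp
    have A': "A \<in> sets (G j)" "A \<in> sets M" "A \<subseteq> space M"
      using A sets_G sets.sets_into_space[of A M] by auto
    have eq: "(\<lambda>\<omega>. (\<omega>, e j \<omega>)) -` (A \<times> B) \<inter> space M = A \<inter> (e j -` B \<inter> space M)"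
      by auto
    have "emeasure (distr M (G j \<Otimes>\<^sub>M borel) (\<lambda>\<omega>. (\<omega>, e j \<omega>))) (A \<times> B)
        = emeasure M (A \<inter> (e j -` B \<inter> space M))"
      using A' B pr by (simp add: emeasure_distr eq)
    moreover have "emeasure ?N A = emeasure M A"
      using A' id by (simp add: emeasure_distr Int_absorb2)
    ultimately show "emeasure ?N A * emeasure (gauss h) B
        = emeasure (distr M (G j \<Otimes>\<^sub>M borel) (\<lambda>\<omega>. (\<omega>, e j \<omega>))) (A \<times> B)"
      using emeasure_Int_noise[OF A'(1) B] by simp
  qed (auto simp: N.sigma_finite_measure_axioms gs.sigma_finite_measure_axioms cong: sets_pair_measure_cong)
  have "(\<integral>\<^sup>+\<omega>. \<Psi> \<omega> (e j \<omega>) \<partial>M)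
      = (\<integral>\<^sup>+p. (\<lambda>(\<omega>, z). \<Psi> \<omega> z) p \<partial>distr M (G j \<Otimes>\<^sub>M borel) (\<lambda>\<omega>. (\<omega>, e j \<omega>)))"
    using Psi pr by (subst nn_integral_distr) auto
  also have "\<dots> = (\<integral>\<^sup>+\<omega>. (\<integral>\<^sup>+z. \<Psi> \<omega> z \<partial>gauss h) \<partial>?N)"
    unfolding D[symmetric] using gs.nn_integral_fst[OF Psi'] by simp
  also have "\<dots> = (\<integral>\<^sup>+\<omega>. (\<integral>\<^sup>+z. \<Psi> \<omega> z \<partial>gauss h) \<partial>M)"
    using id gs.borel_measurable_nn_integral_fst[OF Psi'] by (subst nn_integral_distr) auto
  finally show ?thesis .
qed

text \<open>The discrete Girsanov density: the factor of step \<open>j\<close> is the ratio of the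
  Gaussian densities at the shifted and at the plain increment.\<close>

definition weight :: "(nat \<Rightarrow> 'a \<Rightarrow> real ^ 'd) \<Rightarrow> nat \<Rightarrow> 'a \<Rightarrow> real" where
  "weight u n \<omega> = (\<Prod>j<n. exp (- (u j \<omega> \<bullet> e j \<omega>) - h * (norm (u j \<omega>))\<^sup>2 / 2))"

lemma weight_pos: "weight u n \<omega> > 0"
  by (auto simp: weight_def intro!: prod_pos)

lemma weight_measurable_G:
  assumes u: "\<And>j. u j \<in> borel_measurable (G j)"
  shows "weight u n \<in> borel_measurable (G n)"
  unfolding weight_def[abs_def]
proof (rule borel_measurable_prod)
  fix j assume j: "j \<in> {..<n}"
  have [measurable]: "u j \<in> borel_measurable (G n)" "e j \<in> borel_measurable (G n)"
    using j by (auto intro: G_measurable_mono[OF u] G_measurable_mono[OF e_measurable])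
  show "(\<lambda>\<omega>. exp (- (u j \<omega> \<bullet> e j \<omega>) - h * (norm (u j \<omega>))\<^sup>2 / 2)) \<in> borel_measurable (G n)"
    by measurable
qed

text \<open>Induction on \<open>n\<close>, integrating out the last increment. Given
  \<open>G n\<close> the vector \<open>u n\<close> is fixed, so \<open>gauss_shift\<close> turns the
  last factor into the constant \<open>emeasure (gauss h) (A n)\<close>, while everything else is
  \<open>G n\<close>-measurable.\<close>

lemma weighted_cylinder:
  assumes u: "\<And>j. u j \<in> borel_measurable (G j)" and A: "\<And>j. A j \<in> sets borel"
  shows "(\<integral>\<^sup>+\<omega>. ennreal (weight u n \<omega>) * (\<Prod>j<n. indicator (A j) (e j \<omega> + h *\<^sub>R u j \<omega>)) \<partial>M)
       = (\<Prod>j<n. emeasure (gauss h) (A j))"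
proof (induction n)
  case 0
  then show ?case
    by (simp add: weight_def emeasure_space_1)
next
  case (Suc n)
  note [measurable] = A
  define Q where "Q \<omega> = ennreal (weight u n \<omega>) * (\<Prod>j<n. indicator (A j) (e j \<omega> + h *\<^sub>R u j \<omega>))" for \<omega>
  have Q[measurable]: "Q \<in> borel_measurable (G n)"
    unfolding Q_def[abs_def]
  proof (intro borel_measurable_times_ennreal borel_measurable_prod_ennreal)
    show "(\<lambda>\<omega>. ennreal (weight u n \<omega>)) \<in> borel_measurable (G n)"
      using weight_measurable_G[OF u] by measurable
    fix j assume j: "j \<in> {..<n}"
    have [measurable]: "u j \<in> borel_measurable (G n)" "e j \<in> borel_measurable (G n)"
      using j by (auto intro: G_measurable_mono[OF u] G_measurable_mono[OF e_measurable])
    show "(\<lambda>\<omega>. indicator (A j) (e j \<omega> + h *\<^sub>R u j \<omega>) :: ennreal) \<in> borel_measurable (G n)"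
      by measurable
  qed
  note [measurable] = u
  define \<Psi> where "\<Psi> \<omega> z = Q \<omega> * (ennreal (exp (- (u n \<omega> \<bullet> z) - h * (norm (u n \<omega>))\<^sup>2 / 2))
      * indicator (A n) (z + h *\<^sub>R u n \<omega>))" for \<omega> z
  have "(\<integral>\<^sup>+\<omega>. ennreal (weight u (Suc n) \<omega>) * (\<Prod>j<Suc n. indicator (A j) (e j \<omega> + h *\<^sub>R u j \<omega>)) \<partial>M)
      = (\<integral>\<^sup>+\<omega>. \<Psi> \<omega> (e n \<omega>) \<partial>M)"
    by (intro nn_integral_cong)
       (simp add: weight_def \<Psi>_def Q_def ennreal_mult[OF exp_ge_zero prod_nonneg] mult_ac)
  also have "\<dots> = (\<integral>\<^sup>+\<omega>. (\<integral>\<^sup>+z. \<Psi> \<omega> z \<partial>gauss h) \<partial>M)"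
    by (intro nn_integral_indep_noise) (unfold \<Psi>_def, measurable)
  also have "\<dots> = (\<integral>\<^sup>+\<omega>. Q \<omega> * emeasure (gauss h) (A n) \<partial>M)"
    unfolding \<Psi>_def
    by (subst nn_integral_cmult, simp, subst gauss_shift[OF h_pos]) auto
  also have "\<dots> = (\<Prod>j<Suc n. emeasure (gauss h) (A j))"
    using Suc.IH G_measurable_M[OF Q]
    by (subst nn_integral_multc) (auto simp: Q_def[abs_def])
  finally show ?case .
qed

text \<open>Taking every \<open>A j\<close> to be the whole space in the cylinder formula gives mean
  one for adapted shifts of whatever size.\<close>

lemma nn_integral_weight:
  assumes u: "\<And>j. u j \<in> borel_measurable (G j)"
  shows "(\<integral>\<^sup>+\<omega>. ennreal (weight u n \<omega>) \<partial>M) = 1"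
proof -
  have "emeasure (gauss h :: (real ^ 'd) measure) UNIV = 1"
    using prob_space.emeasure_space_1[OF prob_space_gauss[OF h_pos]] by (metis space_gauss)
  then show ?thesis
    using weighted_cylinder[OF u, of "\<lambda>_. UNIV" n] by simp
qed

text \<open>A finite product measure is determined by its values on rectangles, and there the claim
  is the cylinder formula.\<close>

theorem discrete_girsanov:
  assumes u: "\<And>j. u j \<in> borel_measurable (G j)"
  shows "distr (density M (\<lambda>\<omega>. ennreal (weight u n \<omega>))) (\<Pi>\<^sub>M j\<in>{..<n}. borel)
            (\<lambda>\<omega>. \<lambda>j\<in>{..<n}. e j \<omega> + h *\<^sub>R u j \<omega>)
       = (\<Pi>\<^sub>M j\<in>{..<n}. gauss h)"
proof -
  interpret gs: prob_space "gauss h :: (real ^ 'd) measure"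
    using h_pos by (rule prob_space_gauss)
  interpret product_sigma_finite "\<lambda>_::nat. gauss h :: (real ^ 'd) measure" ..
  have [measurable]: "u j \<in> borel_measurable M" for j
    using u by (rule G_measurable_M)
  have [measurable]: "weight u n \<in> borel_measurable M"
    using weight_measurable_G[OF u] by (rule G_measurable_M)
  show ?thesis
  proof (rule PiM_eqI)
    show "finite {..<n}"
      by simp
    show "sets (distr (density M (\<lambda>\<omega>. ennreal (weight u n \<omega>))) (\<Pi>\<^sub>M j\<in>{..<n}. borel)
            (\<lambda>\<omega>. \<lambda>j\<in>{..<n}. e j \<omega> + h *\<^sub>R u j \<omega>)) = sets (\<Pi>\<^sub>M j\<in>{..<n}. gauss h)"
      by (simp cong: sets_PiM_cong)
    fix A :: "nat \<Rightarrow> (real ^ 'd) set" assume "\<And>j. j \<in> {..<n} \<Longrightarrow> A j \<in> sets (gauss h)"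
    then have A: "\<And>j. j < n \<Longrightarrow> A j \<in> sets borel"
      by auto
    \<comment> \<open>The cylinder formula asks for a whole sequence of Borel sets, while
      \<open>A\<close> is only controlled below \<open>n\<close>.\<close>
    define B where "B j = (if j < n then A j else UNIV)" for j
    have B[measurable]: "B j \<in> sets borel" for j
      using A by (auto simp: B_def)
    have AB: "Pi\<^sub>E {..<n} A = Pi\<^sub>E {..<n} B"
      by (rule PiE_cong) (simp add: B_def)
    have meas: "(\<lambda>\<omega>. \<lambda>j\<in>{..<n}. e j \<omega> + h *\<^sub>R u j \<omega>) \<in> measurable M (\<Pi>\<^sub>M j\<in>{..<n}. borel)"
      by measurable
    have ind: "indicator (Pi\<^sub>E {..<n} B) (\<lambda>j\<in>{..<n}. e j \<omega> + h *\<^sub>R u j \<omega>)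
        = (\<Prod>j<n. indicator (B j) (e j \<omega> + h *\<^sub>R u j \<omega>) :: ennreal)" for \<omega>
    proof (cases "\<forall>j<n. e j \<omega> + h *\<^sub>R u j \<omega> \<in> B j")
      case True
      then show ?thesis
        by (auto simp: PiE_iff indicator_def intro!: prod.neutral[symmetric])
    next
      case False
      then have "(\<Prod>j<n. indicator (B j) (e j \<omega> + h *\<^sub>R u j \<omega>) :: ennreal) = 0"
        by (auto simp: indicator_def)
      moreover have "(\<lambda>j\<in>{..<n}. e j \<omega> + h *\<^sub>R u j \<omega>) \<notin> Pi\<^sub>E {..<n} B"
        using False by (auto simp: PiE_iff)
      ultimately show ?thesis
        by simp
    qed
    have S: "Pi\<^sub>E {..<n} B \<in> sets (\<Pi>\<^sub>M j\<in>{..<n}. borel)"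
      by (intro sets_PiM_I_finite) auto
    have "emeasure (distr (density M (\<lambda>\<omega>. ennreal (weight u n \<omega>))) (\<Pi>\<^sub>M j\<in>{..<n}. borel)
            (\<lambda>\<omega>. \<lambda>j\<in>{..<n}. e j \<omega> + h *\<^sub>R u j \<omega>)) (Pi\<^sub>E {..<n} B)
        = (\<integral>\<^sup>+\<omega>. ennreal (weight u n \<omega>) * indicator (Pi\<^sub>E {..<n} B) (\<lambda>j\<in>{..<n}. e j \<omega> + h *\<^sub>R u j \<omega>) \<partial>M)"
      using S meas
      by (subst nn_integral_indicator[symmetric], simp, subst nn_integral_distr, simp, simp,
          subst nn_integral_density) auto
    also have "\<dots> = (\<Prod>j<n. emeasure (gauss h) (B j))"
      unfolding ind by (rule weighted_cylinder[OF u B])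
    also have "\<dots> = (\<Prod>j\<in>{..<n}. emeasure (gauss h) (A j))"
      by (intro prod.cong) (auto simp: B_def)
    finally show "emeasure (distr (density M (\<lambda>\<omega>. ennreal (weight u n \<omega>))) (\<Pi>\<^sub>M j\<in>{..<n}. borel)
            (\<lambda>\<omega>. \<lambda>j\<in>{..<n}. e j \<omega> + h *\<^sub>R u j \<omega>)) (Pi\<^sub>E {..<n} A)
        = (\<Prod>j\<in>{..<n}. emeasure (gauss h) (A j))"
      by (simp add: AB)
  qed
qed

end

section \<open>Entropy and total variation under a shift of the noise\<close>

lemma nn_integral_gauss_uminus:
  assumes [measurable]: "g \<in> borel_measurable borel"
  shows "(\<integral>\<^sup>+z. g (- z) \<partial>(gauss h :: (real ^ 'd) measure)) = (\<integral>\<^sup>+z. g z \<partial>gauss h)"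
proof -
  let ?p = "\<lambda>z::real ^ 'd. ennreal (\<Prod>i\<in>UNIV. normal_density 0 (sqrt h) (z $ i))"
  have L: "(lborel :: (real ^ 'd) measure) = distr lborel borel uminus"
    using lborel_affine[of "-1" "0 :: real ^ 'd"] by (simp add: density_1 uminus_add_conv_diff)
  have "(\<integral>\<^sup>+z. g z \<partial>gauss h) = (\<integral>\<^sup>+z. ?p z * g z \<partial>distr lborel borel uminus)"
    by (simp add: gauss_def nn_integral_density flip: L)
  also have "\<dots> = (\<integral>\<^sup>+z. ?p z * g (- z) \<partial>lborel)"
    by (subst nn_integral_distr) (auto simp: normal_density_def)
  also have "\<dots> = (\<integral>\<^sup>+z. g (- z) \<partial>gauss h)"
    by (simp add: gauss_def nn_integral_density)
  finally show ?thesis ..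
qed

text \<open>For \<open>x \<ge> 1\<close> the left side vanishes. Below 1, the right side minus the
  left side has derivative \<open>2 * (1 - y) * (1 - 1 / y)\<close>, which is nonpositive, so it
  decreases to its value zero at 1.\<close>

lemma square_pos_part_le_entropy:
  fixes x :: real
  assumes "x > 0"
  shows "(max 0 (1 - x))\<^sup>2 \<le> 2 * (x - 1 - ln x)"
proof (cases "x \<ge> 1")
  case True
  then show ?thesis
    using ln_le_minus_one[OF assms] by simp
next
  case False
  let ?f = "\<lambda>y::real. 2 * (y - 1 - ln y) - (1 - y)\<^sup>2"
  have "?f 1 \<le> ?f x"
  proof (rule DERIV_nonpos_imp_nonincreasing[of x 1 ?f])
    show "x \<le> 1"
      using False by simp
    fix y assume y: "x \<le> y" "y \<le> 1"
    with assms have "y > 0"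
      by simp
    then have "(?f has_real_derivative 2 * (1 - y) * (1 - 1 / y)) (at y)"
      by (auto intro!: derivative_eq_intros simp: field_simps)
    moreover have "2 * (1 - y) * (1 - 1 / y) \<le> 0"
      using y \<open>y > 0\<close> by (intro mult_nonneg_nonpos) (auto simp: field_simps)
    ultimately show "\<exists>l. (?f has_real_derivative l) (at y) \<and> l \<le> 0"
      by blast
  qed
  then show ?thesis
    using False by simp
qed

lemma (in prob_space) expectation_le_sqrt:
  fixes X :: "'a \<Rightarrow> real"
  assumes "integrable M X" "integrable M (\<lambda>\<omega>. (X \<omega>)\<^sup>2)"
  shows "expectation X \<le> sqrt (expectation (\<lambda>\<omega>. (X \<omega>)\<^sup>2))"
proof -
  have "(expectation X)\<^sup>2 \<le> expectation (\<lambda>\<omega>. (X \<omega>)\<^sup>2)"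
    using variance_eq[OF assms] variance_positive[of X] by simp
  then show ?thesis
    by (rule real_le_rsqrt)
qed

context gaussian_noise
begin

lemma nn_integral_noise:
  assumes [measurable]: "g \<in> borel_measurable borel"
  shows "(\<integral>\<^sup>+\<omega>. g (e j \<omega>) \<partial>M) = (\<integral>\<^sup>+z. g z \<partial>gauss h)"
  by (subst e_law[of j, symmetric], subst nn_integral_distr) auto

lemma integrable_noise_square: "integrable M (\<lambda>\<omega>. (norm (e j \<omega>))\<^sup>2)"
proof -
  obtain c where "c \<ge> 0" and "\<forall>h>0. (\<integral>\<^sup>+z. ennreal (norm z ^ (2 * 1)) \<partial>(gauss h :: (real ^ 'd) measure)) \<le> ennreal (c * h ^ 1)"
    using gauss_moment_even[where ?'d = 'd, of 1] by blast
  then have "(\<integral>\<^sup>+\<omega>. ennreal ((norm (e j \<omega>))\<^sup>2) \<partial>M) \<le> ennreal (c * h)"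
    using h_pos nn_integral_noise[of "\<lambda>z. ennreal ((norm z)\<^sup>2)" j] by simp
  then show ?thesis
    by (intro integrableI_bounded) (auto simp: order_le_less_trans)
qed

text \<open>With \<open>U\<close> frozen, the reflection of \<open>z\<close> preserves the Gaussian
  law and exchanges the positive and the negative part of the inner product, so these two parts have
  the same integral.\<close>

lemma noise_orthogonal:
  assumes U: "U \<in> borel_measurable (G j)" and int: "integrable M (\<lambda>\<omega>. (norm (U \<omega>))\<^sup>2)"
  shows "integrable M (\<lambda>\<omega>. U \<omega> \<bullet> e j \<omega>)" and "expectation (\<lambda>\<omega>. U \<omega> \<bullet> e j \<omega>) = 0"
proof -
  have m: "(\<lambda>(\<omega>, z). ennreal (U \<omega> \<bullet> z)) \<in> borel_measurable (G j \<Otimes>\<^sub>M borel)"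
    "(\<lambda>(\<omega>, z). ennreal (- (U \<omega> \<bullet> z))) \<in> borel_measurable (G j \<Otimes>\<^sub>M borel)"
    using U by measurable
  have [measurable]: "U \<in> borel_measurable M"
    using U by (rule G_measurable_M)
  show *: "integrable M (\<lambda>\<omega>. U \<omega> \<bullet> e j \<omega>)"
  proof (rule Bochner_Integration.integrable_bound)
    show "integrable M (\<lambda>\<omega>. (norm (U \<omega>))\<^sup>2 + (norm (e j \<omega>))\<^sup>2)"
      using int integrable_noise_square by simp
    have "\<bar>U \<omega> \<bullet> e j \<omega>\<bar> \<le> (norm (U \<omega>))\<^sup>2 + (norm (e j \<omega>))\<^sup>2" for \<omega>
    proof -
      have "2 * (norm (U \<omega>) * norm (e j \<omega>)) \<le> (norm (U \<omega>))\<^sup>2 + (norm (e j \<omega>))\<^sup>2"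
        using sum_squares_bound[of "norm (U \<omega>)" "norm (e j \<omega>)"] by simp
      moreover have "0 \<le> norm (U \<omega>) * norm (e j \<omega>)"
        by simp
      ultimately show ?thesis
        using Cauchy_Schwarz_ineq2[of "U \<omega>" "e j \<omega>"] by linarith
    qed
    then show "AE \<omega> in M. norm (U \<omega> \<bullet> e j \<omega>) \<le> norm ((norm (U \<omega>))\<^sup>2 + (norm (e j \<omega>))\<^sup>2)"
      by auto
  qed simp
  have "(\<integral>\<^sup>+\<omega>. ennreal (U \<omega> \<bullet> e j \<omega>) \<partial>M) = (\<integral>\<^sup>+\<omega>. (\<integral>\<^sup>+z. ennreal (U \<omega> \<bullet> z) \<partial>gauss h) \<partial>M)"
    using m(1) by (rule nn_integral_indep_noise)
  also have "\<dots> = (\<integral>\<^sup>+\<omega>. (\<integral>\<^sup>+z. ennreal (- (U \<omega> \<bullet> z)) \<partial>gauss h) \<partial>M)"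
    using nn_integral_gauss_uminus[of "\<lambda>z. ennreal (- (U \<omega> \<bullet> z))" h for \<omega>] by simp
  also have "\<dots> = (\<integral>\<^sup>+\<omega>. ennreal (- (U \<omega> \<bullet> e j \<omega>)) \<partial>M)"
    using m(2) by (rule nn_integral_indep_noise[symmetric])
  finally show "expectation (\<lambda>\<omega>. U \<omega> \<bullet> e j \<omega>) = 0"
    using * by (simp add: real_lebesgue_integral_def)
qed

lemma weight_integrable:
  assumes u: "\<And>j. u j \<in> borel_measurable (G j)"
  shows "integrable M (weight u n)" and "expectation (weight u n) = 1"
proof -
  have [measurable]: "weight u n \<in> borel_measurable M"
    using weight_measurable_G[OF u] by (rule G_measurable_M)
  have pos: "AE \<omega> in M. 0 \<le> weight u n \<omega>"
    using weight_pos[of u n] by (auto intro: less_imp_le)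
  show "integrable M (weight u n)"
    using nn_integral_weight[OF u] pos by (intro integrableI_nonneg) auto
  show "expectation (weight u n) = 1"
    using nn_integral_weight[OF u] pos by (simp add: integral_eq_nn_integral)
qed

text \<open>As the density has mean one, its L1 distance to 1 is twice the mean of the positive part
  \<open>P\<close> of \<open>1 - weight u n\<close>. The mean of \<open>P\<close> is at most the
  root of the mean of its square, which the entropy inequality bounds by twice the mean of
  \<open>- ln (weight u n)\<close>. There the terms linear in the noise have mean zero, and
  \<open>h / 2\<close> times the sum of the second moments remains.\<close>

lemma weight_L1:
  assumes u: "\<And>j. u j \<in> borel_measurable (G j)"
    and int: "\<And>j. j < n \<Longrightarrow> integrable M (\<lambda>\<omega>. (norm (u j \<omega>))\<^sup>2)"
  shows "expectation (\<lambda>\<omega>. \<bar>1 - weight u n \<omega>\<bar>) \<le> 2 * sqrt (h * (\<Sum>j<n. expectation (\<lambda>\<omega>. (norm (u j \<omega>))\<^sup>2)))"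
proof -
  let ?R = "weight u n"
  have [measurable]: "?R \<in> borel_measurable M"
    using weight_measurable_G[OF u] by (rule G_measurable_M)
  define P where "P \<omega> = max 0 (1 - ?R \<omega>)" for \<omega>
  have [measurable]: "P \<in> borel_measurable M"
    unfolding P_def[abs_def] by measurable
  have P01: "0 \<le> P \<omega>" "P \<omega> \<le> 1" for \<omega>
    using weight_pos[of u n \<omega>] by (auto simp: P_def)
  have intP: "integrable M P" "integrable M (\<lambda>\<omega>. (P \<omega>)\<^sup>2)"
    using P01 by (auto intro!: integrable_const_bound[where B = 1] simp: power_le_one)
  have ln: "- ln (?R \<omega>) = (\<Sum>j<n. u j \<omega> \<bullet> e j \<omega> + h * (norm (u j \<omega>))\<^sup>2 / 2)" for \<omega>
    unfolding weight_def by (simp add: ln_prod sum_negf[symmetric] add.commute)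
  have int_ln: "integrable M (\<lambda>\<omega>. \<Sum>j<n. u j \<omega> \<bullet> e j \<omega> + h * (norm (u j \<omega>))\<^sup>2 / 2)"
    using noise_orthogonal(1)[OF u int] int by (intro Bochner_Integration.integrable_sum) auto
  have E_ln: "expectation (\<lambda>\<omega>. \<Sum>j<n. u j \<omega> \<bullet> e j \<omega> + h * (norm (u j \<omega>))\<^sup>2 / 2)
      = h / 2 * (\<Sum>j<n. expectation (\<lambda>\<omega>. (norm (u j \<omega>))\<^sup>2))"
    using noise_orthogonal[OF u int] int
    by (subst Bochner_Integration.integral_sum) (auto simp: sum_distrib_left)
  have "expectation (\<lambda>\<omega>. (P \<omega>)\<^sup>2)
      \<le> expectation (\<lambda>\<omega>. 2 * (?R \<omega> - 1 + (\<Sum>j<n. u j \<omega> \<bullet> e j \<omega> + h * (norm (u j \<omega>))\<^sup>2 / 2)))"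
  proof (rule integral_mono)
    show "integrable M (\<lambda>\<omega>. 2 * (?R \<omega> - 1 + (\<Sum>j<n. u j \<omega> \<bullet> e j \<omega> + h * (norm (u j \<omega>))\<^sup>2 / 2)))"
      using weight_integrable[OF u] int_ln by auto
    show "(P \<omega>)\<^sup>2 \<le> 2 * (?R \<omega> - 1 + (\<Sum>j<n. u j \<omega> \<bullet> e j \<omega> + h * (norm (u j \<omega>))\<^sup>2 / 2))" for \<omega>
      using square_pos_part_le_entropy[OF weight_pos[of u n \<omega>]] unfolding P_def ln[symmetric] by simp
  qed (fact intP)
  also have "\<dots> = h * (\<Sum>j<n. expectation (\<lambda>\<omega>. (norm (u j \<omega>))\<^sup>2))"
    using weight_integrable[OF u] int_ln by (simp add: E_ln prob_space)
  finally have "expectation P \<le> sqrt (h * (\<Sum>j<n. expectation (\<lambda>\<omega>. (norm (u j \<omega>))\<^sup>2)))"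
    using expectation_le_sqrt[OF intP] by (meson order_trans real_sqrt_le_iff)
  moreover have "expectation (\<lambda>\<omega>. \<bar>1 - ?R \<omega>\<bar>) = 2 * expectation P"
  proof -
    have "(\<lambda>\<omega>. \<bar>1 - ?R \<omega>\<bar>) = (\<lambda>\<omega>. 2 * P \<omega> - (1 - ?R \<omega>))"
      by (simp add: P_def fun_eq_iff max_def abs_if)
    then show ?thesis
      using intP weight_integrable[OF u] by (simp add: prob_space)
  qed
  ultimately show ?thesis
    by simp
qed

text \<open>The change of measure rewrites the mean over the plain increments as a weighted mean
  over the shifted ones. The difference is then the mean of \<open>g\<close> at the shifted
  increments times \<open>1 - weight u n\<close>, which the L1 bound controls.\<close>

theorem noise_shift_tv:
  assumes u: "\<And>j. u j \<in> borel_measurable (G j)"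
    and int: "\<And>j. j < n \<Longrightarrow> integrable M (\<lambda>\<omega>. (norm (u j \<omega>))\<^sup>2)"
    and g: "g \<in> borel_measurable (\<Pi>\<^sub>M j\<in>{..<n}. borel)"
    and bound: "\<And>w. \<bar>g w\<bar> \<le> (c::real)"
  shows "\<bar>expectation (\<lambda>\<omega>. g (\<lambda>j\<in>{..<n}. e j \<omega> + h *\<^sub>R u j \<omega>)) - expectation (\<lambda>\<omega>. g (\<lambda>j\<in>{..<n}. e j \<omega>))\<bar>
      \<le> c * (2 * sqrt (h * (\<Sum>j<n. expectation (\<lambda>\<omega>. (norm (u j \<omega>))\<^sup>2))))"
proof -
  have "c \<ge> 0"
    using bound[of undefined] by linarith
  note [measurable] = G_measurable_M[OF u] g
  have Rm[measurable]: "weight u n \<in> borel_measurable M"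
    using weight_measurable_G[OF u] by (rule G_measurable_M)
  let ?E = "\<lambda>\<omega>. \<lambda>j\<in>{..<n}. e j \<omega> + h *\<^sub>R u j \<omega>"
  have E[measurable]: "?E \<in> measurable M (\<Pi>\<^sub>M j\<in>{..<n}. borel)"
    by measurable
  have gE[measurable]: "(\<lambda>\<omega>. g (?E \<omega>)) \<in> borel_measurable M"
    using E g by (rule measurable_compose)
  \<comment> \<open>The zero shift has density one, so the same theorem yields the joint law of the
    plain increments.\<close>
  have zero: "distr M (\<Pi>\<^sub>M j\<in>{..<n}. borel) (\<lambda>\<omega>. \<lambda>j\<in>{..<n}. e j \<omega>) = (\<Pi>\<^sub>M j\<in>{..<n}. gauss h)"
    using discrete_girsanov[of "\<lambda>_ _. 0" n] by (simp add: weight_def[abs_def] density_1)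
  have e: "(\<lambda>\<omega>. \<lambda>j\<in>{..<n}. e j \<omega>) \<in> measurable M (\<Pi>\<^sub>M j\<in>{..<n}. borel)"
    by measurable
  have "expectation (\<lambda>\<omega>. g (\<lambda>j\<in>{..<n}. e j \<omega>)) = (\<integral>w. g w \<partial>(\<Pi>\<^sub>M j\<in>{..<n}. gauss h))"
    unfolding zero[symmetric] using e g by (subst integral_distr) auto
  also have "\<dots> = (\<integral>\<omega>. g (?E \<omega>) \<partial>density M (\<lambda>\<omega>. ennreal (weight u n \<omega>)))"
    unfolding discrete_girsanov[OF u, symmetric] using E g by (subst integral_distr) auto
  also have "\<dots> = expectation (\<lambda>\<omega>. weight u n \<omega> * g (?E \<omega>))"
    using weight_pos[of u n] by (subst integral_density) (auto intro: less_imp_le)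
  finally have eq: "expectation (\<lambda>\<omega>. g (\<lambda>j\<in>{..<n}. e j \<omega>)) = expectation (\<lambda>\<omega>. weight u n \<omega> * g (?E \<omega>))" .
  have int1: "integrable M (\<lambda>\<omega>. g (?E \<omega>))"
    using bound by (intro integrable_const_bound[where B = c]) auto
  have int2: "integrable M (\<lambda>\<omega>. weight u n \<omega> * g (?E \<omega>))"
  proof (rule Bochner_Integration.integrable_bound)
    show "integrable M (\<lambda>\<omega>. c * weight u n \<omega>)"
      using weight_integrable[OF u] by simp
    have "\<bar>weight u n \<omega> * g (?E \<omega>)\<bar> \<le> \<bar>c * weight u n \<omega>\<bar>" for \<omega>
      using bound[of "?E \<omega>"] weight_pos[of u n \<omega>] \<open>c \<ge> 0\<close> by (simp add: abs_mult mult.commute)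
    then show "AE \<omega> in M. norm (weight u n \<omega> * g (?E \<omega>)) \<le> norm (c * weight u n \<omega>)"
      by simp
  qed simp
  have int3: "integrable M (\<lambda>\<omega>. c * \<bar>1 - weight u n \<omega>\<bar>)"
    using weight_integrable[OF u] by auto
  have "\<bar>expectation (\<lambda>\<omega>. g (?E \<omega>)) - expectation (\<lambda>\<omega>. g (\<lambda>j\<in>{..<n}. e j \<omega>))\<bar>
      = \<bar>expectation (\<lambda>\<omega>. g (?E \<omega>) - weight u n \<omega> * g (?E \<omega>))\<bar>"
    unfolding eq using int1 int2 by simp
  also have "\<dots> \<le> expectation (\<lambda>\<omega>. c * \<bar>1 - weight u n \<omega>\<bar>)"
  proof (rule order_trans[OF integral_abs_bound integral_mono])
    show "integrable M (\<lambda>\<omega>. \<bar>g (?E \<omega>) - weight u n \<omega> * g (?E \<omega>)\<bar>)"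
      using int1 int2 by (intro integrable_abs Bochner_Integration.integrable_diff)
    show "integrable M (\<lambda>\<omega>. c * \<bar>1 - weight u n \<omega>\<bar>)"
      by (fact int3)
    fix \<omega>
    have "g (?E \<omega>) - weight u n \<omega> * g (?E \<omega>) = g (?E \<omega>) * (1 - weight u n \<omega>)"
      by (simp add: algebra_simps)
    then show "\<bar>g (?E \<omega>) - weight u n \<omega> * g (?E \<omega>)\<bar> \<le> c * \<bar>1 - weight u n \<omega>\<bar>"
      using mult_right_mono[OF bound[of "?E \<omega>"] abs_ge_zero[of "1 - weight u n \<omega>"]] by (simp add: abs_mult)
  qed
  also have "\<dots> \<le> c * (2 * sqrt (h * (\<Sum>j<n. expectation (\<lambda>\<omega>. (norm (u j \<omega>))\<^sup>2))))"
    using mult_left_mono[OF weight_L1[OF u int] \<open>c \<ge> 0\<close>] by simp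
  finally show ?thesis .
qed

end

section \<open>Hoelder continuity of paths\<close>

definition dyadic_floor :: "nat \<Rightarrow> real \<Rightarrow> real" where
  "dyadic_floor n s = of_int \<lfloor>s * 2 ^ n\<rfloor> / 2 ^ n"

lemma dyadic_floor_le: "dyadic_floor n s \<le> s"
  and dyadic_floor_gt: "s - 1 / 2 ^ n < dyadic_floor n s"
proof -
  show "dyadic_floor n s \<le> s"
    by (simp add: dyadic_floor_def field_simps)
  have "s - 1 / 2 ^ n = (s * 2 ^ n - 1) / 2 ^ n"
    by (simp add: field_simps)
  also have "\<dots> < dyadic_floor n s"
    unfolding dyadic_floor_def by (intro divide_strict_right_mono) (linarith, simp)
  finally show "s - 1 / 2 ^ n < dyadic_floor n s" .
qed

lemma dyadic_floor_nonneg: "0 \<le> s \<Longrightarrow> 0 \<le> dyadic_floor n s"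
  by (simp add: dyadic_floor_def)

lemma dyadic_floor_tendsto: "(\<lambda>n. dyadic_floor n s) \<longlonglongrightarrow> s"
proof (rule tendsto_sandwich)
  show "\<forall>\<^sub>F n in sequentially. s - (1 / 2) ^ n \<le> dyadic_floor n s"
    using dyadic_floor_gt[of s] by (auto simp: power_divide intro!: always_eventually less_imp_le)
  show "\<forall>\<^sub>F n in sequentially. dyadic_floor n s \<le> s"
    by (simp add: dyadic_floor_le)
  have "(\<lambda>n. s - (1 / 2) ^ n) \<longlonglongrightarrow> s - 0"
    by (intro tendsto_intros LIMSEQ_power_zero) auto
  then show "(\<lambda>n. s - (1 / 2) ^ n) \<longlonglongrightarrow> s"
    by simp
qed auto

context
  fixes w :: "real \<Rightarrow> 'b::real_normed_vector" and \<gamma> A :: real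
  assumes gamma: "\<gamma> > 0" and A: "A \<ge> 0" and cont: "continuous_on {0..1} w"
    and inc: "\<And>n k. k < 2 ^ n \<Longrightarrow>
      norm (w ((real k + 1) / 2 ^ n) - w (real k / 2 ^ n)) \<le> A * (2 powr - \<gamma>) ^ n"
begin

private abbreviation "q \<equiv> 2 powr - \<gamma>"

lemma q_bounds: "0 < q" "q < 1"
  using gamma powr_less_mono[of "- \<gamma>" 0 2] by auto

text \<open>Doubling a number doubles its floor, possibly plus one, so one refinement of the grid
  moves the approximation by at most one cell of the finer level.\<close>

lemma dyadic_step:
  assumes s: "0 \<le> s" "s \<le> 1"
  shows "norm (w (dyadic_floor (Suc n) s) - w (dyadic_floor n s)) \<le> A * q ^ Suc n"
proof -
  let ?k = "\<lfloor>s * 2 ^ n\<rfloor>" and ?l = "\<lfloor>s * 2 ^ Suc n\<rfloor>"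
  have kl: "?l = 2 * ?k \<or> ?l = 2 * ?k + 1"
    unfolding power_Suc by linarith
  have k0: "?k \<ge> 0"
    using s by simp
  have D: "dyadic_floor n s = real_of_int (2 * ?k) / 2 ^ Suc n"
    by (simp add: dyadic_floor_def)
  from kl show ?thesis
  proof
    assume "?l = 2 * ?k"
    then show ?thesis
      using A q_bounds unfolding D by (simp add: dyadic_floor_def)
  next
    assume l: "?l = 2 * ?k + 1"
    \<comment> \<open>The increment bound requires a cell inside the unit interval: since
      \<open>?l \<le> 2 ^ Suc n\<close>, its predecessor \<open>2 * ?k\<close> is an admissible
      index.\<close>
    have "s * 2 ^ Suc n \<le> 2 ^ Suc n"
      using s by simp
    then have "?l \<le> 2 ^ Suc n"
      by (metis floor_mono floor_of_int of_int_numeral of_int_power)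
    then have "nat (2 * ?k) < 2 ^ Suc n"
      using l k0 by (simp add: nat_less_iff)
    from inc[OF this] show ?thesis
      using k0 l unfolding D by (simp add: dyadic_floor_def)
  qed
qed

text \<open>The moves between consecutive levels beyond \<open>n\<close> form a geometric series
  with sum \<open>q ^ n * (q / (1 - q))\<close> up to the factor \<open>A\<close>. Continuity of
  \<open>w\<close> identifies the limit of the dyadic approximations.\<close>

lemma dyadic_tail:
  assumes s: "0 \<le> s" "s \<le> 1"
  shows "norm (w s - w (dyadic_floor n s)) \<le> A * q ^ n * (q / (1 - q))"
proof -
  let ?c = "q / (1 - q)"
  have c: "?c * (1 - q) = q" "?c \<ge> 0"
    using q_bounds by auto
  have partial: "norm (w (dyadic_floor (n + m) s) - w (dyadic_floor n s)) \<le> A * q ^ n * (?c * (1 - q ^ m))" for m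
  proof (induction m)
    case (Suc m)
    have "norm (w (dyadic_floor (n + Suc m) s) - w (dyadic_floor n s))
        \<le> norm (w (dyadic_floor (Suc (n + m)) s) - w (dyadic_floor (n + m) s))
          + norm (w (dyadic_floor (n + m) s) - w (dyadic_floor n s))"
      by (metis add_Suc_right diff_add_cancel diff_add_eq norm_triangle_ineq add_diff_eq)
    also have "\<dots> \<le> A * q ^ Suc (n + m) + A * q ^ n * (?c * (1 - q ^ m))"
      using dyadic_step[OF s, of "n + m"] Suc.IH by simp
    also have "\<dots> = A * q ^ n * (q ^ m * (?c * (1 - q)) + ?c * (1 - q ^ m))"
      unfolding c by (simp add: power_add algebra_simps)
    also have "\<dots> = A * q ^ n * (?c * (1 - q ^ Suc m))"
      by (simp add: algebra_simps del: times_divide_eq_left times_divide_eq_right)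
    finally show ?case .
  qed simp
  have le: "norm (w (dyadic_floor (n + m) s) - w (dyadic_floor n s)) \<le> A * q ^ n * ?c" for m
  proof -
    have "?c * (1 - q ^ m) \<le> ?c * 1"
      using c q_bounds by (intro mult_left_mono) auto
    then have "A * q ^ n * (?c * (1 - q ^ m)) \<le> A * q ^ n * ?c"
      using A q_bounds by (intro mult_left_mono) auto
    then show ?thesis
      using partial[of m] by linarith
  qed
  have "(\<lambda>m. w (dyadic_floor (m + n) s)) \<longlonglongrightarrow> w s"
  proof (rule continuous_on_tendsto_compose[OF cont])
    show "(\<lambda>m. dyadic_floor (m + n) s) \<longlonglongrightarrow> s"
      using dyadic_floor_tendsto by (rule LIMSEQ_ignore_initial_segment)
    show "\<forall>\<^sub>F m in sequentially. dyadic_floor (m + n) s \<in> {0..1}"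
      using s dyadic_floor_le[of _ s] dyadic_floor_nonneg[of s]
      by (intro always_eventually allI) (auto intro: order_trans)
  qed (use s in auto)
  then have "(\<lambda>m. norm (w (dyadic_floor (n + m) s) - w (dyadic_floor n s))) \<longlonglongrightarrow> norm (w s - w (dyadic_floor n s))"
    by (intro tendsto_intros) (simp add: add.commute)
  then show ?thesis
    by (rule Lim_bounded[where M = 0]) (use le in auto)
qed

text \<open>At the level \<open>n\<close> with
  \<open>(1 / 2) ^ Suc n < \<bar>s - r\<bar> \<le> (1 / 2) ^ n\<close> the two dyadic floors agree
  or are neighbours. Two tails and one increment then bound the distance, which gives the factor
  \<open>2 * (q / (1 - q)) + 1\<close>; the factor \<open>2 powr \<gamma>\<close> is the price of
  the one level between \<open>q ^ n\<close> and \<open>q ^ Suc n\<close>.\<close>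

lemma dyadic_chaining:
  assumes s: "0 \<le> s" "s \<le> 1" and r: "0 \<le> r" "r \<le> 1"
  shows "norm (w s - w r) \<le> (2 * (q / (1 - q)) + 1) * 2 powr \<gamma> * A * \<bar>s - r\<bar> powr \<gamma>"
proof (cases "s = r")
  case False
  let ?c = "q / (1 - q)"
  define d where "d = \<bar>s - r\<bar>"
  have d: "0 < d" "d \<le> 1"
    using False s r by (auto simp: d_def)
  define n where "n = (LEAST n. (1 / 2) ^ Suc n < d)"
  have ex: "\<exists>n. (1 / 2) ^ Suc n < d"
  proof -
    obtain m where "(1 / 2 :: real) ^ m < d"
      using real_arch_pow_inv[OF d(1), of "1 / 2"] by auto
    moreover have "(1 / 2 :: real) ^ Suc m \<le> (1 / 2) ^ m"
      by simp
    ultimately show ?thesis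
      by (meson order_le_less_trans)
  qed
  have n1: "(1 / 2) ^ Suc n < d"
    unfolding n_def using ex by (rule LeastI_ex)
  have n2: "d \<le> (1 / 2) ^ n"
  proof (cases n)
    case (Suc m)
    then have "\<not> (1 / 2) ^ Suc m < d"
      using not_less_Least[of m "\<lambda>n. (1 / 2) ^ Suc n < d"] by (simp add: n_def)
    then show ?thesis
      by (simp add: Suc)
  qed (use d in simp)
  have half: "q = (1 / 2) powr \<gamma>"
    by (simp add: powr_minus powr_divide inverse_eq_divide)
  have qn: "q ^ n \<le> 2 powr \<gamma> * d powr \<gamma>"
  proof -
    have "q ^ n = 2 powr \<gamma> * q ^ Suc n"
      by (simp add: powr_minus)
    also have "q ^ Suc n = ((1 / 2) ^ Suc n) powr \<gamma>"
      by (subst half) (simp add: powr_realpow[symmetric] powr_powr mult.commute del: power_Suc)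
    also have "2 powr \<gamma> * \<dots> \<le> 2 powr \<gamma> * d powr \<gamma>"
      using n1 gamma by (intro mult_left_mono powr_mono2) auto
    finally show ?thesis .
  qed
  have adj: "norm (w (dyadic_floor n x) - w (dyadic_floor n y)) \<le> A * q ^ n"
    if "0 \<le> y" "y \<le> x" "x \<le> 1" "x - y \<le> (1 / 2) ^ n" for x y
  proof -
    have "x * 2 ^ n - y * 2 ^ n \<le> 1"
      using that(4) by (simp add: field_simps power_divide)
    moreover have "y * 2 ^ n \<le> x * 2 ^ n"
      using that by simp
    ultimately have "\<lfloor>x * 2 ^ n\<rfloor> = \<lfloor>y * 2 ^ n\<rfloor> \<or> \<lfloor>x * 2 ^ n\<rfloor> = \<lfloor>y * 2 ^ n\<rfloor> + 1"
      by linarith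
    then show ?thesis
    proof
      assume "\<lfloor>x * 2 ^ n\<rfloor> = \<lfloor>y * 2 ^ n\<rfloor>"
      then show ?thesis
        using A q_bounds by (simp add: dyadic_floor_def)
    next
      assume l: "\<lfloor>x * 2 ^ n\<rfloor> = \<lfloor>y * 2 ^ n\<rfloor> + 1"
      have k0: "\<lfloor>y * 2 ^ n\<rfloor> \<ge> 0"
        using that by simp
      have "x * 2 ^ n \<le> 2 ^ n"
        using that by simp
      then have "\<lfloor>x * 2 ^ n\<rfloor> \<le> 2 ^ n"
        by (metis floor_mono floor_of_int of_int_numeral of_int_power)
      then have "nat \<lfloor>y * 2 ^ n\<rfloor> < 2 ^ n"
        using l k0 by (simp add: nat_less_iff)
      from inc[OF this] show ?thesis
        using k0 by (simp add: dyadic_floor_def l)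
    qed
  qed
  have "norm (w (dyadic_floor n s) - w (dyadic_floor n r)) \<le> A * q ^ n"
    using adj[of r s] adj[of s r] n2 s r by (cases "r \<le> s") (auto simp: d_def norm_minus_commute)
  moreover have "norm (w s - w r) \<le> norm (w s - w (dyadic_floor n s))
      + norm (w (dyadic_floor n s) - w (dyadic_floor n r)) + norm (w r - w (dyadic_floor n r))"
    by norm
  ultimately have "norm (w s - w r) \<le> A * q ^ n * ?c + A * q ^ n + A * q ^ n * ?c"
    using dyadic_tail[OF s, of n] dyadic_tail[OF r, of n] by linarith
  also have "\<dots> = (2 * ?c + 1) * A * q ^ n"
    by (simp add: algebra_simps del: times_divide_eq_left times_divide_eq_right)
  also have "\<dots> \<le> (2 * ?c + 1) * A * (2 powr \<gamma> * d powr \<gamma>)"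
    using qn A q_bounds by (intro mult_left_mono) auto
  finally show ?thesis
    by (simp add: d_def mult_ac)
qed simp

end

text \<open>Chaining reduces the Hoelder seminorm to dyadic increments. Each of them, suitably
  weighted, is dominated by the \<open>p\<close>-th root of the sum \<open>G\<close> of all weighted
  \<open>p\<close>-th powers. This sum has a finite mean since
  \<open>\<gamma> * real p < real m - 1\<close>, and \<open>2 \<le> p\<close> makes the square of
  its root integrable.\<close>

theorem kolmogorov_hoelder:
  fixes W :: "real \<Rightarrow> 'a \<Rightarrow> 'b::{real_normed_vector, second_countable_topology}"
  assumes M: "prob_space M" and T: "T > 0" and gamma: "\<gamma> > 0" and p: "2 \<le> p" "\<gamma> * real p < real m - 1"
    and meas: "\<And>t. 0 \<le> t \<Longrightarrow> W t \<in> borel_measurable M"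
    and moment: "\<And>s t. 0 \<le> s \<Longrightarrow> s < t \<Longrightarrow>
      (\<integral>\<^sup>+\<omega>. ennreal (norm (W t \<omega> - W s \<omega>) ^ p) \<partial>M) \<le> ennreal (K * (t - s) ^ m)"
    and K: "K \<ge> 0"
    and cont: "AE \<omega> in M. continuous_on {0..} (\<lambda>t. W t \<omega>)"
  obtains H where "H \<in> borel_measurable M" "\<And>\<omega>. 0 \<le> H \<omega>" "integrable M (\<lambda>\<omega>. (H \<omega>)\<^sup>2)"
    "AE \<omega> in M. \<forall>s\<in>{0..T}. \<forall>r\<in>{0..T}. norm (W s \<omega> - W r \<omega>) \<le> H \<omega> * \<bar>s - r\<bar> powr \<gamma>"
proof -
  interpret prob_space M
    by fact
  define \<Delta> where "\<Delta> n k \<omega> = norm (W (T * ((real k + 1) / 2 ^ n)) \<omega> - W (T * (real k / 2 ^ n)) \<omega>)"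
    for n k :: nat and \<omega>
  have \<Delta>m[measurable]: "\<Delta> n k \<in> borel_measurable M" for n k
  proof -
    have [measurable]: "W (T * ((real k + 1) / 2 ^ n)) \<in> borel_measurable M"
      "W (T * (real k / 2 ^ n)) \<in> borel_measurable M"
      using T by (auto intro!: meas)
    show ?thesis
      unfolding \<Delta>_def[abs_def] by measurable
  qed
  \<comment> \<open>The sum over all dyadic increments dominates each of them and has a finite expectation.\<close>
  define G where "G \<omega> = (\<Sum>n. \<Sum>k<2 ^ n. ennreal ((\<Delta> n k \<omega> * (2 powr \<gamma>) ^ n) ^ p))" for \<omega>
  have Gm[measurable]: "G \<in> borel_measurable M"
    unfolding G_def[abs_def] by measurable
  \<comment> \<open>Passing to the next level doubles the number of increments, multiplies the
    weights by \<open>(2 powr \<gamma>) ^ p\<close> and the moments by \<open>(1 / 2) ^ m\<close>.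
    The assumption on \<open>p\<close> and \<open>m\<close> makes the product smaller than
    one.\<close>
  define \<rho> where "\<rho> = 2 * (2 powr \<gamma>) ^ p * (1 / 2) ^ m"
  have "\<rho> = 2 powr (1 + \<gamma> * real p - real m)"
    by (simp add: \<rho>_def powr_diff powr_add powr_realpow[symmetric] powr_powr powr_divide)
  then have \<rho>: "0 < \<rho>" "\<rho> < 1"
    using p powr_less_mono[of "1 + \<gamma> * real p - real m" 0 2] by auto
  have "(\<integral>\<^sup>+\<omega>. G \<omega> \<partial>M) = (\<Sum>n. \<Sum>k<2 ^ n. \<integral>\<^sup>+\<omega>. ennreal ((\<Delta> n k \<omega> * (2 powr \<gamma>) ^ n) ^ p) \<partial>M)"
    unfolding G_def by (subst nn_integral_suminf, measurable, subst nn_integral_sum) auto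
  also have "\<dots> \<le> (\<Sum>n. ennreal (K * T ^ m * \<rho> ^ n))"
  proof (intro suminf_le summableI)
    fix n
    have "(\<integral>\<^sup>+\<omega>. ennreal ((\<Delta> n k \<omega> * (2 powr \<gamma>) ^ n) ^ p) \<partial>M)
        \<le> ennreal (((2 powr \<gamma>) ^ n) ^ p * (K * (T / 2 ^ n) ^ m))" for k
    proof -
      have "(\<integral>\<^sup>+\<omega>. ennreal ((\<Delta> n k \<omega> * (2 powr \<gamma>) ^ n) ^ p) \<partial>M)
          = (\<integral>\<^sup>+\<omega>. ennreal (((2 powr \<gamma>) ^ n) ^ p) * ennreal (\<Delta> n k \<omega> ^ p) \<partial>M)"
        by (intro nn_integral_cong) (simp add: power_mult_distrib ennreal_mult'' mult.commute)
      also have "\<dots> = ennreal (((2 powr \<gamma>) ^ n) ^ p) * (\<integral>\<^sup>+\<omega>. ennreal (\<Delta> n k \<omega> ^ p) \<partial>M)"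
        by (intro nn_integral_cmult) measurable
      also have "(\<integral>\<^sup>+\<omega>. ennreal (\<Delta> n k \<omega> ^ p) \<partial>M)
          \<le> ennreal (K * (T * ((real k + 1) / 2 ^ n) - T * (real k / 2 ^ n)) ^ m)"
        unfolding \<Delta>_def using T by (intro moment) (auto simp: field_simps)
      also have "T * ((real k + 1) / 2 ^ n) - T * (real k / 2 ^ n) = T / 2 ^ n"
        by (simp add: field_simps)
      finally show ?thesis
        by (simp add: ennreal_mult'[symmetric] mult_left_mono)
    qed
    then have "(\<Sum>k<2 ^ n. \<integral>\<^sup>+\<omega>. ennreal ((\<Delta> n k \<omega> * (2 powr \<gamma>) ^ n) ^ p) \<partial>M)
        \<le> (\<Sum>k<(2::nat) ^ n. ennreal (((2 powr \<gamma>) ^ n) ^ p * (K * (T / 2 ^ n) ^ m)))"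
      by (intro sum_mono) auto
    also have "\<dots> = ennreal (2 ^ n * (((2 powr \<gamma>) ^ n) ^ p * (K * (T / 2 ^ n) ^ m)))"
      using K T by (simp add: ennreal_mult ennreal_of_nat_eq_real_of_nat[symmetric] ennreal_power[symmetric])
    also have "2 ^ n * (((2 powr \<gamma>) ^ n) ^ p * (K * (T / 2 ^ n) ^ m)) = K * T ^ m * \<rho> ^ n"
      by (simp add: \<rho>_def power_mult_distrib power_divide power_mult[symmetric] mult.commute)
    finally show "(\<Sum>k<2 ^ n. \<integral>\<^sup>+\<omega>. ennreal ((\<Delta> n k \<omega> * (2 powr \<gamma>) ^ n) ^ p) \<partial>M) \<le> ennreal (K * T ^ m * \<rho> ^ n)" .
  qed
  also have "\<dots> = ennreal (\<Sum>n. K * T ^ m * \<rho> ^ n)"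
    using K T \<rho> by (intro suminf_ennreal2) (auto intro!: summable_mult)
  finally have EG: "(\<integral>\<^sup>+\<omega>. G \<omega> \<partial>M) < \<infinity>"
    using order_le_less_trans by fastforce
  then have G_fin: "AE \<omega> in M. G \<omega> \<noteq> \<infinity>"
    by (intro nn_integral_PInf_AE) auto
  define g where "g \<omega> = enn2real (G \<omega>)" for \<omega>
  have gm[measurable]: "g \<in> borel_measurable M"
    unfolding g_def[abs_def] by measurable
  have g0: "0 \<le> g \<omega>" for \<omega>
    by (simp add: g_def)
  have int_g: "integrable M g"
  proof (rule integrableI_bounded)
    have "(\<integral>\<^sup>+\<omega>. ennreal (norm (g \<omega>)) \<partial>M) \<le> (\<integral>\<^sup>+\<omega>. G \<omega> \<partial>M)"
      using G_fin by (intro nn_integral_mono_AE) (auto simp: g_def top.not_eq_extremum)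
    then show "(\<integral>\<^sup>+\<omega>. ennreal (norm (g \<omega>)) \<partial>M) < \<infinity>"
      using EG by (rule order_le_less_trans)
  qed simp
  \<comment> \<open>The constant of the chaining lemma; division by \<open>T powr \<gamma>\<close>
    undoes the rescaling of \<open>{0..T}\<close> to \<open>{0..1}\<close>.\<close>
  define c where "c = (2 * (2 powr - \<gamma> / (1 - 2 powr - \<gamma>)) + 1) * 2 powr \<gamma> / T powr \<gamma>"
  have c: "c \<ge> 0"
    using powr_less_mono[of "- \<gamma>" 0 2] gamma by (simp add: c_def)
  define H where "H \<omega> = c * g \<omega> powr (1 / real p)" for \<omega>
  show ?thesis
  proof
    show "H \<in> borel_measurable M"
      unfolding H_def[abs_def] by measurable
    show "0 \<le> H \<omega>" for \<omega>
      using c by (simp add: H_def)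
    show "integrable M (\<lambda>\<omega>. (H \<omega>)\<^sup>2)"
    proof (rule Bochner_Integration.integrable_bound)
      show "integrable M (\<lambda>\<omega>. c\<^sup>2 * (1 + g \<omega>))"
        using int_g by simp
      show "(\<lambda>\<omega>. (H \<omega>)\<^sup>2) \<in> borel_measurable M"
        unfolding H_def by measurable
      have "(g \<omega> powr (1 / real p))\<^sup>2 \<le> 1 + g \<omega>" for \<omega>
      proof -
        have "(g \<omega> powr (1 / real p))\<^sup>2 = g \<omega> powr (2 / real p)"
          by (simp add: power2_eq_square powr_add[symmetric])
        also have "\<dots> \<le> 1 + g \<omega>"
        proof (cases "g \<omega> \<le> 1")
          case True
          then have "g \<omega> powr (2 / real p) \<le> 1"
            using g0[of \<omega>] by (intro powr_le1) auto
          then show ?thesis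
            using g0[of \<omega>] by linarith
        next
          case False
          then have "g \<omega> powr (2 / real p) \<le> g \<omega> powr 1"
            using p by (intro powr_mono) auto
          then show ?thesis
            using False by simp
        qed
        finally show ?thesis .
      qed
      then have "(H \<omega>)\<^sup>2 \<le> c\<^sup>2 * (1 + g \<omega>)" for \<omega>
        by (simp add: H_def power_mult_distrib mult_left_mono)
      then show "AE \<omega> in M. norm ((H \<omega>)\<^sup>2) \<le> norm (c\<^sup>2 * (1 + g \<omega>))"
        using g0 by (auto simp: abs_mult)
    qed
    show "AE \<omega> in M. \<forall>s\<in>{0..T}. \<forall>r\<in>{0..T}. norm (W s \<omega> - W r \<omega>) \<le> H \<omega> * \<bar>s - r\<bar> powr \<gamma>"
      using cont G_fin
    proof eventually_elim
      case (elim \<omega>)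
      define w where "w s = W (T * s) \<omega>" for s
      have cw: "continuous_on {0..1} w"
        unfolding w_def using T
        by (intro continuous_on_compose2[OF elim(1)] continuous_intros) auto
      have inc: "norm (w ((real k + 1) / 2 ^ n) - w (real k / 2 ^ n)) \<le> g \<omega> powr (1 / real p) * (2 powr - \<gamma>) ^ n"
        if k: "k < 2 ^ n" for n k
      proof -
        let ?x = "\<Delta> n k \<omega> * (2 powr \<gamma>) ^ n"
        have x0: "0 \<le> ?x"
          by (simp add: \<Delta>_def)
        have "ennreal (?x ^ p) \<le> (\<Sum>k<2 ^ n. ennreal ((\<Delta> n k \<omega> * (2 powr \<gamma>) ^ n) ^ p))"
          using k by (intro member_le_sum[of k "{..<2 ^ n}"]) auto
        also have "\<dots> = (\<Sum>i\<in>{n}. \<Sum>k<2 ^ i. ennreal ((\<Delta> i k \<omega> * (2 powr \<gamma>) ^ i) ^ p))"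
          by simp
        also have "\<dots> \<le> G \<omega>"
          unfolding G_def by (intro sum_le_suminf) auto
        also have "\<dots> = ennreal (g \<omega>)"
          using elim(2) by (simp add: g_def top.not_eq_extremum)
        finally have "?x ^ p \<le> g \<omega>"
          using g0[of \<omega>] by simp
        then have "(?x ^ p) powr (1 / real p) \<le> g \<omega> powr (1 / real p)"
          using x0 by (intro powr_mono2) auto
        moreover have "(x ^ p) powr (1 / real p) = x" if "0 \<le> x" for x :: real
          using p that by (cases "x = 0") (simp_all add: powr_realpow[symmetric] powr_powr)
        note this[OF x0]
        ultimately have "\<Delta> n k \<omega> * (2 powr \<gamma>) ^ n * (2 powr - \<gamma>) ^ n \<le> g \<omega> powr (1 / real p) * (2 powr - \<gamma>) ^ n"
          by (intro mult_right_mono) auto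
        moreover have "(2 powr \<gamma>) ^ n * (2 powr - \<gamma>) ^ n = (1::real)"
          by (simp add: power_mult_distrib[symmetric] powr_add[symmetric])
        ultimately have "\<Delta> n k \<omega> \<le> g \<omega> powr (1 / real p) * (2 powr - \<gamma>) ^ n"
          by (simp add: mult.assoc)
        then show ?thesis
          by (simp add: \<Delta>_def w_def)
      qed
      show ?case
      proof (intro ballI)
        fix s r assume sr: "s \<in> {0..T}" "r \<in> {0..T}"
        have "norm (w (s / T) - w (r / T)) \<le> (2 * (2 powr - \<gamma> / (1 - 2 powr - \<gamma>)) + 1) * 2 powr \<gamma>
            * (g \<omega> powr (1 / real p)) * \<bar>s / T - r / T\<bar> powr \<gamma>"
          using sr T by (intro dyadic_chaining[OF gamma _ cw inc]) auto
        also have "\<bar>s / T - r / T\<bar> powr \<gamma> = \<bar>s - r\<bar> powr \<gamma> / T powr \<gamma>"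
          using T by (simp add: diff_divide_distrib[symmetric] powr_divide)
        finally show "norm (W s \<omega> - W r \<omega>) \<le> H \<omega> * \<bar>s - r\<bar> powr \<gamma>"
          using T by (simp add: w_def H_def c_def)
      qed
    qed
  qed
qed

text \<open>With Gaussian moments of order \<open>2 * m\<close> bounded by a multiple of
  \<open>(t - s) ^ m\<close>, the Kolmogorov condition reads
  \<open>\<gamma> * real (2 * m) < real m - 1\<close>. As \<open>\<gamma> < 1 / 2\<close>, it holds
  for all large \<open>m\<close>.\<close>

theorem brownian_motion_hoelder:
  fixes W :: "real \<Rightarrow> 'a \<Rightarrow> real ^ 'd"
  assumes fps: "filtered_prob_space M F" and bm: "brownian_motion M F W"
    and T: "T > 0" and gamma: "\<gamma> > 0" "\<gamma> < 1 / 2"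
  obtains H where "H \<in> borel_measurable M" "\<And>\<omega>. 0 \<le> H \<omega>" "integrable M (\<lambda>\<omega>. (H \<omega>)\<^sup>2)"
    "AE \<omega> in M. \<forall>s\<in>{0..T}. \<forall>r\<in>{0..T}. norm (W s \<omega> - W r \<omega>) \<le> H \<omega> * \<bar>s - r\<bar> powr \<gamma>"
proof -
  obtain m :: nat where m: "1 / (1 - 2 * \<gamma>) < real m"
    using reals_Archimedean2 by blast
  have "1 < real m * (1 - 2 * \<gamma>)"
    using m gamma by (simp add: field_simps)
  then have gm: "\<gamma> * real (2 * m) < real m - 1"
    by (simp add: algebra_simps)
  have "m > 0"
    using gm gamma by (cases m) auto
  obtain K where K: "K \<ge> 0"
    and mom: "\<And>h. h > 0 \<Longrightarrow> (\<integral>\<^sup>+z. ennreal (norm z ^ (2 * m)) \<partial>(gauss h :: (real ^ 'd) measure)) \<le> ennreal (K * h ^ m)"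
    using gauss_moment_even[where ?'d = 'd, of m] by blast
  show ?thesis
  proof (rule kolmogorov_hoelder[of M T \<gamma> "2 * m" m W K])
    show "prob_space M"
      using fps by (simp add: filtered_prob_space_def)
    show "W t \<in> borel_measurable M" if "0 \<le> t" for t
    proof -
      have "W t \<in> borel_measurable (F t)"
        using bm that by (simp add: brownian_motion_def adapted_process_def)
      moreover have "space (F t) = space M" "sets (F t) \<subseteq> sets M"
        using fps by (auto simp: filtered_prob_space_def filtration_def)
      ultimately show ?thesis
        using measurable_mono[of borel borel "F t" M] by auto
    qed
    show "(\<integral>\<^sup>+\<omega>. ennreal (norm (W t \<omega> - W s \<omega>) ^ (2 * m)) \<partial>M) \<le> ennreal (K * (t - s) ^ m)"
      if st: "0 \<le> s" "s < t" for s t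
    proof -
      have D: "distributed M lborel (\<lambda>\<omega>. W t \<omega> - W s \<omega>)
          (\<lambda>x. ennreal (\<Prod>i\<in>UNIV. normal_density 0 (sqrt (t - s)) (x $ i)))"
        using bm st by (simp add: brownian_motion_def)
      have "(\<integral>\<^sup>+\<omega>. ennreal (norm (W t \<omega> - W s \<omega>) ^ (2 * m)) \<partial>M)
          = (\<integral>\<^sup>+z. ennreal (norm z ^ (2 * m)) \<partial>(gauss (t - s) :: (real ^ 'd) measure))"
        using distributed_nn_integral[OF D, of "\<lambda>z. ennreal (norm z ^ (2 * m))", symmetric]
        by (simp add: gauss_def nn_integral_density)
      then show ?thesis
        using mom[of "t - s"] st by simp
    qed
    show "AE \<omega> in M. continuous_on {0..} (\<lambda>t. W t \<omega>)"
      using bm by (simp add: brownian_motion_def)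
  qed (use T gamma gm K \<open>m > 0\<close> that in auto)
qed

section \<open>Pathwise estimates\<close>

text \<open>The constant \<open>c\<close> is a frozen drift. With \<open>B\<close> bounding the
  deviation from it this is a consistency error; with \<open>B = 0\<close> it integrates a piecewise
  constant drift exactly. The bound is asked on the open interval because the floor in the scheme
  can jump at the right endpoint.\<close>

lemma set_integral_increment:
  fixes D :: "real \<Rightarrow> 'b::euclidean_space"
  assumes rs: "0 \<le> r" "r \<le> s" and int: "set_integrable lborel {0..s} D"
    and bound: "\<And>u. r < u \<Longrightarrow> u < s \<Longrightarrow> norm (D u - c) \<le> B"
  shows "norm ((LINT u:{0..s}|lborel. D u) - (LINT u:{0..r}|lborel. D u) - (s - r) *\<^sub>R c) \<le> (s - r) * B"
proof -
  have i1: "set_integrable lborel {0..r} D" and i2: "set_integrable lborel {r<..<s} D"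
    using rs by (auto intro: set_integrable_subset[OF int])
  have i3: "set_integrable lborel {r<..<s} (\<lambda>_. c)" and i4: "set_integrable lborel {r<..<s} (\<lambda>_. B)"
    using rs by (auto simp: set_integrable_def)
  have "(LINT u:{0..s}|lborel. D u) = (LINT u:{0..r} \<union> {r<..<s}|lborel. D u)"
    unfolding set_lebesgue_integral_def
  proof (rule integral_cong_AE)
    show "(\<lambda>u. indicat_real {0..s} u *\<^sub>R D u) \<in> borel_measurable lborel"
      using int by (auto simp: set_integrable_def)
    have "set_integrable lborel ({0..r} \<union> {r<..<s}) D"
      using i1 i2 by (intro set_integrable_Un) auto
    then show "(\<lambda>u. indicat_real ({0..r} \<union> {r<..<s}) u *\<^sub>R D u) \<in> borel_measurable lborel"
      by (auto simp: set_integrable_def)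
    \<comment> \<open>The integrands can differ only at the right endpoint \<open>s\<close>, a null
      set.\<close>
    show "AE u in lborel. indicat_real {0..s} u *\<^sub>R D u = indicat_real ({0..r} \<union> {r<..<s}) u *\<^sub>R D u"
      using AE_lborel_singleton[of s] by eventually_elim (use rs in \<open>auto simp: indicator_def\<close>)
  qed
  also have "\<dots> = (LINT u:{0..r}|lborel. D u) + (LINT u:{r<..<s}|lborel. D u)"
    using i1 i2 by (intro set_integral_Un) auto
  finally have "(LINT u:{0..s}|lborel. D u) - (LINT u:{0..r}|lborel. D u) - (s - r) *\<^sub>R c
      = (LINT u:{r<..<s}|lborel. D u) - (LINT u:{r<..<s}|lborel. c)"
    using rs by (simp add: set_lebesgue_integral_def)
  also have "\<dots> = (LINT u:{r<..<s}|lborel. D u - c)"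
    using i2 i3 by (simp add: set_integral_diff)
  also have "norm \<dots> \<le> (LINT u:{r<..<s}|lborel. norm (D u - c))"
    using i2 i3 by (intro set_integral_norm_bound set_integral_diff)
  also have "\<dots> \<le> (LINT u:{r<..<s}|lborel. B)"
    using i2 i3 i4 bound by (intro set_integral_mono set_integrable_norm set_integral_diff) auto
  also have "\<dots> = (s - r) * B"
    using rs by (simp add: set_lebesgue_integral_def)
  finally show ?thesis .
qed

section \<open>Path segments and their interpolations\<close>

lemma continuous_on_restrict [simp]: "continuous_on S (restrict f S) \<longleftrightarrow> continuous_on S f"
  by (rule continuous_on_cong) auto

lemma segment_in_path_space:
  assumes "continuous_on {s - \<tau>..s} x"
  shows "segment \<tau> x s \<in> mspace (path_space \<tau>)"
proof -
  have "continuous_on {-\<tau>..0} (\<lambda>\<theta>. x (s + \<theta>))"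
    by (intro continuous_on_compose2[OF assms] continuous_intros) auto
  then show ?thesis
    by (simp add: mspace_path_space segment_def del: restrict_apply)
qed

text \<open>On its cell the subtracted coefficient of the interpolation formula is
  \<open>- l\<close> with \<open>l\<close> in \<open>{0..1}\<close>, so the value is a convex
  combination of two neighbouring grid values. Both \<open>i\<close> and \<open>l\<close> depend on
  \<open>\<theta>\<close> alone, which allows two paths to be compared weight by weight.\<close>

lemma interp_segment_convex:
  assumes \<delta>: "\<delta> > 0" and m: "\<tau> = real m * \<delta>" "m > 0" and \<theta>: "\<theta> \<in> {-\<tau>..0}"
  obtains i l where "i < m" "- (real i + 1) * \<delta> \<le> \<theta>" "\<theta> \<le> - real i * \<delta>" "0 \<le> l" "l \<le> 1"
    "\<And>x k. interp_segment \<tau> \<delta> x k \<theta>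
      = (1 - l) *\<^sub>R x ((of_int k - real i) * \<delta>) + l *\<^sub>R x ((of_int k - real i - 1) * \<delta>)"
proof -
  define i where "i = nat (\<lceil>- \<theta> / \<delta>\<rceil> - 1)"
  have q: "0 \<le> - \<theta> / \<delta>" "- \<theta> / \<delta> \<le> real m"
    using \<theta> \<delta> m by (auto simp: field_simps)
  have c: "\<lceil>- \<theta> / \<delta>\<rceil> \<le> int m"
    using q by (simp add: ceiling_le_iff)
  have i: "i < m" "real i \<le> - \<theta> / \<delta>" "- \<theta> / \<delta> \<le> real i + 1"
    using c q m by (auto simp: i_def) linarith+
  have th: "- (real i + 1) * \<delta> \<le> \<theta>" "\<theta> \<le> - real i * \<delta>"
    using i \<delta> by (auto simp: field_simps)
  define l where "l = - ((\<theta> + real i * \<delta>) / \<delta>)"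
  have l: "0 \<le> l" "l \<le> 1"
    using i \<delta> by (auto simp: l_def field_simps)
  have l': "1 - l = (\<theta> + (1 + real i) * \<delta>) / \<delta>"
    using \<delta> by (simp add: l_def field_simps)
  show ?thesis
  proof (rule that[OF i(1) th l])
    fix x :: "real \<Rightarrow> real ^ 'a" and k
    have "interp_segment \<tau> \<delta> x k \<theta> =
       ((\<theta> + (1 + real i) * \<delta>) / \<delta>) *\<^sub>R x ((of_int k - real i) * \<delta>)
       - ((\<theta> + real i * \<delta>) / \<delta>) *\<^sub>R x ((of_int k - real i - 1) * \<delta>)"
      using \<delta> m th i by (intro interp_segment_eq) auto
    then show "interp_segment \<tau> \<delta> x k \<theta>
      = (1 - l) *\<^sub>R x ((of_int k - real i) * \<delta>) + l *\<^sub>R x ((of_int k - real i - 1) * \<delta>)"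
      unfolding l' by (simp add: l_def)
  qed
qed

lemma interp_segment_in_path_space:
  assumes \<delta>: "\<delta> > 0" and m: "\<tau> = real m * \<delta>" "m > 0"
  shows "interp_segment \<tau> \<delta> x k \<in> mspace (path_space \<tau>)"
proof -
  let ?I = "\<lambda>i::nat. {- (real i + 1) * \<delta> .. - real i * \<delta>}"
  have "continuous_on (\<Union>i\<in>{..<m}. ?I i) (interp_segment \<tau> \<delta> x k)"
  proof (rule continuous_on_closed_Union)
    fix i assume i: "i \<in> {..<m}"
    have "continuous_on (?I i) (\<lambda>\<theta>. ((\<theta> + (1 + real i) * \<delta>) / \<delta>) *\<^sub>R x ((of_int k - real i) * \<delta>)
       - ((\<theta> + real i * \<delta>) / \<delta>) *\<^sub>R x ((of_int k - real i - 1) * \<delta>))"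
      using \<delta> by (intro continuous_intros) auto
    also have "?this \<longleftrightarrow> continuous_on (?I i) (interp_segment \<tau> \<delta> x k)"
      using i \<delta> m by (intro continuous_on_cong interp_segment_eq[symmetric]) auto
    finally show "continuous_on (?I i) (interp_segment \<tau> \<delta> x k)" .
  qed auto
  moreover have "{-\<tau>..0} \<subseteq> (\<Union>i\<in>{..<m}. ?I i)"
  proof
    fix \<theta> assume "\<theta> \<in> {-\<tau>..0}"
    then show "\<theta> \<in> (\<Union>i\<in>{..<m}. ?I i)"
      by (rule interp_segment_convex[OF \<delta> m]) auto
  qed
  ultimately have "continuous_on {-\<tau>..0} (interp_segment \<tau> \<delta> x k)"
    by (rule continuous_on_subset)
  then show ?thesis
    by (auto simp: mspace_path_space interp_segment_def)
qed

lemma norm_convex_diff_le: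
  fixes a b v :: "'b::real_normed_vector"
  assumes "0 \<le> l" "l \<le> 1" "norm (a - v) \<le> B" "norm (b - v) \<le> B"
  shows "norm ((1 - l) *\<^sub>R a + l *\<^sub>R b - v) \<le> B"
proof -
  have "(1 - l) *\<^sub>R a + l *\<^sub>R b - v = (1 - l) *\<^sub>R (a - v) + l *\<^sub>R (b - v)"
    by (simp add: algebra_simps)
  also have "norm \<dots> \<le> (1 - l) * norm (a - v) + l * norm (b - v)"
    using assms by (intro order_trans[OF norm_triangle_ineq]) auto
  also have "\<dots> \<le> (1 - l) * B + l * B"
    using assms by (intro add_mono mult_left_mono) auto
  finally show ?thesis
    by (simp add: algebra_simps)
qed

text \<open>Both interpolations use the same convex weights, so interpolating does not increase the
  distance of the grid values.\<close>

lemma interp_segment_diff_le: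
  fixes x y :: "real \<Rightarrow> real ^ 'd"
  assumes \<delta>: "\<delta> > 0" and m: "\<tau> = real m * \<delta>" "m > 0" and \<theta>: "\<theta> \<in> {-\<tau>..0}"
    and le: "\<And>i. i \<le> m \<Longrightarrow> norm (x ((of_int k - real i) * \<delta>) - y ((of_int k - real i) * \<delta>)) \<le> B"
  shows "norm (interp_segment \<tau> \<delta> x k \<theta> - interp_segment \<tau> \<delta> y k \<theta>) \<le> B"
proof -
  obtain i l where il: "i < m" "0 \<le> l" "l \<le> 1" and eq: "\<And>(x :: real \<Rightarrow> real ^ 'd) k. interp_segment \<tau> \<delta> x k \<theta>
      = (1 - l) *\<^sub>R x ((of_int k - real i) * \<delta>) + l *\<^sub>R x ((of_int k - real i - 1) * \<delta>)"
    using interp_segment_convex[OF \<delta> m \<theta>] by metis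
  have "norm (x ((of_int k - real i) * \<delta>) - y ((of_int k - real i) * \<delta>) - 0) \<le> B"
    "norm (x ((of_int k - real i - 1) * \<delta>) - y ((of_int k - real i - 1) * \<delta>) - 0) \<le> B"
    using le[of i] le[of "Suc i"] il by (auto simp: algebra_simps)
  moreover have "(1 - l) *\<^sub>R a + l *\<^sub>R a' - ((1 - l) *\<^sub>R c + l *\<^sub>R c')
      = (1 - l) *\<^sub>R (a - c) + l *\<^sub>R (a' - c') - 0" for a a' c c' :: "real ^ 'd"
    by (simp add: algebra_simps)
  ultimately show ?thesis
    unfolding eq using norm_convex_diff_le[OF il(2,3), where v = 0] by simp
qed

text \<open>Replacing \<open>s\<close> by \<open>of_int k * \<delta>\<close> costs at most one step
  and moving to a node of the cell at most another, which is the reason for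
  \<open>2 * \<delta>\<close>. The lower node stays above \<open>-\<tau>\<close> because a cell ends
  at \<open>(real i + 1) * \<delta> \<le> \<tau>\<close>.\<close>

lemma interp_segment_close:
  fixes x :: "real \<Rightarrow> real ^ 'd"
  assumes \<delta>: "\<delta> > 0" and m: "\<tau> = real m * \<delta>" "m > 0" and \<theta>: "\<theta> \<in> {-\<tau>..0}"
    and k: "k \<ge> 0" "of_int k * \<delta> \<le> s" "s \<le> (of_int k + 1) * \<delta>" "s \<le> T"
    and le: "\<And>p q. -\<tau> \<le> p \<Longrightarrow> p \<le> T \<Longrightarrow> -\<tau> \<le> q \<Longrightarrow> q \<le> T \<Longrightarrow> \<bar>p - q\<bar> \<le> 2 * \<delta> \<Longrightarrow> norm (x p - x q) \<le> B"
  shows "norm (interp_segment \<tau> \<delta> x k \<theta> - x (s + \<theta>)) \<le> B"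
proof -
  obtain i l where il: "i < m" "- (real i + 1) * \<delta> \<le> \<theta>" "\<theta> \<le> - real i * \<delta>" "0 \<le> l" "l \<le> 1"
    and eq: "\<And>(x :: real \<Rightarrow> real ^ 'd) k. interp_segment \<tau> \<delta> x k \<theta>
      = (1 - l) *\<^sub>R x ((of_int k - real i) * \<delta>) + l *\<^sub>R x ((of_int k - real i - 1) * \<delta>)"
    using interp_segment_convex[OF \<delta> m \<theta>] by metis
  define a c where "a = of_int k * \<delta>" and "c = real i * \<delta>"
  have a: "0 \<le> a" "a \<le> s" "s \<le> a + \<delta>" and c: "0 \<le> c" "- (c + \<delta>) \<le> \<theta>" "\<theta> \<le> - c"
    using k \<delta> il by (auto simp: a_def c_def algebra_simps)
  have "(real i + 1) * \<delta> \<le> \<tau>"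
    unfolding m(1) using il(1) \<delta> by (intro mult_right_mono) auto
  then have im: "c + \<delta> \<le> \<tau>"
    by (simp add: c_def algebra_simps)
  have \<theta>': "-\<tau> \<le> \<theta>" "\<theta> \<le> 0"
    using \<theta> by auto
  let ?p = "(of_int k - real i) * \<delta>" and ?q = "(of_int k - real i - 1) * \<delta>"
  have p: "?p = a - c" and q: "?q = a - c - \<delta>"
    by (simp_all add: a_def c_def algebra_simps)
  have "norm (x ?p - x (s + \<theta>)) \<le> B"
    unfolding p using a c im \<theta>' \<delta> k(4) by (intro le; linarith)
  moreover have "norm (x ?q - x (s + \<theta>)) \<le> B"
    unfolding q using a c im \<theta>' \<delta> k(4) by (intro le; linarith)
  ultimately show ?thesis
    unfolding eq using il by (intro norm_convex_diff_le) auto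
qed

section \<open>Growth and continuity of the drift\<close>

locale delay_drift =
  fixes b :: "real ^ 'd \<Rightarrow> real ^ 'd" and Z :: "(real \<Rightarrow> real ^ 'd) \<Rightarrow> real ^ 'd"
    and \<tau> L1 L2 \<alpha> :: real
  assumes tau: "\<tau> > 0" and L: "L1 \<ge> 0" "L2 \<ge> 0" and alpha: "0 < \<alpha>" "\<alpha> \<le> 1"
    and b_lipschitz: "\<And>x y. norm (b x - b y) \<le> L1 * norm (x - y)"
    and Z_hoelder: "\<And>\<zeta> \<eta>. \<zeta> \<in> mspace (path_space \<tau>) \<Longrightarrow> \<eta> \<in> mspace (path_space \<tau>) \<Longrightarrow>
           norm (Z \<zeta> - Z \<eta>) \<le> L2 * mdist (path_space \<tau>) \<zeta> \<eta> powr \<alpha>"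
begin

definition drift :: "(real \<Rightarrow> real ^ 'd) \<Rightarrow> real \<Rightarrow> real ^ 'd" where
  "drift x s = b (x s) + Z (segment \<tau> x s)"

definition em_drift :: "real \<Rightarrow> (real \<Rightarrow> real ^ 'd) \<Rightarrow> int \<Rightarrow> real ^ 'd" where
  "em_drift \<delta> x k = b (x (of_int k * \<delta>)) + Z (interp_segment \<tau> \<delta> x k)"

lemma Z_diff_le:
  assumes "\<zeta> \<in> mspace (path_space \<tau>)" "\<eta> \<in> mspace (path_space \<tau>)"
    and "\<And>\<theta>. \<theta> \<in> {-\<tau>..0} \<Longrightarrow> norm (\<zeta> \<theta> - \<eta> \<theta>) \<le> B"
  shows "norm (Z \<zeta> - Z \<eta>) \<le> L2 * B powr \<alpha>"
proof -
  have "mdist (path_space \<tau>) \<zeta> \<eta> \<le> B"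
    using assms tau by (subst mdist_path_space) (auto intro!: cSUP_least)
  then have "mdist (path_space \<tau>) \<zeta> \<eta> powr \<alpha> \<le> B powr \<alpha>"
    using alpha by (intro powr_mono2) auto
  then show ?thesis
    using Z_hoelder[OF assms(1,2)] L(2) by (meson mult_left_mono order_trans)
qed

lemma powr_alpha_le: "0 \<le> B \<Longrightarrow> B powr \<alpha> \<le> 1 + B"
proof (cases "B \<le> 1")
  case True
  assume "0 \<le> B"
  then have "B powr \<alpha> \<le> 1"
    using True alpha by (intro powr_le1) auto
  then show ?thesis
    using \<open>0 \<le> B\<close> by simp
next
  case False
  then have "B powr \<alpha> \<le> B powr 1"
    using alpha by (intro powr_mono) auto
  then show ?thesis
    using False by simp
qed

text \<open>Comparison with the zero path. Since \<open>B powr \<alpha> \<le> 1 + B\<close>, the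
  Hoelder bound on \<open>Z\<close> gives linear growth, with a constant common to all
  paths.\<close>

lemma drift_growth:
  obtains c where "c \<ge> 0"
    "\<And>x s B. continuous_on {s - \<tau>..s} x \<Longrightarrow> (\<And>r. s - \<tau> \<le> r \<Longrightarrow> r \<le> s \<Longrightarrow> norm (x r) \<le> B)
      \<Longrightarrow> norm (drift x s) \<le> c * (1 + B)"
proof
  \<comment> \<open>The zero path must be restricted, since elements of \<open>path_space\<close>
    are \<open>undefined\<close> outside the interval.\<close>
  let ?z = "restrict (\<lambda>_. 0) {-\<tau>..0} :: real \<Rightarrow> real ^ 'd"
  let ?c = "norm (b 0) + norm (Z ?z) + L2 + L1"
  show "0 \<le> ?c"
    using L by simp
  fix x :: "real \<Rightarrow> real ^ 'd" and s B assume x: "continuous_on {s - \<tau>..s} x" "\<And>r. s - \<tau> \<le> r \<Longrightarrow> r \<le> s \<Longrightarrow> norm (x r) \<le> B"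
  have z: "?z \<in> mspace (path_space \<tau>)"
    by (simp add: mspace_path_space del: restrict_apply)
  have B: "0 \<le> B"
    using x(2)[of s] tau norm_ge_zero[of "x s"] by linarith
  have "norm (Z (segment \<tau> x s) - Z ?z) \<le> L2 * B powr \<alpha>"
    using x(2) by (intro Z_diff_le segment_in_path_space[OF x(1)] z) (auto simp: segment_def)
  also have "\<dots> \<le> L2 * (1 + B)"
    using powr_alpha_le[OF B] L by (intro mult_left_mono)
  finally have Z: "norm (Z (segment \<tau> x s)) \<le> norm (Z ?z) + L2 * (1 + B)"
    using norm_triangle_sub[of "Z (segment \<tau> x s)" "Z ?z"] by linarith
  have "norm (b (x s) - b 0) \<le> L1 * norm (x s)"
    using b_lipschitz[of "x s" 0] by simp
  also have "\<dots> \<le> L1 * (1 + B)"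
    using x(2)[of s] tau L by (intro mult_left_mono) auto
  finally have b: "norm (b (x s)) \<le> norm (b 0) + L1 * (1 + B)"
    using norm_triangle_sub[of "b (x s)" "b 0"] by linarith
  have "norm (drift x s) \<le> norm (b 0) + L1 * (1 + B) + (norm (Z ?z) + L2 * (1 + B))"
    unfolding drift_def using b Z by (intro order_trans[OF norm_triangle_ineq add_mono])
  also have "\<dots> \<le> ?c * (1 + B)"
    using B by (simp add: algebra_simps)
  finally show "norm (drift x s) \<le> ?c * (1 + B)" .
qed

lemma em_drift_diff_le:
  assumes \<delta>: "\<delta> > 0" and m: "\<tau> = real m * \<delta>" "m > 0"
    and le: "\<And>i. i \<le> m \<Longrightarrow> norm (x ((of_int k - real i) * \<delta>) - y ((of_int k - real i) * \<delta>)) \<le> B"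
  shows "norm (em_drift \<delta> x k - em_drift \<delta> y k) \<le> L1 * B + L2 * B powr \<alpha>"
proof -
  have "norm (b (x (of_int k * \<delta>)) - b (y (of_int k * \<delta>))) \<le> L1 * B"
    using b_lipschitz[of "x (of_int k * \<delta>)" "y (of_int k * \<delta>)"] mult_left_mono[OF le[of 0] L(1)] by simp
  moreover have "norm (Z (interp_segment \<tau> \<delta> x k) - Z (interp_segment \<tau> \<delta> y k)) \<le> L2 * B powr \<alpha>"
    by (intro Z_diff_le interp_segment_in_path_space[OF \<delta> m] interp_segment_diff_le[OF \<delta> m] le)
  ultimately show ?thesis
    unfolding em_drift_def add_diff_add by (intro order_trans[OF norm_triangle_ineq add_mono])
qed

lemma em_drift_close:
  assumes \<delta>: "\<delta> > 0" and m: "\<tau> = real m * \<delta>" "m > 0"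
    and k: "k \<ge> 0" "of_int k * \<delta> \<le> s" "s \<le> (of_int k + 1) * \<delta>" "s \<le> T"
    and x: "continuous_on {-\<tau>..T} x"
    and le: "\<And>p q. -\<tau> \<le> p \<Longrightarrow> p \<le> T \<Longrightarrow> -\<tau> \<le> q \<Longrightarrow> q \<le> T \<Longrightarrow> \<bar>p - q\<bar> \<le> 2 * \<delta> \<Longrightarrow> norm (x p - x q) \<le> B"
  shows "norm (em_drift \<delta> x k - drift x s) \<le> L1 * B + L2 * B powr \<alpha>"
proof -
  have s: "0 \<le> of_int k * \<delta>"
    using k \<delta> by simp
  have s': "s \<le> of_int k * \<delta> + \<delta>"
    using k by (simp add: algebra_simps)
  have "norm (x (of_int k * \<delta>) - x s) \<le> B"
    using s s' k(2,4) tau \<delta> by (intro le; linarith)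
  then have "norm (b (x (of_int k * \<delta>)) - b (x s)) \<le> L1 * B"
    using b_lipschitz[of "x (of_int k * \<delta>)" "x s"] L(1) by (meson mult_left_mono order_trans)
  moreover have "continuous_on {s - \<tau>..s} x"
    using s k by (intro continuous_on_subset[OF x]) auto
  then have "norm (Z (interp_segment \<tau> \<delta> x k) - Z (segment \<tau> x s)) \<le> L2 * B powr \<alpha>"
    using interp_segment_close[OF \<delta> m _ k, of _ x B] le
    by (intro Z_diff_le interp_segment_in_path_space[OF \<delta> m] segment_in_path_space) (auto simp: segment_def)
  ultimately show ?thesis
    unfolding em_drift_def drift_def add_diff_add by (intro order_trans[OF norm_triangle_ineq add_mono])
qed

end

section \<open>Regularity of a single solution path\<close>

lemma le_powr_mult:
  fixes x X \<gamma> :: real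
  assumes "0 \<le> x" "x \<le> X" "\<gamma> \<le> 1"
  shows "x \<le> X powr (1 - \<gamma>) * x powr \<gamma>"
proof (cases "x = 0")
  case False
  then have "x = x powr (1 - \<gamma>) * x powr \<gamma>"
    using assms by (simp add: powr_add[symmetric])
  also have "\<dots> \<le> X powr (1 - \<gamma>) * x powr \<gamma>"
    using assms by (intro mult_right_mono powr_mono2) auto
  finally show ?thesis .
qed simp

lemma powr_antimono_exp:
  fixes x :: real
  assumes "0 < x" "x \<le> 1" "a \<le> b"
  shows "x powr b \<le> x powr a"
  using assms by (intro powr_mono') auto

locale delay_path = delay_drift b Z \<tau> L1 L2 \<alpha>
  for b :: "real ^ 'd \<Rightarrow> real ^ 'd" and Z \<tau> L1 L2 \<alpha> +
  fixes \<xi> :: "real \<Rightarrow> real ^ 'd" and \<sigma> :: "real ^ 'd ^ 'd" and T \<gamma> L3 :: real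
  assumes T: "T > 0" and gamma: "0 < \<gamma>" "\<gamma> < 1" and L3: "L3 \<ge> 0"
    and xi_lipschitz: "\<And>s t. s \<in> {-\<tau>..0} \<Longrightarrow> t \<in> {-\<tau>..0} \<Longrightarrow> norm (\<xi> t - \<xi> s) \<le> L3 * \<bar>t - s\<bar>"
begin

text \<open>What almost every sample satisfies, stated for one deterministic driving path
  \<open>w\<close> with Hoelder constant \<open>H\<close>. In the lemmas below the constant
  \<open>K\<close> is obtained before \<open>x\<close>, \<open>w\<close> and \<open>H\<close> are
  fixed, so the dependence on the sample is confined to the factor \<open>1 + H\<close>.\<close>

definition solution_path :: "(real \<Rightarrow> real ^ 'd) \<Rightarrow> (real \<Rightarrow> real ^ 'd) \<Rightarrow> real \<Rightarrow> bool" where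
  "solution_path x w H \<longleftrightarrow> 0 \<le> H \<and> continuous_on {-\<tau>..T} x \<and> (\<forall>\<theta>\<in>{-\<tau>..0}. x \<theta> = \<xi> \<theta>) \<and> w 0 = 0 \<and>
     (\<forall>s\<in>{0..T}. \<forall>r\<in>{0..T}. norm (w s - w r) \<le> H * \<bar>s - r\<bar> powr \<gamma>) \<and>
     (\<forall>t\<in>{0..T}. set_integrable lborel {0..t} (drift x) \<and>
        x t = \<xi> 0 + (LINT s:{0..t}|lborel. drift x s) + \<sigma> *v w t)"

lemma sigma_bound: obtains S where "S \<ge> 0" "\<And>v. norm (\<sigma> *v v) \<le> S * norm v"
  using bounded_linear.nonneg_bounded[OF matrix_vector_mul_bounded_linear[of \<sigma>]]
  by (metis mult.commute)

lemma solution_path_bound: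
  obtains K where "K \<ge> 0"
    "\<And>x w H t. solution_path x w H \<Longrightarrow> t \<in> {-\<tau>..T} \<Longrightarrow> norm (x t) \<le> K * (1 + H)"
proof -
  obtain c where c: "c \<ge> 0" and growth: "\<And>x s B. continuous_on {s - \<tau>..s} x \<Longrightarrow>
      (\<And>r. s - \<tau> \<le> r \<Longrightarrow> r \<le> s \<Longrightarrow> norm (x r) \<le> B) \<Longrightarrow> norm (drift x s) \<le> c * (1 + B)"
    by (rule drift_growth) blast
  obtain S where S: "S \<ge> 0" "\<And>v. norm (\<sigma> *v v) \<le> S * norm v"
    by (rule sigma_bound) blast
  define X0 where "X0 = norm (\<xi> 0) + L3 * \<tau>"
  have X0: "norm (\<xi> \<theta>) \<le> X0" if "\<theta> \<in> {-\<tau>..0}" for \<theta>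
  proof -
    have "norm (\<xi> \<theta> - \<xi> 0) \<le> L3 * \<bar>\<theta> - 0\<bar>"
      using that tau by (intro xi_lipschitz) auto
    also have "\<dots> \<le> L3 * \<tau>"
      using that L3 by (intro mult_left_mono) auto
    finally show ?thesis
      unfolding X0_def using norm_triangle_sub[of "\<xi> \<theta>" "\<xi> 0"] by linarith
  qed
  have X00: "X0 \<ge> 0"
    using L3 tau by (simp add: X0_def)
  \<comment> \<open>The rate is chosen with \<open>c / l \<le> 1 / 2\<close>, so that the integrated
    drift bound costs at most half of the weighted supremum. The summand 1 keeps \<open>l\<close>
    positive if \<open>c = 0\<close>.\<close>
  define l where "l = 2 * c + 1"
  have l: "l > 0" "c / l \<le> 1 / 2"
    using c by (auto simp: l_def field_simps)
  define K where "K = 2 * (X0 + c * T + S * T powr \<gamma>) * exp (l * T)"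
  have K0: "K \<ge> 0"
    using X00 c S T by (simp add: K_def)
  show ?thesis
  proof (rule that[OF K0])
    fix x w H t assume sp: "solution_path x w H" and t: "t \<in> {-\<tau>..T}"
    have H: "0 \<le> H" and cont: "continuous_on {-\<tau>..T} x" and init: "\<And>\<theta>. \<theta> \<in> {-\<tau>..0} \<Longrightarrow> x \<theta> = \<xi> \<theta>"
      and w0: "w 0 = 0" and hoelder: "\<And>s r. s \<in> {0..T} \<Longrightarrow> r \<in> {0..T} \<Longrightarrow> norm (w s - w r) \<le> H * \<bar>s - r\<bar> powr \<gamma>"
      and int: "\<And>t. t \<in> {0..T} \<Longrightarrow> set_integrable lborel {0..t} (drift x)"
      and eq: "\<And>t. t \<in> {0..T} \<Longrightarrow> x t = \<xi> 0 + (LINT s:{0..t}|lborel. drift x s) + \<sigma> *v w t"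
      using sp by (auto simp: solution_path_def)
    \<comment> \<open>An exponentially weighted supremum, attained at \<open>r0\<close>, replaces Gronwall's inequality.\<close>
    define E where "E r = exp (- l * max 0 r) * norm (x r)" for r
    have "continuous_on {-\<tau>..T} E"
      unfolding E_def[abs_def] by (intro continuous_intros cont)
    then obtain r0 where r0: "r0 \<in> {-\<tau>..T}" and max: "\<And>r. r \<in> {-\<tau>..T} \<Longrightarrow> E r \<le> E r0"
      using continuous_attains_sup[of "{-\<tau>..T}" E] tau T by auto
    define N where "N = E r0"
    have N0: "0 \<le> N"
      by (simp add: N_def E_def)
    have xN: "norm (x r) \<le> N * exp (l * max 0 r)" if "r \<in> {-\<tau>..T}" for r
    proof -
      have "norm (x r) = E r * exp (l * max 0 r)"
        by (simp add: E_def exp_minus)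
      also have "\<dots> \<le> N * exp (l * max 0 r)"
        using max[OF that] by (simp add: N_def)
      finally show ?thesis .
    qed
    have dr: "norm (drift x s) \<le> c * (1 + N * exp (l * s))" if s: "s \<in> {0..T}" for s
    proof (rule growth)
      show "continuous_on {s - \<tau>..s} x"
        using s by (intro continuous_on_subset[OF cont]) auto
      fix r assume r: "s - \<tau> \<le> r" "r \<le> s"
      have "norm (x r) \<le> N * exp (l * max 0 r)"
        using r s by (intro xN) auto
      also have "\<dots> \<le> N * exp (l * s)"
        using r s l N0 by (intro mult_left_mono) auto
      finally show "norm (x r) \<le> N * exp (l * s)" .
    qed
    define A where "A = X0 + c * T + S * (H * T powr \<gamma>)"
    have xt: "norm (x s) \<le> A + N / 2 * exp (l * s)" if s: "s \<in> {0..T}" for s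
    proof -
      have hb: "has_bochner_integral lborel (\<lambda>u. (c * (1 + N * exp (l * u))) * indicator {0..s} u)
          (c * (s + N * exp (l * s) / l) - c * (0 + N * exp (l * 0) / l))"
        using s l by (intro has_bochner_integral_FTC_Icc_real) (auto intro!: derivative_eq_intros continuous_intros)
      have si: "set_integrable lborel {0..s} (\<lambda>u. c * (1 + N * exp (l * u)))"
        using hb by (simp add: set_integrable_def has_bochner_integral_iff mult.commute)
      have "norm (LINT u:{0..s}|lborel. drift x u) \<le> (LINT u:{0..s}|lborel. norm (drift x u))"
        using int[OF s] by (rule set_integral_norm_bound)
      also have "\<dots> \<le> (LINT u:{0..s}|lborel. c * (1 + N * exp (l * u)))"
        using int[OF s] si dr s by (intro set_integral_mono set_integrable_norm) auto
      also have "\<dots> = c * (s + N * exp (l * s) / l) - c * (0 + N * exp (l * 0) / l)"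
        unfolding set_lebesgue_integral_def using has_bochner_integral_integral_eq[OF hb]
        by (simp only: real_scaleR_def mult.commute)
      also have "\<dots> \<le> c * s + (c / l) * (N * exp (l * s))"
        using c N0 l by (simp add: algebra_simps)
      also have "\<dots> \<le> c * T + 1 / 2 * (N * exp (l * s))"
        using s c N0 l by (intro add_mono mult_mono mult_left_mono) auto
      finally have 1: "norm (LINT u:{0..s}|lborel. drift x u) \<le> c * T + N / 2 * exp (l * s)"
        by simp
      have "norm (w s) \<le> H * \<bar>s - 0\<bar> powr \<gamma>"
        using hoelder[of s 0] s T w0 by simp
      also have "\<dots> \<le> H * T powr \<gamma>"
        using s H gamma by (intro mult_left_mono powr_mono2) auto
      finally have 2: "norm (\<sigma> *v w s) \<le> S * (H * T powr \<gamma>)"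
        using S by (meson mult_left_mono order_trans)
      have 3: "norm (\<xi> 0) \<le> X0"
        using X0[of 0] tau by simp
      have "norm (x s) \<le> norm (\<xi> 0) + norm (LINT u:{0..s}|lborel. drift x u) + norm (\<sigma> *v w s)"
        unfolding eq[OF s] by (intro order_trans[OF norm_triangle_ineq] add_right_mono norm_triangle_ineq)
      then show ?thesis
        using 1 2 3 unfolding A_def by linarith
    qed
    have A0: "X0 \<le> A" "0 \<le> A"
      using X00 c T S H by (auto simp: A_def)
    \<comment> \<open>The estimate is taken at the maximiser \<open>r0\<close>; for
      \<open>r0 \<le> 0\<close> the initial datum bounds it directly. The term \<open>N / 2\<close>
      is then absorbed into the left side.\<close>
    have "N \<le> A + N / 2"
    proof (cases "r0 \<le> 0")
      case True
      then have "N = norm (\<xi> r0)"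
        using init[of r0] r0 by (simp add: N_def E_def max_def)
      then show ?thesis
        using X0[of r0] r0 True A0 N0 by auto
    next
      case False
      then have "N = exp (- (l * r0)) * norm (x r0)"
        by (simp add: N_def E_def)
      also have "\<dots> \<le> exp (- (l * r0)) * (A + N / 2 * exp (l * r0))"
        using False r0 by (intro mult_left_mono xt) auto
      also have "\<dots> = exp (- (l * r0)) * A + N / 2"
        by (simp add: algebra_simps exp_minus)
      also have "exp (- (l * r0)) * A \<le> 1 * A"
        using False l A0 by (intro mult_right_mono) auto
      finally show ?thesis
        by simp
    qed
    then have N: "N \<le> 2 * A"
      by simp
    have "norm (x t) \<le> N * exp (l * max 0 t)"
      using t by (rule xN)
    also have "\<dots> \<le> 2 * A * exp (l * T)"
      using N N0 t l T by (intro mult_mono) auto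
    also have "\<dots> \<le> 2 * ((X0 + c * T + S * T powr \<gamma>) * (1 + H)) * exp (l * T)"
    proof -
      have "0 \<le> (X0 + c * T) * H + S * T powr \<gamma>"
        using X00 c T H S(1) by simp
      then have "A \<le> (X0 + c * T + S * T powr \<gamma>) * (1 + H)"
        by (simp add: A_def algebra_simps)
      then show ?thesis
        by simp
    qed
    finally show "norm (x t) \<le> K * (1 + H)"
      by (simp add: K_def mult_ac)
  qed
qed

lemma solution_path_increment:
  assumes sp: "solution_path x w H" and rs: "0 \<le> r" "r \<le> s" "s \<le> T"
    and bound: "\<And>u. r < u \<Longrightarrow> u < s \<Longrightarrow> norm (drift x u - c) \<le> B"
  shows "norm (x s - x r - (s - r) *\<^sub>R c - \<sigma> *v (w s - w r)) \<le> (s - r) * B"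
proof -
  have int: "set_integrable lborel {0..s} (drift x)"
    and eq: "x s = \<xi> 0 + (LINT u:{0..s}|lborel. drift x u) + \<sigma> *v w s"
      "x r = \<xi> 0 + (LINT u:{0..r}|lborel. drift x u) + \<sigma> *v w r"
    using sp rs by (auto simp: solution_path_def)
  have increment: "x s - x r - (s - r) *\<^sub>R c - \<sigma> *v (w s - w r)
      = (LINT u:{0..s}|lborel. drift x u) - (LINT u:{0..r}|lborel. drift x u) - (s - r) *\<^sub>R c"
    unfolding eq by (simp add: matrix_vector_mult_diff_distrib)
  show ?thesis
    unfolding increment by (rule set_integral_increment[OF rs(1,2) int bound])
qed

text \<open>The noise is Hoelder, while the integral of the bounded drift and the initial datum are
  Lipschitz. On bounded intervals the latter are Hoelder too, by
  \<open>x = x powr (1 - \<gamma>) * x powr \<gamma>\<close>, which brings in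
  \<open>T powr (1 - \<gamma>)\<close> and \<open>\<tau> powr (1 - \<gamma>)\<close>. Intervals
  straddling zero are split there.\<close>

lemma solution_path_hoelder:
  obtains K where "K \<ge> 0"
    "\<And>x w H s r. solution_path x w H \<Longrightarrow> s \<in> {-\<tau>..T} \<Longrightarrow> r \<in> {-\<tau>..T} \<Longrightarrow>
      norm (x s - x r) \<le> K * (1 + H) * \<bar>s - r\<bar> powr \<gamma>"
proof -
  obtain c where c: "c \<ge> 0" and growth: "\<And>x s B. continuous_on {s - \<tau>..s} x \<Longrightarrow>
      (\<And>r. s - \<tau> \<le> r \<Longrightarrow> r \<le> s \<Longrightarrow> norm (x r) \<le> B) \<Longrightarrow> norm (drift x s) \<le> c * (1 + B)"
    by (rule drift_growth) blast
  obtain S where S: "S \<ge> 0" "\<And>v. norm (\<sigma> *v v) \<le> S * norm v"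
    by (rule sigma_bound) blast
  obtain K0 where K0: "K0 \<ge> 0"
    and xK: "\<And>x w H t. solution_path x w H \<Longrightarrow> t \<in> {-\<tau>..T} \<Longrightarrow> norm (x t) \<le> K0 * (1 + H)"
    by (rule solution_path_bound) blast
  define K1 where "K1 = c * (1 + K0) * T powr (1 - \<gamma>) + S"
  define K2 where "K2 = L3 * \<tau> powr (1 - \<gamma>)"
  have K12: "K1 \<ge> 0" "K2 \<ge> 0"
    using c K0 S L3 by (auto simp: K1_def K2_def)
  show ?thesis
  proof (rule that[of "K1 + K2"])
    show "0 \<le> K1 + K2"
      using K12 by simp
    fix x w H s r assume sp: "solution_path x w H" and sr: "s \<in> {-\<tau>..T}" "r \<in> {-\<tau>..T}"
    have H: "0 \<le> H" and cont: "continuous_on {-\<tau>..T} x" and init: "\<And>\<theta>. \<theta> \<in> {-\<tau>..0} \<Longrightarrow> x \<theta> = \<xi> \<theta>"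
      and hoelder: "\<And>s r. s \<in> {0..T} \<Longrightarrow> r \<in> {0..T} \<Longrightarrow> norm (w s - w r) \<le> H * \<bar>s - r\<bar> powr \<gamma>"
      using sp by (auto simp: solution_path_def)
    have pos: "norm (x v - x u) \<le> K1 * (1 + H) * (v - u) powr \<gamma>" if uv: "0 \<le> u" "u \<le> v" "v \<le> T" for u v
    proof -
      have "norm (x v - x u - (v - u) *\<^sub>R 0 - \<sigma> *v (w v - w u)) \<le> (v - u) * (c * (1 + K0 * (1 + H)))"
      proof (rule solution_path_increment[OF sp uv])
        fix q assume q: "u < q" "q < v"
        have "norm (drift x q) \<le> c * (1 + K0 * (1 + H))"
          using q uv by (intro growth continuous_on_subset[OF cont] xK[OF sp]) auto
        then show "norm (drift x q - 0) \<le> c * (1 + K0 * (1 + H))"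
          by simp
      qed
      then have "norm (x v - x u) \<le> (v - u) * (c * (1 + K0 * (1 + H))) + norm (\<sigma> *v (w v - w u))"
        using norm_triangle_sub[of "x v - x u" "\<sigma> *v (w v - w u)"] by simp
      also have "norm (\<sigma> *v (w v - w u)) \<le> S * (H * (v - u) powr \<gamma>)"
        using hoelder[of v u] uv S by (intro order_trans[OF S(2)] mult_left_mono) auto
      also have "(v - u) * (c * (1 + K0 * (1 + H)))
          \<le> (T powr (1 - \<gamma>) * (v - u) powr \<gamma>) * (c * (1 + K0) * (1 + H))"
      proof (rule mult_mono)
        show "v - u \<le> T powr (1 - \<gamma>) * (v - u) powr \<gamma>"
          using uv gamma by (intro le_powr_mult) auto
        have "1 + K0 * (1 + H) \<le> (1 + K0) * (1 + H)"
          using H by (simp add: algebra_simps)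
        then show "c * (1 + K0 * (1 + H)) \<le> c * (1 + K0) * (1 + H)"
          using c by (simp add: mult.assoc mult_left_mono)
      qed (use c K0 H in auto)
      also have "S * (H * (v - u) powr \<gamma>) \<le> S * ((1 + H) * (v - u) powr \<gamma>)"
        using S H by (intro mult_left_mono mult_right_mono) auto
      finally show ?thesis
        by (simp add: K1_def algebra_simps)
    qed
    have neg: "norm (x v - x u) \<le> K2 * (v - u) powr \<gamma>" if uv: "-\<tau> \<le> u" "u \<le> v" "v \<le> 0" for u v
    proof -
      have "norm (x v - x u) \<le> L3 * (v - u)"
        using uv xi_lipschitz[of u v] init[of u] init[of v] by auto
      also have "\<dots> \<le> L3 * (\<tau> powr (1 - \<gamma>) * (v - u) powr \<gamma>)"
        using uv gamma L3 by (intro mult_left_mono le_powr_mult) auto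
      finally show ?thesis
        by (simp add: K2_def mult_ac)
    qed
    have K2H: "K2 \<le> K2 * (1 + H)"
      using K12 H by (simp add: algebra_simps)
    have le: "norm (x v - x u) \<le> (K1 + K2) * (1 + H) * (v - u) powr \<gamma>" if uv: "-\<tau> \<le> u" "u \<le> v" "v \<le> T" for u v
    proof -
      consider "0 \<le> u" | "v \<le> 0" | "u < 0" "0 < v"
        by linarith
      then show ?thesis
      proof cases
        case 1
        have "norm (x v - x u) \<le> K1 * (1 + H) * (v - u) powr \<gamma>"
          using 1 uv by (intro pos) auto
        also have "\<dots> \<le> (K1 + K2) * (1 + H) * (v - u) powr \<gamma>"
          using K12 H by (intro mult_right_mono) auto
        finally show ?thesis .
      next
        case 2
        have "norm (x v - x u) \<le> K2 * (v - u) powr \<gamma>"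
          using 2 uv by (intro neg) auto
        also have "\<dots> \<le> K2 * (1 + H) * (v - u) powr \<gamma>"
          using K2H by (intro mult_right_mono) auto
        also have "\<dots> \<le> (K1 + K2) * (1 + H) * (v - u) powr \<gamma>"
          using K12 H by (intro mult_right_mono) auto
        finally show ?thesis .
      next
        case 3
        have "norm (x v - x u) \<le> norm (x v - x 0) + norm (x 0 - x u)"
          by norm
        also have "\<dots> \<le> K1 * (1 + H) * (v - 0) powr \<gamma> + K2 * (0 - u) powr \<gamma>"
          using 3 uv by (intro add_mono pos neg) auto
        also have "\<dots> \<le> K1 * (1 + H) * (v - u) powr \<gamma> + K2 * (1 + H) * (v - u) powr \<gamma>"
          using 3 K12 K2H H gamma by (intro add_mono mult_left_mono mult_mono powr_mono2) auto
        finally show ?thesis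
          by (simp add: algebra_simps)
      qed
    qed
    show "norm (x s - x r) \<le> (K1 + K2) * (1 + H) * \<bar>s - r\<bar> powr \<gamma>"
      using le[of r s] le[of s r] sr by (cases "r \<le> s") (auto simp: norm_minus_commute)
  qed
qed

text \<open>As \<open>\<delta> \<le> 1\<close>, the power \<open>\<gamma> * \<alpha>\<close> of
  \<open>\<delta>\<close> dominates the power \<open>\<gamma>\<close>. The factor
  \<open>1 + H\<close> stays linear through
  \<open>(D * (1 + H)) powr \<alpha> \<le> 1 + D * (1 + H)\<close>, so a square integrable
  \<open>H\<close> gives a square integrable bound.\<close>

lemma lipschitz_hoelder_le:
  assumes D: "D \<ge> 0" and H: "H \<ge> 0" and \<delta>: "0 < \<delta>" "\<delta> \<le> 1"
    and B: "0 \<le> B" "B \<le> D * (1 + H) * \<delta> powr \<gamma>"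
  shows "L1 * B + L2 * B powr \<alpha> \<le> (L1 * D + L2 * (1 + D)) * (1 + H) * \<delta> powr (\<gamma> * \<alpha>)"
proof -
  have DH: "0 \<le> D * (1 + H)"
    using D H by simp
  have "\<delta> powr \<gamma> \<le> \<delta> powr (\<gamma> * \<alpha>)"
    using \<delta> gamma alpha by (intro powr_antimono_exp) (auto simp: mult_left_le)
  then have "B \<le> D * (1 + H) * \<delta> powr (\<gamma> * \<alpha>)"
    using B DH by (meson mult_left_mono order_trans)
  then have 1: "L1 * B \<le> L1 * (D * (1 + H) * \<delta> powr (\<gamma> * \<alpha>))"
    using L by (intro mult_left_mono)
  have "B powr \<alpha> \<le> (D * (1 + H) * \<delta> powr \<gamma>) powr \<alpha>"
    using B alpha by (intro powr_mono2) auto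
  also have "\<dots> = (D * (1 + H)) powr \<alpha> * \<delta> powr (\<gamma> * \<alpha>)"
    using DH by (simp add: powr_mult powr_powr)
  also have "\<dots> \<le> (1 + D * (1 + H)) * \<delta> powr (\<gamma> * \<alpha>)"
    using powr_alpha_le[OF DH] by (intro mult_right_mono) auto
  also have "\<dots> \<le> (1 + D) * (1 + H) * \<delta> powr (\<gamma> * \<alpha>)"
    using H by (intro mult_right_mono) (auto simp: algebra_simps)
  finally have 2: "L2 * B powr \<alpha> \<le> L2 * ((1 + D) * (1 + H) * \<delta> powr (\<gamma> * \<alpha>))"
    using L by (intro mult_left_mono)
  show ?thesis
    using add_mono[OF 1 2] by (simp add: algebra_simps)
qed

lemma solution_path_em_drift:
  obtains K where "K \<ge> 0"
    "\<And>x w H \<delta> m k s. solution_path x w H \<Longrightarrow> 0 < \<delta> \<Longrightarrow> \<delta> \<le> 1 \<Longrightarrow> \<tau> = real m * \<delta> \<Longrightarrow> m > 0 \<Longrightarrow>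
      k \<ge> 0 \<Longrightarrow> of_int k * \<delta> \<le> s \<Longrightarrow> s \<le> (of_int k + 1) * \<delta> \<Longrightarrow> s \<le> T \<Longrightarrow>
      norm (em_drift \<delta> x k - drift x s) \<le> K * (1 + H) * \<delta> powr (\<gamma> * \<alpha>)"
proof -
  obtain K0 where K0: "K0 \<ge> 0" and xK: "\<And>x w H s r. solution_path x w H \<Longrightarrow> s \<in> {-\<tau>..T} \<Longrightarrow>
      r \<in> {-\<tau>..T} \<Longrightarrow> norm (x s - x r) \<le> K0 * (1 + H) * \<bar>s - r\<bar> powr \<gamma>"
    by (rule solution_path_hoelder) blast
  show ?thesis
  proof (rule that[of "L1 * (2 * K0) + L2 * (1 + 2 * K0)"])
    show "0 \<le> L1 * (2 * K0) + L2 * (1 + 2 * K0)"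
      using K0 L by simp
    fix x w H \<delta> m k s
    assume sp: "solution_path x w H" and \<delta>: "0 < \<delta>" "\<delta> \<le> 1" and m: "\<tau> = real m * \<delta>" "m > 0"
      and k: "k \<ge> 0" "of_int k * \<delta> \<le> s" "s \<le> (of_int k + 1) * \<delta>" "s \<le> T"
    have H: "0 \<le> H" and cont: "continuous_on {-\<tau>..T} x"
      using sp by (auto simp: solution_path_def)
    \<comment> \<open>The path is compared at times up to \<open>2 * \<delta>\<close> apart;
      \<open>2 powr \<gamma> \<le> 2\<close> explains the factor 2 in front of
      \<open>K0\<close>.\<close>
    let ?B = "K0 * (1 + H) * (2 * \<delta>) powr \<gamma>"
    have "norm (em_drift \<delta> x k - drift x s) \<le> L1 * ?B + L2 * ?B powr \<alpha>"
    proof (rule em_drift_close[OF \<delta>(1) m k cont])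
      fix p q assume pq: "-\<tau> \<le> p" "p \<le> T" "-\<tau> \<le> q" "q \<le> T" "\<bar>p - q\<bar> \<le> 2 * \<delta>"
      have "norm (x p - x q) \<le> K0 * (1 + H) * \<bar>p - q\<bar> powr \<gamma>"
        using pq by (intro xK[OF sp]) auto
      also have "\<dots> \<le> ?B"
        using pq K0 H gamma by (intro mult_left_mono powr_mono2) auto
      finally show "norm (x p - x q) \<le> ?B" .
    qed
    also have "\<dots> \<le> (L1 * (2 * K0) + L2 * (1 + 2 * K0)) * (1 + H) * \<delta> powr (\<gamma> * \<alpha>)"
    proof (rule lipschitz_hoelder_le[OF _ H \<delta>])
      have "2 powr \<gamma> \<le> (2::real) powr 1"
        using gamma by (intro powr_mono) auto
      then have "(2 * \<delta>) powr \<gamma> \<le> 2 * \<delta> powr \<gamma>"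
        using \<delta> by (simp add: powr_mult)
      then have "K0 * (1 + H) * (2 * \<delta>) powr \<gamma> \<le> K0 * (1 + H) * (2 * \<delta> powr \<gamma>)"
        using K0 H by (intro mult_left_mono) auto
      then show "?B \<le> 2 * K0 * (1 + H) * \<delta> powr \<gamma>"
        by (simp add: algebra_simps)
    qed (use K0 H in auto)
    finally show "norm (em_drift \<delta> x k - drift x s)
        \<le> (L1 * (2 * K0) + L2 * (1 + 2 * K0)) * (1 + H) * \<delta> powr (\<gamma> * \<alpha>)" .
  qed
qed

text \<open>The drift in the recursion is that of \<open>x\<close> and not of \<open>y\<close>, so
  the noise cancels and the local errors simply add up: \<open>j\<close> steps, each contributing
  \<open>h\<close> times the consistency error, give at most \<open>T\<close> times that error,
  without a Gronwall factor.\<close>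

lemma fine_euler_close:
  obtains K where "K \<ge> 0"
    "\<And>x w H h m n y j. solution_path x w H \<Longrightarrow> 0 < h \<Longrightarrow> h \<le> 1 \<Longrightarrow> \<tau> = real m * h \<Longrightarrow> m > 0 \<Longrightarrow>
      real n * h \<le> T \<Longrightarrow> y 0 = \<xi> 0 \<Longrightarrow>
      (\<And>j. j < n \<Longrightarrow> y (Suc j) = y j + h *\<^sub>R em_drift h x (int j) + \<sigma> *v (w (real (Suc j) * h) - w (real j * h))) \<Longrightarrow>
      j \<le> n \<Longrightarrow> norm (y j - x (real j * h)) \<le> K * (1 + H) * h powr (\<gamma> * \<alpha>)"
proof -
  obtain K0 where K0: "K0 \<ge> 0" and dK:
    "\<And>x w H \<delta> m k s. solution_path x w H \<Longrightarrow> 0 < \<delta> \<Longrightarrow> \<delta> \<le> 1 \<Longrightarrow> \<tau> = real m * \<delta> \<Longrightarrow> m > 0 \<Longrightarrow>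
      k \<ge> 0 \<Longrightarrow> of_int k * \<delta> \<le> s \<Longrightarrow> s \<le> (of_int k + 1) * \<delta> \<Longrightarrow> s \<le> T \<Longrightarrow>
      norm (em_drift \<delta> x k - drift x s) \<le> K0 * (1 + H) * \<delta> powr (\<gamma> * \<alpha>)"
    by (rule solution_path_em_drift) blast
  show ?thesis
  proof (rule that[of "T * K0"])
    show "0 \<le> T * K0"
      using K0 T by simp
    fix x w H h m n y j
    assume sp: "solution_path x w H" and h: "0 < h" "h \<le> 1" and m: "\<tau> = real m * h" "m > 0"
      and n: "real n * h \<le> T" and y0: "y 0 = \<xi> 0"
      and y: "\<And>j. j < n \<Longrightarrow> y (Suc j) = y j + h *\<^sub>R em_drift h x (int j) + \<sigma> *v (w (real (Suc j) * h) - w (real j * h))"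
      and j: "j \<le> n"
    have H: "0 \<le> H"
      using sp by (auto simp: solution_path_def)
    let ?B = "K0 * (1 + H) * h powr (\<gamma> * \<alpha>)"
    have "norm (y j - x (real j * h)) \<le> real j * h * ?B"
      using j
    proof (induction j)
      case 0
      then show ?case
        using y0 sp tau by (simp add: solution_path_def)
    next
      case (Suc j)
      let ?r = "real j * h" and ?s = "real (Suc j) * h" and ?a = "em_drift h x (int j)"
      have sT: "?s \<le> T"
        using Suc.prems n h by (intro order_trans[OF _ n] mult_right_mono) auto
      have sr: "?s - ?r = h"
        by (simp add: algebra_simps)
      have "norm (x ?s - x ?r - (?s - ?r) *\<^sub>R ?a - \<sigma> *v (w ?s - w ?r)) \<le> (?s - ?r) * ?B"
      proof (rule solution_path_increment[OF sp _ _ sT])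
        fix u assume u: "?r < u" "u < ?s"
        have "norm (?a - drift x u) \<le> ?B"
          using u sT h by (intro dK[OF sp h m]) (auto simp: algebra_simps)
        then show "norm (drift x u - ?a) \<le> ?B"
          by (simp add: norm_minus_commute)
      qed (use h in \<open>auto simp: algebra_simps\<close>)
      then have 1: "norm (x ?s - x ?r - h *\<^sub>R ?a - \<sigma> *v (w ?s - w ?r)) \<le> h * ?B"
        unfolding sr .
      have "y (Suc j) - x ?s = (y j - x ?r) - (x ?s - x ?r - h *\<^sub>R ?a - \<sigma> *v (w ?s - w ?r))"
        using y[of j] Suc.prems by simp
      then have "norm (y (Suc j) - x ?s) \<le> norm (y j - x ?r) + norm (x ?s - x ?r - h *\<^sub>R ?a - \<sigma> *v (w ?s - w ?r))"
        by (metis norm_triangle_ineq4)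
      also have "\<dots> \<le> real j * h * ?B + h * ?B"
        using Suc 1 by (intro add_mono) auto
      also have "\<dots> = real (Suc j) * h * ?B"
        by (simp add: algebra_simps)
      finally show ?case .
    qed
    also have "\<dots> \<le> T * ?B"
    proof (intro mult_right_mono)
      have "real j * h \<le> real n * h"
        using j h by (intro mult_right_mono) auto
      then show "real j * h \<le> T"
        using n by linarith
    qed (use K0 H in auto)
    finally show "norm (y j - x (real j * h)) \<le> T * K0 * (1 + H) * h powr (\<gamma> * \<alpha>)"
      by (simp add: mult_ac)
  qed
qed

text \<open>\<open>y\<close> lists values on the grid of width \<open>h = \<delta>/N\<close>; the scheme of step \<open>\<delta>\<close> only reads every \<open>N\<close>-th of them.\<close>

definition grid_path :: "real \<Rightarrow> nat \<Rightarrow> (nat \<Rightarrow> real ^ 'd) \<Rightarrow> real \<Rightarrow> real ^ 'd" where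
  "grid_path \<delta> N y s = (if s \<le> 0 then \<xi> s else y (N * nat \<lfloor>s / \<delta>\<rfloor>))"

abbreviation grid_drift :: "real \<Rightarrow> nat \<Rightarrow> (nat \<Rightarrow> real ^ 'd) \<Rightarrow> nat \<Rightarrow> real ^ 'd" where
  "grid_drift \<delta> N y k \<equiv> em_drift \<delta> (grid_path \<delta> N y) (int k)"

lemma grid_path_at:
  assumes "\<delta> > 0"
  shows "grid_path \<delta> N y ((real k - real i) * \<delta>)
    = (if k \<le> i then \<xi> ((real k - real i) * \<delta>) else y (N * (k - i)))"
proof (cases "k \<le> i")
  case True
  then have "(real k - real i) * \<delta> \<le> 0"
    using assms by (intro mult_nonpos_nonneg) auto
  then show ?thesis
    using True by (simp add: grid_path_def)
next
  case False
  then have "\<not> (real k - real i) * \<delta> \<le> 0"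
    using assms by (simp add: mult_le_0_iff)
  moreover have "(real k - real i) * \<delta> / \<delta> = of_int (int (k - i))"
    using assms False by (simp add: of_nat_diff)
  then have "nat \<lfloor>(real k - real i) * \<delta> / \<delta>\<rfloor> = k - i"
    by (metis floor_of_int nat_int)
  ultimately show ?thesis
    using False by (simp only: grid_path_def if_False)
qed

text \<open>The sum is a crude stand-in for a maximum over the entries that are read. It vanishes
  when the entries up to \<open>N * k\<close> agree, which gives causality, and it is continuous in
  finitely many coordinates, which gives measurability.\<close>

lemma grid_drift_diff_le:
  fixes N k :: nat
  assumes \<delta>: "\<delta> > 0" and m: "\<tau> = real m * \<delta>" "m > 0"
  defines "B \<equiv> \<lambda>y y'. \<Sum>i\<le>N * k. norm (y i - y' i)"
  shows "norm (grid_drift \<delta> N y k - grid_drift \<delta> N y' k) \<le> L1 * B y y' + L2 * B y y' powr \<alpha>"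
proof (rule em_drift_diff_le[OF \<delta> m])
  fix i assume "i \<le> m"
  have "norm (y (N * (k - i)) - y' (N * (k - i))) \<le> B y y'"
    unfolding B_def by (intro member_le_sum[of _ _ "\<lambda>i. norm (y i - y' i)"]) auto
  moreover have "0 \<le> B y y'"
    unfolding B_def by (intro sum_nonneg) auto
  ultimately show "norm (grid_path \<delta> N y ((of_int (int k) - real i) * \<delta>)
      - grid_path \<delta> N y' ((of_int (int k) - real i) * \<delta>)) \<le> B y y'"
    unfolding of_int_of_nat_eq grid_path_at[OF \<delta>] by simp
qed

lemma grid_drift_cong:
  assumes "\<delta> > 0" "\<tau> = real m * \<delta>" "m > 0" and "\<And>i. i \<le> N * k \<Longrightarrow> y i = y' i"
  shows "grid_drift \<delta> N y k = grid_drift \<delta> N y' k"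
  using grid_drift_diff_le[OF assms(1-3), where N = N and k = k and y = y and y' = y'] assms(4) by simp

text \<open>On sequences with the product topology the drift is continuous, because its modulus
  tends to zero along with finitely many coordinates. Measurability thus rests on the Hoelder bound
  for \<open>Z\<close>, and no sigma-algebra on the path space enters.\<close>

lemma grid_drift_measurable:
  assumes \<delta>: "\<delta> > 0" and m: "\<tau> = real m * \<delta>" "m > 0"
  shows "(\<lambda>y. grid_drift \<delta> N y k) \<in> borel_measurable borel"
proof (intro borel_measurable_continuous_onI)
  show "continuous_on UNIV (\<lambda>y. grid_drift \<delta> N y k)"
    unfolding continuous_on_def
  proof
    fix y :: "nat \<Rightarrow> real ^ 'd"
    let ?B = "\<lambda>y'. \<Sum>i\<le>N * k. norm (y' i - y i)"
    have coord: "((\<lambda>y'. y' i) \<longlongrightarrow> y i) (at y)" for i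
      using continuous_on_product_coordinates[of i] by (auto simp: continuous_on_def)
    have "(?B \<longlongrightarrow> (\<Sum>i\<le>N * k. norm (y i - y i))) (at y)"
      by (intro tendsto_intros coord)
    then have B: "(?B \<longlongrightarrow> 0) (at y)"
      by simp
    have "((\<lambda>y'. ?B y' powr \<alpha>) \<longlongrightarrow> 0) (at y)"
      using alpha by (intro tendsto_zero_powrI[OF B]) (auto intro!: always_eventually sum_nonneg)
    then have "((\<lambda>y'. L1 * ?B y' + L2 * ?B y' powr \<alpha>) \<longlongrightarrow> L1 * 0 + L2 * 0) (at y)"
      by (intro tendsto_intros B)
    then have lim: "((\<lambda>y'. L1 * ?B y' + L2 * ?B y' powr \<alpha>) \<longlongrightarrow> 0) (at y)"
      by simp
    have "((\<lambda>y'. grid_drift \<delta> N y' k - grid_drift \<delta> N y k) \<longlongrightarrow> 0) (at y)"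
      using lim by (rule Lim_null_comparison[OF always_eventually, OF allI, OF grid_drift_diff_le[OF \<delta> m]])
    then show "((\<lambda>y. grid_drift \<delta> N y k) \<longlongrightarrow> grid_drift \<delta> N y k) (at y within UNIV)"
      by (subst Lim_null) simp
  qed
qed

lemma grid_drift_measurable_comp:
  assumes \<delta>: "\<delta> > 0" and m: "\<tau> = real m * \<delta>" "m > 0"
    and y: "\<And>i. i \<le> N * k \<Longrightarrow> y i \<in> borel_measurable M"
  shows "(\<lambda>\<omega>. grid_drift \<delta> N (\<lambda>i. y i \<omega>) k) \<in> borel_measurable M"
proof -
  \<comment> \<open>Entries beyond \<open>N * k\<close> are not assumed measurable; as they are
    never read, they are set to zero.\<close>
  let ?y = "\<lambda>i \<omega>. if i \<le> N * k then y i \<omega> else 0"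
  have "?y i \<in> borel_measurable M" for i
    using y by (cases "i \<le> N * k") auto
  then have "(\<lambda>\<omega> i. ?y i \<omega>) \<in> borel_measurable M"
    by (rule measurable_coordinatewise_then_product)
  from measurable_compose[OF this grid_drift_measurable[OF \<delta> m]]
  have "(\<lambda>\<omega>. grid_drift \<delta> N (\<lambda>i. ?y i \<omega>) k) \<in> borel_measurable M" .
  also have "(\<lambda>\<omega>. grid_drift \<delta> N (\<lambda>i. ?y i \<omega>) k) = (\<lambda>\<omega>. grid_drift \<delta> N (\<lambda>i. y i \<omega>) k)"
    by (intro ext grid_drift_cong[OF \<delta> m]) auto
  finally show ?thesis .
qed

lemma em_drift_eq_grid_drift:
  assumes \<delta>: "\<delta> > 0" and m: "\<tau> = real m * \<delta>" "m > 0" and h: "\<delta> = real N * h"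
    and init: "\<And>\<theta>. \<theta> \<in> {-\<tau>..0} \<Longrightarrow> x \<theta> = \<xi> \<theta>"
  shows "em_drift \<delta> x (int k) = grid_drift \<delta> N (\<lambda>j. x (real j * h)) k"
proof -
  \<comment> \<open>Equality is obtained as distance zero: the modulus of continuity with
    \<open>B = 0\<close> reduces it to agreement at the nodes.\<close>
  have "norm (em_drift \<delta> x (int k) - grid_drift \<delta> N (\<lambda>j. x (real j * h)) k) \<le> L1 * 0 + L2 * 0 powr \<alpha>"
  proof (rule em_drift_diff_le[OF \<delta> m])
    fix i assume i: "i \<le> m"
    show "norm (x ((of_int (int k) - real i) * \<delta>)
        - grid_path \<delta> N (\<lambda>j. x (real j * h)) ((of_int (int k) - real i) * \<delta>)) \<le> 0"
    proof (cases "k \<le> i")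
      case True
      have "- real m * \<delta> \<le> (real k - real i) * \<delta>"
        using i \<delta> by (intro mult_right_mono) auto
      moreover have "(real k - real i) * \<delta> \<le> 0"
        using True \<delta> by (intro mult_nonpos_nonneg) auto
      ultimately show ?thesis
        using True init m by (simp add: grid_path_at[OF \<delta>])
    next
      case False
      have "(real k - real i) * \<delta> = real (N * (k - i)) * h"
        using False by (simp add: h of_nat_diff)
      then show ?thesis
        using False unfolding of_int_of_nat_eq grid_path_at[OF \<delta>] by (simp add: mult_ac)
    qed
  qed
  then show ?thesis
    by simp
qed

text \<open>The delayed drift reads earlier values, so the recursion carries the whole list: after
  \<open>j\<close> steps the entries up to \<open>j\<close> are final, and later ones still hold the
  placeholder \<open>\<xi> 0\<close>. The argument \<open>w\<close> is a sequence of noise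
  increments, and \<open>j div N\<close> is the coarse cell of the fine index
  \<open>j\<close>.\<close>

primrec euler_hist :: "real \<Rightarrow> nat \<Rightarrow> real \<Rightarrow> (nat \<Rightarrow> real ^ 'd) \<Rightarrow> nat \<Rightarrow> nat \<Rightarrow> real ^ 'd" where
  "euler_hist \<delta> N h w 0 = (\<lambda>_. \<xi> 0)"
| "euler_hist \<delta> N h w (Suc j) = (euler_hist \<delta> N h w j)(Suc j :=
     euler_hist \<delta> N h w j j + h *\<^sub>R grid_drift \<delta> N (euler_hist \<delta> N h w j) (j div N) + \<sigma> *v w j)"

text \<open>The drift at step \<open>j\<close> reads entries up to \<open>N * (j div N)\<close>,
  hence at most \<open>j\<close>, and these are already identified. Any sequence obeying the
  recursion is therefore a function of its increments.\<close>

lemma euler_hist_unique: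
  assumes \<delta>: "\<delta> > 0" and m: "\<tau> = real m * \<delta>" "m > 0" and y0: "y 0 = \<xi> 0"
    and y: "\<And>j. j < n \<Longrightarrow> y (Suc j) = y j + h *\<^sub>R grid_drift \<delta> N y (j div N) + \<sigma> *v w j"
  shows "j \<le> n \<Longrightarrow> i \<le> j \<Longrightarrow> euler_hist \<delta> N h w j i = y i"
proof (induction j arbitrary: i)
  case (Suc j)
  have IH: "euler_hist \<delta> N h w j i = y i" if "i \<le> j" for i
    using Suc that by simp
  have "grid_drift \<delta> N (euler_hist \<delta> N h w j) (j div N) = grid_drift \<delta> N y (j div N)"
    by (intro grid_drift_cong[OF \<delta> m] IH) (metis order_trans times_div_less_eq_dividend)
  then show ?case
    using Suc.prems IH y[of j] by (auto simp: le_Suc_eq)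
qed (use y0 in simp)

lemma euler_hist_measurable:
  assumes \<delta>: "\<delta> > 0" and m: "\<tau> = real m * \<delta>" "m > 0"
  shows "j \<le> n \<Longrightarrow> (\<lambda>w. euler_hist \<delta> N h w j i) \<in> borel_measurable (\<Pi>\<^sub>M j\<in>{..<n}. borel)"
proof (induction j arbitrary: i)
  case (Suc j)
  have IH[measurable]: "(\<lambda>w. euler_hist \<delta> N h w j i) \<in> borel_measurable (\<Pi>\<^sub>M j\<in>{..<n}. borel)" for i
    using Suc by simp
  have [measurable]: "(\<lambda>w. grid_drift \<delta> N (euler_hist \<delta> N h w j) (j div N)) \<in> borel_measurable (\<Pi>\<^sub>M j\<in>{..<n}. borel)"
    by (rule grid_drift_measurable_comp[OF \<delta> m, of N "j div N" "\<lambda>i w. euler_hist \<delta> N h w j i"]) (rule IH)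
  have s[measurable]: "(*v) \<sigma> \<in> borel_measurable borel"
    by (intro borel_measurable_continuous_onI linear_continuous_on matrix_vector_mul_bounded_linear)
  have w: "(\<lambda>w. w j) \<in> borel_measurable (\<Pi>\<^sub>M j\<in>{..<n}. borel :: (real ^ 'd) measure)"
    using Suc.prems by (intro measurable_component_singleton) auto
  have [measurable]: "(\<lambda>w. \<sigma> *v w j) \<in> borel_measurable (\<Pi>\<^sub>M j\<in>{..<n}. borel)"
    using measurable_compose[OF w s] .
  show ?case
    by (cases "i = Suc j") simp_all
qed simp

lemma em_scheme_recursion:
  assumes h: "h > 0" and N: "N > 0" and \<delta>: "\<delta> = real N * h" and m: "\<tau> = real m * \<delta>" "m > 0"
    and init: "\<And>\<theta>. \<theta> \<in> {-\<tau>..0} \<Longrightarrow> x \<theta> = \<xi> \<theta>"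
    and int: "\<And>t. 0 \<le> t \<Longrightarrow> set_integrable lborel {0..t} (\<lambda>s. em_drift \<delta> x \<lfloor>s / \<delta>\<rfloor>)"
    and eq: "\<And>t. 0 \<le> t \<Longrightarrow> x t = \<xi> 0 + (LINT s:{0..t}|lborel. em_drift \<delta> x \<lfloor>s / \<delta>\<rfloor>) + \<sigma> *v w t"
  shows "x (real (Suc j) * h) = x (real j * h) + h *\<^sub>R grid_drift \<delta> N (\<lambda>j. x (real j * h)) (j div N)
      + \<sigma> *v (w (real (Suc j) * h) - w (real j * h))"
proof -
  define q where "q = j div N"
  let ?r = "real j * h" and ?s = "real (Suc j) * h" and ?c = "em_drift \<delta> x (int q)"
  have \<delta>0: "\<delta> > 0"
    using h N \<delta> by simp
  have rs: "0 \<le> ?r" "?r \<le> ?s" "?s - ?r = h"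
    using h by (auto simp: algebra_simps)
  have qj: "q * N \<le> j" "Suc j \<le> (q + 1) * N"
    using N dividend_less_div_times[of N j] by (auto simp: q_def)
  have lo: "real q * \<delta> \<le> ?r"
  proof -
    have "real q * \<delta> = real (q * N) * h"
      by (simp add: \<delta>)
    also have "\<dots> \<le> ?r"
      using qj(1) h by (intro mult_right_mono) (auto simp del: of_nat_mult)
    finally show ?thesis .
  qed
  have hi: "?s \<le> (real q + 1) * \<delta>"
  proof -
    have "?s \<le> real ((q + 1) * N) * h"
      using qj(2) h by (intro mult_right_mono) (auto simp del: of_nat_mult of_nat_Suc)
    also have "\<dots> = (real q + 1) * \<delta>"
      by (simp add: \<delta> algebra_simps)
    finally show ?thesis .
  qed
  have fl: "\<lfloor>u / \<delta>\<rfloor> = int q" if "?r < u" "u < ?s" for u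
  proof (rule floor_unique)
    show "of_int (int q) \<le> u / \<delta>"
      using lo that \<delta>0 by (simp add: field_simps)
    show "u / \<delta> < of_int (int q) + 1"
      using hi that \<delta>0 by (simp add: field_simps)
  qed
  have "norm ((LINT u:{0..?s}|lborel. em_drift \<delta> x \<lfloor>u / \<delta>\<rfloor>) - (LINT u:{0..?r}|lborel. em_drift \<delta> x \<lfloor>u / \<delta>\<rfloor>)
      - (?s - ?r) *\<^sub>R ?c) \<le> (?s - ?r) * 0"
    using rs fl by (intro set_integral_increment int) auto
  then have "(LINT u:{0..?s}|lborel. em_drift \<delta> x \<lfloor>u / \<delta>\<rfloor>)
      = (LINT u:{0..?r}|lborel. em_drift \<delta> x \<lfloor>u / \<delta>\<rfloor>) + h *\<^sub>R ?c"
    unfolding rs(3) by (simp add: algebra_simps)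
  then have "x ?s = x ?r + h *\<^sub>R ?c + \<sigma> *v (w ?s - w ?r)"
    using eq[of ?s] eq[of ?r] rs by (simp add: matrix_vector_mult_diff_distrib)
  then show ?thesis
    using em_drift_eq_grid_drift[OF \<delta>0 m \<delta> init, of q] by (simp add: q_def)
qed

text \<open>Three errors are added: the fine drift of \<open>x\<close> against its true drift at
  time \<open>real j * h\<close>, the coarse drift of \<open>x\<close> against the same, and the
  coarse drift along \<open>x\<close> against that along \<open>y\<close>. The first two are
  consistency errors, which explains \<open>2 * K0\<close>; the third uses that \<open>y\<close> is
  close to \<open>x\<close>.\<close>

lemma drift_discrepancy:
  obtains K where "K \<ge> 0"
    "\<And>x w H h \<delta> N m n y j. solution_path x w H \<Longrightarrow> 0 < h \<Longrightarrow> N > 0 \<Longrightarrow> \<delta> = real N * h \<Longrightarrow> \<delta> \<le> 1 \<Longrightarrow>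
      \<tau> = real m * \<delta> \<Longrightarrow> m > 0 \<Longrightarrow> h powr \<alpha> \<le> \<delta> \<Longrightarrow> real n * h \<le> T \<Longrightarrow> y 0 = \<xi> 0 \<Longrightarrow>
      (\<And>j. j < n \<Longrightarrow> y (Suc j) = y j + h *\<^sub>R em_drift h x (int j) + \<sigma> *v (w (real (Suc j) * h) - w (real j * h))) \<Longrightarrow>
      j \<le> n \<Longrightarrow> norm (em_drift h x (int j) - grid_drift \<delta> N y (j div N)) \<le> K * (1 + H) * \<delta> powr (\<gamma> * \<alpha>)"
proof -
  obtain K0 where K0: "K0 \<ge> 0" and dK:
    "\<And>x w H \<delta> m k s. solution_path x w H \<Longrightarrow> 0 < \<delta> \<Longrightarrow> \<delta> \<le> 1 \<Longrightarrow> \<tau> = real m * \<delta> \<Longrightarrow> m > 0 \<Longrightarrow>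
      k \<ge> 0 \<Longrightarrow> of_int k * \<delta> \<le> s \<Longrightarrow> s \<le> (of_int k + 1) * \<delta> \<Longrightarrow> s \<le> T \<Longrightarrow>
      norm (em_drift \<delta> x k - drift x s) \<le> K0 * (1 + H) * \<delta> powr (\<gamma> * \<alpha>)"
    by (rule solution_path_em_drift) blast
  obtain K1 where K1: "K1 \<ge> 0" and yK:
    "\<And>x w H h m n y j. solution_path x w H \<Longrightarrow> 0 < h \<Longrightarrow> h \<le> 1 \<Longrightarrow> \<tau> = real m * h \<Longrightarrow> m > 0 \<Longrightarrow>
      real n * h \<le> T \<Longrightarrow> y 0 = \<xi> 0 \<Longrightarrow>
      (\<And>j. j < n \<Longrightarrow> y (Suc j) = y j + h *\<^sub>R em_drift h x (int j) + \<sigma> *v (w (real (Suc j) * h) - w (real j * h))) \<Longrightarrow>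
      j \<le> n \<Longrightarrow> norm (y j - x (real j * h)) \<le> K1 * (1 + H) * h powr (\<gamma> * \<alpha>)"
    by (rule fine_euler_close) blast
  define K2 where "K2 = L1 * K1 + L2 * (1 + K1)"
  have K2: "K2 \<ge> 0"
    using K1 L by (simp add: K2_def)
  show ?thesis
  proof (rule that[of "2 * K0 + K2"])
    show "0 \<le> 2 * K0 + K2"
      using K0 K2 by simp
    fix x w H h \<delta> N m n y j
    assume sp: "solution_path x w H" and h: "0 < h" and N: "N > 0" and \<delta>: "\<delta> = real N * h" "\<delta> \<le> 1"
      and m: "\<tau> = real m * \<delta>" "m > 0" and small: "h powr \<alpha> \<le> \<delta>" and n: "real n * h \<le> T" and y0: "y 0 = \<xi> 0"
      and y: "\<And>j. j < n \<Longrightarrow> y (Suc j) = y j + h *\<^sub>R em_drift h x (int j) + \<sigma> *v (w (real (Suc j) * h) - w (real j * h))"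
      and j: "j \<le> n"
    have H: "0 \<le> H" and init: "\<And>\<theta>. \<theta> \<in> {-\<tau>..0} \<Longrightarrow> x \<theta> = \<xi> \<theta>"
      using sp by (auto simp: solution_path_def)
    define k where "k = j div N"
    let ?s = "real j * h"
    have \<delta>0: "0 < \<delta>"
      using h N \<delta> by simp
    have h\<delta>: "h \<le> \<delta>"
    proof -
      have "1 * h \<le> real N * h"
        using N h by (intro mult_right_mono) auto
      then show ?thesis
        by (simp add: \<delta>)
    qed
    have h1: "h \<le> 1"
      using h\<delta> \<delta>(2) by simp
    have mh: "\<tau> = real (m * N) * h" "m * N > 0"
      using m N \<delta> by auto
    have sT: "?s \<le> T"
    proof -
      have "?s \<le> real n * h"
        using j h by (intro mult_right_mono) auto
      then show ?thesis
        using n by simp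
    qed
    have kj: "k * N \<le> j" "j \<le> (k + 1) * N"
      using N dividend_less_div_times[of N j] by (auto simp: k_def)
    have lo: "of_int (int k) * \<delta> \<le> ?s"
    proof -
      have "of_int (int k) * \<delta> = real (k * N) * h"
        by (simp add: \<delta>)
      also have "\<dots> \<le> ?s"
        using kj(1) h by (intro mult_right_mono) (auto simp del: of_nat_mult)
      finally show ?thesis .
    qed
    have hi: "?s \<le> (of_int (int k) + 1) * \<delta>"
    proof -
      have "?s \<le> real ((k + 1) * N) * h"
        using kj(2) h by (intro mult_right_mono) (auto simp del: of_nat_mult)
      also have "\<dots> = (of_int (int k) + 1) * \<delta>"
        by (simp add: \<delta> algebra_simps)
      finally show ?thesis .
    qed
    have "norm (em_drift h x (int j) - drift x ?s) \<le> K0 * (1 + H) * h powr (\<gamma> * \<alpha>)"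
      using h sT by (intro dK[OF sp h h1 mh]) (auto simp: algebra_simps)
    also have "\<dots> \<le> K0 * (1 + H) * \<delta> powr (\<gamma> * \<alpha>)"
      using K0 H h h\<delta> gamma alpha by (intro mult_left_mono powr_mono2) auto
    finally have 1: "norm (em_drift h x (int j) - drift x ?s) \<le> K0 * (1 + H) * \<delta> powr (\<gamma> * \<alpha>)" .
    have 2: "norm (em_drift \<delta> x (int k) - drift x ?s) \<le> K0 * (1 + H) * \<delta> powr (\<gamma> * \<alpha>)"
      using sT lo hi by (intro dK[OF sp \<delta>0 \<delta>(2) m]) auto
    let ?B = "K1 * (1 + H) * h powr (\<gamma> * \<alpha>)"
    have B0: "0 \<le> ?B"
      using K1 H by simp
    have "norm (em_drift \<delta> x (int k) - grid_drift \<delta> N y k) \<le> L1 * ?B + L2 * ?B powr \<alpha>"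
      unfolding em_drift_eq_grid_drift[OF \<delta>0 m \<delta>(1) init, of k, simplified]
    proof (rule em_drift_diff_le[OF \<delta>0 m])
      fix i assume "i \<le> m"
      show "norm (grid_path \<delta> N (\<lambda>j. x (real j * h)) ((of_int (int k) - real i) * \<delta>)
          - grid_path \<delta> N y ((of_int (int k) - real i) * \<delta>)) \<le> ?B"
      proof (cases "k \<le> i")
        case True
        then show ?thesis
          using B0 by (simp add: grid_path_at[OF \<delta>0])
      next
        case False
        have "norm (y (N * (k - i)) - x (real (N * (k - i)) * h)) \<le> ?B"
        proof (rule yK[where y = y, OF sp h h1 mh n y0])
          show "N * (k - i) \<le> n"
            using kj(1) j by (metis diff_le_self le_trans mult.commute mult_le_mono2)
        qed (rule y)
        then show ?thesis
          using False by (simp add: grid_path_at[OF \<delta>0] norm_minus_commute)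
      qed
    qed
    also have "\<dots> \<le> (L1 * K1 + L2 * (1 + K1)) * (1 + H) * \<delta> powr (\<gamma> * \<alpha>)"
    proof (rule lipschitz_hoelder_le[OF K1 H \<delta>0 \<delta>(2) B0])
      \<comment> \<open>The distance of \<open>y\<close> to \<open>x\<close> already carries the
        exponent \<open>\<gamma> * \<alpha>\<close>, and \<open>Z\<close> takes another power
        \<open>\<alpha>\<close>. The smallness of \<open>h\<close> makes up for this loss.\<close>
      have "h powr (\<gamma> * \<alpha>) = (h powr \<alpha>) powr \<gamma>"
        by (simp add: powr_powr mult.commute)
      also have "\<dots> \<le> \<delta> powr \<gamma>"
        using small gamma by (intro powr_mono2) auto
      finally show "?B \<le> K1 * (1 + H) * \<delta> powr \<gamma>"
        using K1 H by (intro mult_left_mono) auto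
    qed
    finally have 3: "norm (em_drift \<delta> x (int k) - grid_drift \<delta> N y k) \<le> K2 * (1 + H) * \<delta> powr (\<gamma> * \<alpha>)"
      by (simp add: K2_def)
    have "norm (em_drift h x (int j) - grid_drift \<delta> N y k)
        \<le> norm (em_drift h x (int j) - drift x ?s) + norm (em_drift \<delta> x (int k) - drift x ?s)
          + norm (em_drift \<delta> x (int k) - grid_drift \<delta> N y k)"
      by norm
    also have "\<dots> \<le> (2 * K0 + K2) * (1 + H) * \<delta> powr (\<gamma> * \<alpha>)"
      using 1 2 3 by (simp add: algebra_simps)
    finally show "norm (em_drift h x (int j) - grid_drift \<delta> N y (j div N)) \<le> (2 * K0 + K2) * (1 + H) * \<delta> powr (\<gamma> * \<alpha>)"
      by (simp add: k_def)
  qed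
qed

end

section \<open>Comparison with the Euler--Maruyama scheme\<close>

lemma matrix_inv_right:
  assumes "invertible A"
  shows "A ** matrix_inv A = mat 1"
  using someI_ex[OF assms[unfolded invertible_def]] unfolding matrix_inv_def by blast

locale em_comparison = delay_path b Z \<tau> L1 L2 \<alpha> \<xi> \<sigma> T \<gamma> L3
  for b :: "real ^ 'd \<Rightarrow> real ^ 'd" and Z \<tau> L1 L2 \<alpha> \<xi> \<sigma> T \<gamma> L3 +
  fixes M :: "'a measure" and F :: "real \<Rightarrow> 'a measure" and W X :: "real \<Rightarrow> 'a \<Rightarrow> real ^ 'd"
    and H :: "'a \<Rightarrow> real"
  assumes fps: "filtered_prob_space M F" and bm: "brownian_motion M F W"
    and sol: "additive_noise_solution M F W \<tau> drift \<sigma> \<xi> X"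
    and inv: "invertible \<sigma>"
    and H_measurable: "H \<in> borel_measurable M" and H_nonneg: "\<And>\<omega>. 0 \<le> H \<omega>"
    and H_square: "integrable M (\<lambda>\<omega>. (H \<omega>)\<^sup>2)"
    and H_hoelder: "AE \<omega> in M. \<forall>s\<in>{0..T}. \<forall>r\<in>{0..T}. norm (W s \<omega> - W r \<omega>) \<le> H \<omega> * \<bar>s - r\<bar> powr \<gamma>"
begin

sublocale prob_space M
  using fps by (simp add: filtered_prob_space_def)

lemma space_F: "space (F t) = space M" and sets_F: "sets (F t) \<subseteq> sets M"
  using fps by (auto simp: filtered_prob_space_def filtration_def)

lemma F_mono: "s \<le> t \<Longrightarrow> sets (F s) \<subseteq> sets (F t)"
  using fps by (auto simp: filtered_prob_space_def filtration_def)

lemma F_measurable_mono: "f \<in> measurable (F s) N \<Longrightarrow> s \<le> t \<Longrightarrow> f \<in> measurable (F t) N"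
  using measurable_mono[of N N "F s" "F t"] F_mono[of s t] space_F by auto

lemma F_measurable_M: "f \<in> measurable (F t) N \<Longrightarrow> f \<in> measurable M N"
  using measurable_mono[of N N "F t" M] sets_F space_F by auto

lemma W_adapted: "0 \<le> t \<Longrightarrow> W t \<in> borel_measurable (F t)"
  using bm by (simp add: brownian_motion_def adapted_process_def)

lemma X_adapted: "0 \<le> t \<Longrightarrow> X t \<in> borel_measurable (F t)"
  using sol by (simp add: additive_noise_solution_def adapted_process_def)

text \<open>
  \<^term>\<open>X t\<close> equals \<^term>\<open>\<xi> t\<close> for \<open>t \<le> 0\<close> only almost surely. Forcing this everywhere makes
  the discretised drift exactly adapted, although \<^term>\<open>F\<close> need not be complete.
\<close>

definition X_ext :: "real \<Rightarrow> 'a \<Rightarrow> real ^ 'd" where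
  "X_ext t \<omega> = (if t \<le> 0 then \<xi> t else X t \<omega>)"

text \<open>On the intersection of three almost sure events \<open>X_ext\<close> and
  \<open>X\<close> agree from \<open>-\<tau>\<close> on, so they have the same segments and drift
  integrals at nonnegative times.\<close>

lemma solution_path_AE: "AE \<omega> in M. solution_path (\<lambda>t. X_ext t \<omega>) (\<lambda>t. W t \<omega>) (H \<omega>)
    \<and> (\<forall>t\<ge>0. X_ext t \<omega> = X t \<omega>)"
proof -
  have W0: "AE \<omega> in M. W 0 \<omega> = 0"
    using bm by (simp add: brownian_motion_def)
  have X: "AE \<omega> in M. continuous_on {-\<tau>..} (\<lambda>t. X t \<omega>) \<and> (\<forall>\<theta>\<in>{-\<tau>..0}. X \<theta> \<omega> = \<xi> \<theta>) \<and>
      (\<forall>t\<ge>0. set_integrable lborel {0..t} (drift (\<lambda>r. X r \<omega>)) \<and>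
         X t \<omega> = \<xi> 0 + (LINT s:{0..t}|lborel. drift (\<lambda>r. X r \<omega>) s) + \<sigma> *v W t \<omega>)"
    using sol by (simp add: additive_noise_solution_def)
  from W0 X H_hoelder show ?thesis
  proof eventually_elim
    case (elim \<omega>)
    have eq: "X_ext t \<omega> = X t \<omega>" if "-\<tau> \<le> t" for t
      using elim(2) that by (auto simp: X_ext_def)
    have cont: "continuous_on {-\<tau>..T} (\<lambda>t. X_ext t \<omega>)"
    proof -
      have "continuous_on {-\<tau>..T} (\<lambda>t. X t \<omega>)"
        using elim(2) by (auto intro: continuous_on_subset)
      also have "?this \<longleftrightarrow> continuous_on {-\<tau>..T} (\<lambda>t. X_ext t \<omega>)"
        by (rule continuous_on_cong) (auto simp: eq)
      finally show ?thesis .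
    qed
    have dr: "drift (\<lambda>t. X_ext t \<omega>) s = drift (\<lambda>t. X t \<omega>) s" if "0 \<le> s" for s
    proof -
      have "segment \<tau> (\<lambda>t. X_ext t \<omega>) s = segment \<tau> (\<lambda>t. X t \<omega>) s"
        using that by (auto simp: segment_def eq intro!: ext)
      then show ?thesis
        using that tau by (simp add: drift_def eq)
    qed
    have int: "set_integrable lborel {0..t} (drift (\<lambda>t. X_ext t \<omega>))"
      and lint: "(LINT s:{0..t}|lborel. drift (\<lambda>t. X_ext t \<omega>) s) = (LINT s:{0..t}|lborel. drift (\<lambda>t. X t \<omega>) s)"
      if "0 \<le> t" for t
    proof -
      have "set_integrable lborel {0..t} (drift (\<lambda>t. X t \<omega>))"
        using elim(2) that by auto
      also have "?this \<longleftrightarrow> set_integrable lborel {0..t} (drift (\<lambda>t. X_ext t \<omega>))"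
        by (intro set_integrable_cong) (auto simp: dr)
      finally show "set_integrable lborel {0..t} (drift (\<lambda>t. X_ext t \<omega>))" .
      show "(LINT s:{0..t}|lborel. drift (\<lambda>t. X_ext t \<omega>) s) = (LINT s:{0..t}|lborel. drift (\<lambda>t. X t \<omega>) s)"
        by (intro set_lebesgue_integral_cong) (auto simp: dr)
    qed
    have "X_ext t \<omega> = \<xi> 0 + (LINT s:{0..t}|lborel. drift (\<lambda>t. X_ext t \<omega>) s) + \<sigma> *v W t \<omega>" if "0 \<le> t" for t
      using elim(2) that tau unfolding lint[OF that] by (simp add: eq)
    moreover have "X_ext \<theta> \<omega> = \<xi> \<theta>" if "\<theta> \<in> {-\<tau>..0}" for \<theta>
      using that by (simp add: X_ext_def)
    ultimately have "solution_path (\<lambda>t. X_ext t \<omega>) (\<lambda>t. W t \<omega>) (H \<omega>)"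
      using elim(1,3) cont int H_nonneg[of \<omega>] unfolding solution_path_def by simp
    then show ?case
      using eq tau by auto
  qed
qed

text \<open>The drift of \<open>X\<close> is read off the interpolation of step \<open>h\<close>
  rather than off the true segment: finitely many values of \<open>X\<close> then determine it,
  which yields adaptedness.\<close>

definition fine_drift :: "real \<Rightarrow> nat \<Rightarrow> 'a \<Rightarrow> real ^ 'd" where
  "fine_drift h j \<omega> = em_drift h (\<lambda>t. X_ext t \<omega>) (int j)"

definition increment :: "real \<Rightarrow> nat \<Rightarrow> 'a \<Rightarrow> real ^ 'd" where
  "increment h j \<omega> = W (real (Suc j) * h) \<omega> - W (real j * h) \<omega>"

text \<open>As the drifts come from \<open>X\<close>, this is an explicit sum and not a recursion in
  its own values.\<close>

definition fine_scheme :: "real \<Rightarrow> nat \<Rightarrow> 'a \<Rightarrow> real ^ 'd" where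
  "fine_scheme h j \<omega> = \<xi> 0 + (\<Sum>i<j. h *\<^sub>R fine_drift h i \<omega> + \<sigma> *v increment h i \<omega>)"

text \<open>The shift of the noise which turns the increments driving \<^term>\<open>fine_scheme h\<close> into those driving the coarse scheme.\<close>

definition shift :: "real \<Rightarrow> nat \<Rightarrow> real \<Rightarrow> nat \<Rightarrow> 'a \<Rightarrow> real ^ 'd" where
  "shift \<delta> N h j \<omega> = matrix_inv \<sigma> *v (fine_drift h j \<omega> - grid_drift \<delta> N (\<lambda>i. fine_scheme h i \<omega>) (j div N))"

lemma matrix_vector_measurable: "(*v) (A :: real ^ 'd ^ 'd) \<in> borel_measurable borel"
  by (intro borel_measurable_continuous_onI linear_continuous_on matrix_vector_mul_bounded_linear)

lemma gaussian_noise_increments: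
  assumes h: "h > 0"
  shows "gaussian_noise M (\<lambda>j. F (real j * h)) (increment h) h"
proof (unfold_locales)
  show "h > 0"
    by fact
  show "space (F (real j * h)) = space M" "sets (F (real j * h)) \<subseteq> events" for j
    by (rule space_F sets_F)+
  show "sets (F (real i * h)) \<subseteq> sets (F (real j * h))" if "i \<le> j" for i j
    using that h by (intro F_mono mult_right_mono) auto
  fix j
  have lt: "0 \<le> real j * h" "real j * h < real (Suc j) * h" "real (Suc j) * h - real j * h = h"
    using h by (auto simp: algebra_simps)
  have [measurable]: "W (real j * h) \<in> borel_measurable (F (real (Suc j) * h))"
    "W (real (Suc j) * h) \<in> borel_measurable (F (real (Suc j) * h))"
    using lt by (auto intro!: W_adapted F_measurable_mono[OF W_adapted])
  show "increment h j \<in> borel_measurable (F (real (Suc j) * h))"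
    unfolding increment_def[abs_def] by measurable
  have "distributed M lborel (increment h j)
      (\<lambda>x. ennreal (\<Prod>i\<in>UNIV. normal_density 0 (sqrt (real (Suc j) * h - real j * h)) (x $ i)))"
    using bm lt(1,2) unfolding brownian_motion_def increment_def[abs_def] by blast
  then have "distr M lborel (increment h j) = gauss h"
    unfolding lt(3) gauss_def by (simp add: distributed_def)
  moreover have "distr M borel (increment h j) = distr M lborel (increment h j)"
    by (rule distr_cong) auto
  ultimately show "distr M borel (increment h j) = gauss h"
    by simp
  have "indep_set (sets (F (real j * h))) (sets (vimage_algebra (space M) (\<lambda>\<omega>. W (real (Suc j) * h) \<omega> - W (real j * h) \<omega>) borel))"
    using bm lt(1,2) unfolding brownian_motion_def by blast
  then show "indep_set (sets (F (real j * h))) (sets (vimage_algebra (space M) (increment h j) borel))"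
    by (simp add: increment_def[abs_def])
qed

context
  fixes h :: real and m N :: nat and \<delta> :: real
  assumes h: "h > 0" and N: "N > 0" and \<delta>: "\<delta> = real N * h" and m: "\<tau> = real m * \<delta>" "m > 0"
begin

lemma delta_pos: "\<delta> > 0"
  using h N \<delta> by simp

lemma fine_grid: "\<tau> = real (m * N) * h" "m * N > 0"
  using m N \<delta> by auto

interpretation gaussian_noise M "\<lambda>j. F (real j * h)" "increment h" h
  using h by (rule gaussian_noise_increments)

text \<open>With refinement factor 1 the fine drift is itself a \<open>grid_drift\<close>, evaluated
  on the values of \<open>X_ext\<close> at grid times up to \<open>real j * h\<close>.\<close>

lemma fine_drift_measurable: "fine_drift h j \<in> borel_measurable (F (real j * h))"
proof -
  have "fine_drift h j \<omega> = grid_drift h 1 (\<lambda>i. X_ext (real i * h) \<omega>) j" for \<omega>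
    unfolding fine_drift_def by (rule em_drift_eq_grid_drift[OF h fine_grid]) (auto simp: X_ext_def)
  moreover have "(\<lambda>\<omega>. grid_drift h 1 (\<lambda>i. X_ext (real i * h) \<omega>) j) \<in> borel_measurable (F (real j * h))"
  proof (rule grid_drift_measurable_comp[OF h fine_grid])
    fix i assume "i \<le> 1 * j"
    then have "0 \<le> real i * h" "real i * h \<le> real j * h"
      using h by (auto intro!: mult_right_mono)
    then have "X (real i * h) \<in> borel_measurable (F (real j * h))"
      by (rule F_measurable_mono[OF X_adapted])
    then show "X_ext (real i * h) \<in> borel_measurable (F (real j * h))"
      by (cases "real i * h \<le> 0") (simp_all add: X_ext_def[abs_def])
  qed
  ultimately show ?thesis
    by (simp cong: measurable_cong)
qed

lemma fine_scheme_measurable: "fine_scheme h j \<in> borel_measurable (F (real j * h))"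
  unfolding fine_scheme_def[abs_def]
proof (intro borel_measurable_add borel_measurable_sum borel_measurable_const)
  fix i assume i: "i \<in> {..<j}"
  have "fine_drift h i \<in> borel_measurable (F (real j * h))"
    using i by (intro G_measurable_mono[OF fine_drift_measurable]) auto
  then show "(\<lambda>\<omega>. h *\<^sub>R fine_drift h i \<omega>) \<in> borel_measurable (F (real j * h))"
    by measurable
  have "increment h i \<in> borel_measurable (F (real j * h))"
    using i by (intro G_measurable_mono[OF e_measurable]) auto
  then show "(\<lambda>\<omega>. \<sigma> *v increment h i \<omega>) \<in> borel_measurable (F (real j * h))"
    using matrix_vector_measurable by (rule measurable_compose)
qed

lemma shift_measurable: "shift \<delta> N h j \<in> borel_measurable (F (real j * h))"
proof -
  have "(\<lambda>\<omega>. grid_drift \<delta> N (\<lambda>i. fine_scheme h i \<omega>) (j div N)) \<in> borel_measurable (F (real j * h))"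
  proof (rule grid_drift_measurable_comp[OF delta_pos m])
    fix i assume "i \<le> N * (j div N)"
    then have "i \<le> j"
      by (metis order_trans times_div_less_eq_dividend)
    then show "fine_scheme h i \<in> borel_measurable (F (real j * h))"
      by (rule G_measurable_mono[OF fine_scheme_measurable])
  qed
  then have "(\<lambda>\<omega>. fine_drift h j \<omega> - grid_drift \<delta> N (\<lambda>i. fine_scheme h i \<omega>) (j div N)) \<in> borel_measurable (F (real j * h))"
    using fine_drift_measurable[of j] by measurable
  from measurable_compose[OF this matrix_vector_measurable] show ?thesis
    unfolding shift_def[abs_def] .
qed

lemma fine_scheme_recursion:
  "fine_scheme h (Suc j) \<omega> = fine_scheme h j \<omega> + h *\<^sub>R fine_drift h j \<omega> + \<sigma> *v increment h j \<omega>"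
  by (simp add: fine_scheme_def)

text \<open>Multiplying the shift by \<open>\<sigma>\<close> gives back the difference of the
  drifts, so shifting the increments trades the coarse drift for the fine one. The identity holds
  for every sample.\<close>

lemma fine_scheme_eq_hist:
  "euler_hist \<delta> N h (\<lambda>j\<in>{..<n}. increment h j \<omega> + h *\<^sub>R shift \<delta> N h j \<omega>) n n = fine_scheme h n \<omega>"
proof (rule euler_hist_unique[OF delta_pos m])
  show "fine_scheme h 0 \<omega> = \<xi> 0"
    by (simp add: fine_scheme_def)
  fix j assume j: "j < n"
  have "\<sigma> *v shift \<delta> N h j \<omega> = fine_drift h j \<omega> - grid_drift \<delta> N (\<lambda>i. fine_scheme h i \<omega>) (j div N)"
    unfolding shift_def matrix_vector_mul_assoc matrix_inv_right[OF inv] by simp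
  then have "\<sigma> *v (h *\<^sub>R shift \<delta> N h j \<omega>)
      = h *\<^sub>R fine_drift h j \<omega> - h *\<^sub>R grid_drift \<delta> N (\<lambda>i. fine_scheme h i \<omega>) (j div N)"
    by (simp add: matrix_vector_mult_scaleR scaleR_diff_right)
  then show "fine_scheme h (Suc j) \<omega> = fine_scheme h j \<omega>
      + h *\<^sub>R grid_drift \<delta> N (\<lambda>i. fine_scheme h i \<omega>) (j div N)
      + \<sigma> *v (\<lambda>j\<in>{..<n}. increment h j \<omega> + h *\<^sub>R shift \<delta> N h j \<omega>) j"
    using j by (simp add: fine_scheme_recursion matrix_vector_right_distrib)
qed auto

text \<open>The counterpart for the plain increments: the same map now produces the scheme, on the
  almost sure event where its integral equation holds.\<close>

lemma em_scheme_eq_hist: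
  assumes em: "euler_maruyama M F W \<tau> b Z \<sigma> \<xi> \<delta> Y"
  shows "AE \<omega> in M. euler_hist \<delta> N h (\<lambda>j\<in>{..<n}. increment h j \<omega>) n n = Y (real n * h) \<omega>"
proof -
  have "AE \<omega> in M. (\<forall>\<theta>\<in>{-\<tau>..0}. Y \<theta> \<omega> = \<xi> \<theta>) \<and>
      (\<forall>t\<ge>0. set_integrable lborel {0..t} (\<lambda>s. em_drift \<delta> (\<lambda>r. Y r \<omega>) \<lfloor>s / \<delta>\<rfloor>) \<and>
         Y t \<omega> = \<xi> 0 + (LINT s:{0..t}|lborel. em_drift \<delta> (\<lambda>r. Y r \<omega>) \<lfloor>s / \<delta>\<rfloor>) + \<sigma> *v W t \<omega>)"
    using em unfolding euler_maruyama_def additive_noise_solution_def em_drift_def by auto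
  then show ?thesis
  proof eventually_elim
    case (elim \<omega>)
    show ?case
    proof (rule euler_hist_unique[OF delta_pos m, where y = "\<lambda>j. Y (real j * h) \<omega>"])
      show "Y (real 0 * h) \<omega> = \<xi> 0"
        using elim tau by auto
      fix j assume j: "j < n"
      have "Y (real (Suc j) * h) \<omega> = Y (real j * h) \<omega> + h *\<^sub>R grid_drift \<delta> N (\<lambda>j. Y (real j * h) \<omega>) (j div N)
          + \<sigma> *v (W (real (Suc j) * h) \<omega> - W (real j * h) \<omega>)"
        using elim by (intro em_scheme_recursion[where x = "\<lambda>t. Y t \<omega>" and w = "\<lambda>t. W t \<omega>", OF h N \<delta> m]) auto
      then show "Y (real (Suc j) * h) \<omega> = Y (real j * h) \<omega> + h *\<^sub>R grid_drift \<delta> N (\<lambda>j. Y (real j * h) \<omega>) (j div N)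
          + \<sigma> *v (\<lambda>j\<in>{..<n}. increment h j \<omega>) j"
        using j by (simp add: increment_def)
    qed auto
  qed
qed

text \<open>Both processes are images under one measurable map, of the shifted and of the plain
  increments, so the shift bound applies. There are at most \<open>T / h\<close> steps, each with a
  second moment at most \<open>K\<^sup>2\<close> times that of \<open>1 + H\<close>, so the factor
  \<open>h\<close> cancels.\<close>

lemma em_tv_grid:
  fixes f :: "real ^ 'd \<Rightarrow> real"
  assumes em: "euler_maruyama M F W \<tau> b Z \<sigma> \<xi> \<delta> Y"
    and f: "f \<in> borel_measurable borel" "\<And>x. \<bar>f x\<bar> \<le> 1"
    and n: "real n * h \<le> T" and K: "K \<ge> 0"
    and shift: "\<And>j. j < n \<Longrightarrow> AE \<omega> in M. norm (shift \<delta> N h j \<omega>) \<le> K * (1 + H \<omega>)"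
  shows "\<bar>expectation (\<lambda>\<omega>. f (fine_scheme h n \<omega>)) - expectation (\<lambda>\<omega>. f (Y (real n * h) \<omega>))\<bar>
      \<le> 2 * sqrt (T * expectation (\<lambda>\<omega>. (1 + H \<omega>)\<^sup>2)) * K"
proof -
  let ?u = "shift \<delta> N h" and ?g = "\<lambda>w. f (euler_hist \<delta> N h w n n)" and ?E = "expectation (\<lambda>\<omega>. (1 + H \<omega>)\<^sup>2)"
  note [measurable] = H_measurable
  have um[measurable]: "?u j \<in> borel_measurable M" for j
    using shift_measurable by (rule F_measurable_M)
  have intH: "integrable M (\<lambda>\<omega>. (1 + H \<omega>)\<^sup>2)"
  proof (rule Bochner_Integration.integrable_bound)
    show "integrable M (\<lambda>\<omega>. 2 + 2 * (H \<omega>)\<^sup>2)"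
      using H_square by simp
    have "(1 + H \<omega>)\<^sup>2 \<le> 2 + 2 * (H \<omega>)\<^sup>2" for \<omega>
      using sum_squares_bound[of 1 "H \<omega>"] by (simp add: power2_sum)
    then show "AE \<omega> in M. norm ((1 + H \<omega>)\<^sup>2) \<le> norm (2 + 2 * (H \<omega>)\<^sup>2)"
      by simp
  qed simp
  have sq: "AE \<omega> in M. (norm (?u j \<omega>))\<^sup>2 \<le> K\<^sup>2 * (1 + H \<omega>)\<^sup>2" if "j < n" for j
    using shift[OF that] by eventually_elim (metis norm_ge_zero power_mono power_mult_distrib)
  have int: "integrable M (\<lambda>\<omega>. (norm (?u j \<omega>))\<^sup>2)" if "j < n" for j
    by (rule Bochner_Integration.integrable_bound[of _ "\<lambda>\<omega>. K\<^sup>2 * (1 + H \<omega>)\<^sup>2"])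
      (use intH sq[OF that] in auto)
  have le: "expectation (\<lambda>\<omega>. (norm (?u j \<omega>))\<^sup>2) \<le> K\<^sup>2 * ?E" if "j < n" for j
    using integral_mono_AE[OF int[OF that] _ sq[OF that]] intH by simp
  have "h * (\<Sum>j<n. expectation (\<lambda>\<omega>. (norm (?u j \<omega>))\<^sup>2)) \<le> h * (\<Sum>j<n. K\<^sup>2 * ?E)"
    using le h by (intro mult_left_mono sum_mono) auto
  also have "\<dots> = real n * h * (K\<^sup>2 * ?E)"
    by simp
  also have "\<dots> \<le> T * (K\<^sup>2 * ?E)"
    using n by (intro mult_right_mono) auto
  finally have "sqrt (h * (\<Sum>j<n. expectation (\<lambda>\<omega>. (norm (?u j \<omega>))\<^sup>2))) \<le> sqrt (T * (K\<^sup>2 * ?E))"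
    by (rule real_sqrt_le_mono)
  also have "\<dots> = sqrt (T * ?E) * K"
    using K by (simp add: real_sqrt_mult mult_ac)
  finally have "sqrt (h * (\<Sum>j<n. expectation (\<lambda>\<omega>. (norm (?u j \<omega>))\<^sup>2))) \<le> sqrt (T * ?E) * K" .
  moreover have "\<bar>expectation (\<lambda>\<omega>. ?g (\<lambda>j\<in>{..<n}. increment h j \<omega> + h *\<^sub>R ?u j \<omega>)) - expectation (\<lambda>\<omega>. ?g (\<lambda>j\<in>{..<n}. increment h j \<omega>))\<bar>
      \<le> 1 * (2 * sqrt (h * (\<Sum>j<n. expectation (\<lambda>\<omega>. (norm (?u j \<omega>))\<^sup>2))))"
  proof (rule noise_shift_tv[OF shift_measurable int])
    show "?g \<in> borel_measurable (\<Pi>\<^sub>M j\<in>{..<n}. borel)"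
      by (rule measurable_compose[OF euler_hist_measurable[OF delta_pos m order_refl] f(1)])
  qed (use f in auto)
  moreover have "expectation (\<lambda>\<omega>. ?g (\<lambda>j\<in>{..<n}. increment h j \<omega> + h *\<^sub>R ?u j \<omega>)) = expectation (\<lambda>\<omega>. f (fine_scheme h n \<omega>))"
    unfolding fine_scheme_eq_hist ..
  moreover have "expectation (\<lambda>\<omega>. ?g (\<lambda>j\<in>{..<n}. increment h j \<omega>)) = expectation (\<lambda>\<omega>. f (Y (real n * h) \<omega>))"
  proof (rule integral_cong_AE)
    have "(\<lambda>\<omega>. \<lambda>j\<in>{..<n}. increment h j \<omega>) \<in> measurable M (\<Pi>\<^sub>M j\<in>{..<n}. borel)"
      by measurable
    from measurable_compose[OF measurable_compose[OF this euler_hist_measurable[OF delta_pos m order_refl]] f(1)]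
    show "(\<lambda>\<omega>. ?g (\<lambda>j\<in>{..<n}. increment h j \<omega>)) \<in> borel_measurable M" .
    have "Y (real n * h) \<in> borel_measurable (F (real n * h))"
      using em h by (simp add: euler_maruyama_def additive_noise_solution_def adapted_process_def)
    from measurable_compose[OF F_measurable_M[OF this] f(1)]
    show "(\<lambda>\<omega>. f (Y (real n * h) \<omega>)) \<in> borel_measurable M" .
    show "AE \<omega> in M. ?g (\<lambda>j\<in>{..<n}. increment h j \<omega>) = f (Y (real n * h) \<omega>)"
      using em_scheme_eq_hist[OF em, of n] by eventually_elim simp
  qed
  ultimately show ?thesis
    by (simp add: mult.assoc)
qed

end

text \<open>The fine width tends to zero with \<open>\<delta>\<close> fixed. For continuous bounded
  \<open>f\<close> both means converge by dominated convergence, and the grid bound, which is the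
  same for all \<open>N\<close> with \<open>h N powr \<alpha> < \<delta>\<close>, passes to the
  limit.\<close>

lemma em_tv_continuous:
  obtains K where "K \<ge> 0"
    "\<And>\<delta> m Y f t. 0 < \<delta> \<Longrightarrow> \<delta> \<le> 1 \<Longrightarrow> \<tau> = real m * \<delta> \<Longrightarrow> m > 0 \<Longrightarrow>
      euler_maruyama M F W \<tau> b Z \<sigma> \<xi> \<delta> Y \<Longrightarrow> continuous_on UNIV f \<Longrightarrow> (\<And>x. \<bar>f x\<bar> \<le> (1::real)) \<Longrightarrow>
      t \<in> {0..T} \<Longrightarrow>
      \<bar>expectation (\<lambda>\<omega>. f (X t \<omega>)) - expectation (\<lambda>\<omega>. f (Y t \<omega>))\<bar> \<le> K * \<delta> powr (\<gamma> * \<alpha>)"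
proof -
  obtain K0 where K0: "K0 \<ge> 0" and disc:
    "\<And>x w H h \<delta> N m n y j. solution_path x w H \<Longrightarrow> 0 < h \<Longrightarrow> N > 0 \<Longrightarrow> \<delta> = real N * h \<Longrightarrow> \<delta> \<le> 1 \<Longrightarrow>
      \<tau> = real m * \<delta> \<Longrightarrow> m > 0 \<Longrightarrow> h powr \<alpha> \<le> \<delta> \<Longrightarrow> real n * h \<le> T \<Longrightarrow> y 0 = \<xi> 0 \<Longrightarrow>
      (\<And>j. j < n \<Longrightarrow> y (Suc j) = y j + h *\<^sub>R em_drift h x (int j) + \<sigma> *v (w (real (Suc j) * h) - w (real j * h))) \<Longrightarrow>
      j \<le> n \<Longrightarrow> norm (em_drift h x (int j) - grid_drift \<delta> N y (j div N)) \<le> K0 * (1 + H) * \<delta> powr (\<gamma> * \<alpha>)"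
    by (rule drift_discrepancy) blast
  obtain K1 where K1: "K1 \<ge> 0" and close:
    "\<And>x w H h m n y j. solution_path x w H \<Longrightarrow> 0 < h \<Longrightarrow> h \<le> 1 \<Longrightarrow> \<tau> = real m * h \<Longrightarrow> m > 0 \<Longrightarrow>
      real n * h \<le> T \<Longrightarrow> y 0 = \<xi> 0 \<Longrightarrow>
      (\<And>j. j < n \<Longrightarrow> y (Suc j) = y j + h *\<^sub>R em_drift h x (int j) + \<sigma> *v (w (real (Suc j) * h) - w (real j * h))) \<Longrightarrow>
      j \<le> n \<Longrightarrow> norm (y j - x (real j * h)) \<le> K1 * (1 + H) * h powr (\<gamma> * \<alpha>)"
    by (rule fine_euler_close) blast
  obtain S where S: "S \<ge> 0" "\<And>v. norm (matrix_inv \<sigma> *v v) \<le> S * norm v"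
    using bounded_linear.nonneg_bounded[OF matrix_vector_mul_bounded_linear[of "matrix_inv \<sigma>"]]
    by (metis mult.commute)
  let ?C = "2 * sqrt (T * expectation (\<lambda>\<omega>. (1 + H \<omega>)\<^sup>2))"
  show ?thesis
  proof (rule that[of "?C * (S * K0)"])
    show "0 \<le> ?C * (S * K0)"
      using S K0 T by (intro mult_nonneg_nonneg) auto
    fix \<delta> m Y t and f :: "real ^ 'd \<Rightarrow> real"
    assume \<delta>: "0 < \<delta>" "\<delta> \<le> 1" and m: "\<tau> = real m * \<delta>" "m > 0"
      and em: "euler_maruyama M F W \<tau> b Z \<sigma> \<xi> \<delta> Y"
      and f: "continuous_on UNIV f" "\<And>x. \<bar>f x\<bar> \<le> 1" and t: "t \<in> {0..T}"
    have fm: "f \<in> borel_measurable borel"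
      using f(1) by (rule borel_measurable_continuous_onI)
    \<comment> \<open>Using \<open>Suc N\<close> avoids a division by zero and keeps
      \<open>\<delta>\<close> an exact multiple of the fine width.\<close>
    define h where "h N = \<delta> / real (Suc N)" for N
    \<comment> \<open>In general \<open>t\<close> is not a grid time;
      \<open>real (n N) * h N\<close> is the last one not exceeding it and converges to
      \<open>t\<close>.\<close>
    define n where "n N = nat \<lfloor>t / h N\<rfloor>" for N
    have h: "h N > 0" "\<delta> = real (Suc N) * h N" "h N \<le> 1" for N
    proof -
      show "h N > 0" "\<delta> = real (Suc N) * h N"
        using \<delta> by (auto simp: h_def)
      have "\<delta> \<le> 1 * real (Suc N)"
        using \<delta> by simp
      then show "h N \<le> 1"
        unfolding h_def by (subst divide_le_eq) auto
    qed
    have nh: "real (n N) * h N \<le> t" "t - h N < real (n N) * h N" for N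
    proof -
      have "0 \<le> t / h N"
        using t h(1)[of N] by simp
      then have "real (n N) = of_int \<lfloor>t / h N\<rfloor>"
        by (simp add: n_def)
      then have "real (n N) \<le> t / h N" "t / h N < real (n N) + 1"
        by linarith+
      then show "real (n N) * h N \<le> t" "t - h N < real (n N) * h N"
        using h(1)[of N] by (auto simp: field_simps)
    qed
    have nhT: "real (n N) * h N \<le> T" for N
      using nh(1)[of N] t by simp
    have h0: "h \<longlonglongrightarrow> 0"
      unfolding h_def[abs_def] using LIMSEQ_Suc[OF lim_const_over_n[of \<delta>]] by simp
    have nht: "(\<lambda>N. real (n N) * h N) \<longlonglongrightarrow> t"
    proof (rule tendsto_sandwich)
      show "\<forall>\<^sub>F N in sequentially. t - h N \<le> real (n N) * h N"
        using nh(2) by (auto intro: always_eventually less_imp_le)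
      show "\<forall>\<^sub>F N in sequentially. real (n N) * h N \<le> t"
        using nh(1) by simp
      show "(\<lambda>N. t - h N) \<longlonglongrightarrow> t"
        using tendsto_diff[OF tendsto_const h0, of t] by simp
    qed simp
    have fine_m: "fine_scheme (h N) (n N) \<in> borel_measurable M" for N
      by (rule F_measurable_M[OF fine_scheme_measurable[OF h(1) _ h(2) m]]) simp
    have X_m: "X t \<in> borel_measurable M"
      using t by (intro F_measurable_M[OF X_adapted]) auto
    have Y_m: "Y s \<in> borel_measurable M" if "0 \<le> s" for s
      using em that by (intro F_measurable_M[of _ s])
        (simp add: euler_maruyama_def additive_noise_solution_def adapted_process_def)
    have rec: "fine_scheme (h N) (Suc j) \<omega> = fine_scheme (h N) j \<omega> + h N *\<^sub>R em_drift (h N) (\<lambda>t. X_ext t \<omega>) (int j)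
        + \<sigma> *v (W (real (Suc j) * h N) \<omega> - W (real j * h N) \<omega>)" for N j \<omega>
      by (simp add: fine_scheme_def fine_drift_def increment_def)
    have start: "fine_scheme (h N) 0 \<omega> = \<xi> 0" for N \<omega>
      by (simp add: fine_scheme_def)
    have fine_close: "norm (fine_scheme (h N) (n N) \<omega> - X_ext (real (n N) * h N) \<omega>) \<le> K1 * (1 + H \<omega>) * h N powr (\<gamma> * \<alpha>)"
      if "solution_path (\<lambda>t. X_ext t \<omega>) (\<lambda>t. W t \<omega>) (H \<omega>)" for N \<omega>
      by (rule close[of "\<lambda>t. X_ext t \<omega>" "\<lambda>t. W t \<omega>" "H \<omega>" "h N" "m * Suc N" "n N"
            "\<lambda>j. fine_scheme (h N) j \<omega>" "n N", OF that h(1,3) fine_grid[OF h(1) _ h(2) m] nhT start rec]) auto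
    have fine_disc: "norm (fine_drift (h N) j \<omega> - grid_drift \<delta> (Suc N) (\<lambda>i. fine_scheme (h N) i \<omega>) (j div Suc N))
        \<le> K0 * (1 + H \<omega>) * \<delta> powr (\<gamma> * \<alpha>)"
      if "solution_path (\<lambda>t. X_ext t \<omega>) (\<lambda>t. W t \<omega>) (H \<omega>)" "h N powr \<alpha> \<le> \<delta>" "j \<le> n N" for N j \<omega>
      unfolding fine_drift_def
      by (rule disc[of "\<lambda>t. X_ext t \<omega>" "\<lambda>t. W t \<omega>" "H \<omega>" "h N" "Suc N" \<delta> m "n N"
            "\<lambda>j. fine_scheme (h N) j \<omega>" j, OF that(1) h(1) _ h(2) \<delta>(2) m that(2) nhT start rec that(3)]) auto
    have lim1: "(\<lambda>N. expectation (\<lambda>\<omega>. f (fine_scheme (h N) (n N) \<omega>))) \<longlonglongrightarrow> expectation (\<lambda>\<omega>. f (X t \<omega>))"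
    proof (rule integral_dominated_convergence[where w = "\<lambda>_. 1"])
      show "(\<lambda>\<omega>. f (X t \<omega>)) \<in> borel_measurable M"
        using X_m fm by (rule measurable_compose)
      show "(\<lambda>\<omega>. f (fine_scheme (h N) (n N) \<omega>)) \<in> borel_measurable M" for N
        using fine_m fm by (rule measurable_compose)
      show "AE \<omega> in M. (\<lambda>N. f (fine_scheme (h N) (n N) \<omega>)) \<longlonglongrightarrow> f (X t \<omega>)"
        using solution_path_AE
      proof eventually_elim
        case (elim \<omega>)
        have cont: "continuous_on {-\<tau>..T} (\<lambda>t. X_ext t \<omega>)"
          using elim by (simp add: solution_path_def)
        have 1: "(\<lambda>N. X_ext (real (n N) * h N) \<omega>) \<longlonglongrightarrow> X_ext t \<omega>"
        proof (rule continuous_on_tendsto_compose[OF cont nht])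
          have "- \<tau> \<le> real (n N) * h N" for N
            using tau mult_nonneg_nonneg[of "real (n N)" "h N"] h(1)[of N] by linarith
          then show "\<forall>\<^sub>F N in sequentially. real (n N) * h N \<in> {-\<tau>..T}"
            using nhT by simp
        qed (use t tau in auto)
        have "(\<lambda>N. h N powr (\<gamma> * \<alpha>)) \<longlonglongrightarrow> 0"
          using gamma alpha h(1) by (intro tendsto_zero_powrI[OF h0 tendsto_const]) (auto intro: always_eventually less_imp_le)
        then have lim0: "(\<lambda>N. K1 * (1 + H \<omega>) * h N powr (\<gamma> * \<alpha>)) \<longlonglongrightarrow> 0"
          by (rule tendsto_mult_right_zero)
        have "norm (fine_scheme (h N) (n N) \<omega> - X_ext (real (n N) * h N) \<omega>) \<le> K1 * (1 + H \<omega>) * h N powr (\<gamma> * \<alpha>)" for N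
          using elim by (intro fine_close) simp
        then have "(\<lambda>N. fine_scheme (h N) (n N) \<omega> - X_ext (real (n N) * h N) \<omega>) \<longlonglongrightarrow> 0"
          by (intro Lim_null_comparison[OF always_eventually lim0]) auto
        from tendsto_add[OF this 1] have "(\<lambda>N. fine_scheme (h N) (n N) \<omega>) \<longlonglongrightarrow> X t \<omega>"
          using elim t by simp
        then show ?case
          using f(1) by (intro continuous_on_tendsto_compose[OF f(1)]) auto
      qed
    qed (use f in auto)
    have lim2: "(\<lambda>N. expectation (\<lambda>\<omega>. f (Y (real (n N) * h N) \<omega>))) \<longlonglongrightarrow> expectation (\<lambda>\<omega>. f (Y t \<omega>))"
    proof (rule integral_dominated_convergence[where w = "\<lambda>_. 1"])
      show "(\<lambda>\<omega>. f (Y t \<omega>)) \<in> borel_measurable M"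
        using t by (intro measurable_compose[OF Y_m fm]) auto
      show "(\<lambda>\<omega>. f (Y (real (n N) * h N) \<omega>)) \<in> borel_measurable M" for N
        using h(1)[of N] by (intro measurable_compose[OF Y_m fm]) auto
      have "AE \<omega> in M. continuous_on {-\<tau>..} (\<lambda>t. Y t \<omega>)"
        using em by (simp add: euler_maruyama_def additive_noise_solution_def)
      then show "AE \<omega> in M. (\<lambda>N. f (Y (real (n N) * h N) \<omega>)) \<longlonglongrightarrow> f (Y t \<omega>)"
      proof eventually_elim
        case (elim \<omega>)
        have "(\<lambda>N. Y (real (n N) * h N) \<omega>) \<longlonglongrightarrow> Y t \<omega>"
        proof (rule continuous_on_tendsto_compose[OF elim nht])
          have "- \<tau> \<le> real (n N) * h N" for N
            using tau mult_nonneg_nonneg[of "real (n N)" "h N"] h(1)[of N] by linarith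
          then show "\<forall>\<^sub>F N in sequentially. real (n N) * h N \<in> {-\<tau>..}"
            by simp
        qed (use t tau in auto)
        then show ?case
          using f(1) by (intro continuous_on_tendsto_compose[OF f(1)]) auto
      qed
    qed (use f in auto)
    have "(\<lambda>N. h N powr \<alpha>) \<longlonglongrightarrow> 0"
      using alpha h(1) by (intro tendsto_zero_powrI[OF h0 tendsto_const]) (auto intro: always_eventually less_imp_le)
    then have "\<forall>\<^sub>F N in sequentially. h N powr \<alpha> < \<delta>"
      using \<delta>(1) by (rule order_tendstoD(2))
    then have ev: "\<forall>\<^sub>F N in sequentially. \<bar>expectation (\<lambda>\<omega>. f (fine_scheme (h N) (n N) \<omega>))
        - expectation (\<lambda>\<omega>. f (Y (real (n N) * h N) \<omega>))\<bar> \<le> ?C * (S * K0) * \<delta> powr (\<gamma> * \<alpha>)"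
    proof eventually_elim
      case (elim N)
      have "\<bar>expectation (\<lambda>\<omega>. f (fine_scheme (h N) (n N) \<omega>)) - expectation (\<lambda>\<omega>. f (Y (real (n N) * h N) \<omega>))\<bar>
          \<le> ?C * (S * K0 * \<delta> powr (\<gamma> * \<alpha>))"
      proof (rule em_tv_grid[OF h(1) _ h(2) m em fm f(2) nhT])
        fix j assume j: "j < n N"
        show "AE \<omega> in M. norm (shift \<delta> (Suc N) (h N) j \<omega>) \<le> S * K0 * \<delta> powr (\<gamma> * \<alpha>) * (1 + H \<omega>)"
          using solution_path_AE
        proof eventually_elim
          case sp: (elim \<omega>)
          have "norm (fine_drift (h N) j \<omega> - grid_drift \<delta> (Suc N) (\<lambda>i. fine_scheme (h N) i \<omega>) (j div Suc N))
              \<le> K0 * (1 + H \<omega>) * \<delta> powr (\<gamma> * \<alpha>)"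
            using sp elim j by (intro fine_disc) auto
          then have "norm (shift \<delta> (Suc N) (h N) j \<omega>) \<le> S * (K0 * (1 + H \<omega>) * \<delta> powr (\<gamma> * \<alpha>))"
            unfolding shift_def using S by (meson mult_left_mono order_trans)
          then show ?case
            by (simp add: mult_ac)
        qed
      qed (use S K0 in auto)
      then show ?case
        by (simp add: mult.assoc)
    qed
    have "(\<lambda>N. \<bar>expectation (\<lambda>\<omega>. f (fine_scheme (h N) (n N) \<omega>)) - expectation (\<lambda>\<omega>. f (Y (real (n N) * h N) \<omega>))\<bar>)
        \<longlonglongrightarrow> \<bar>expectation (\<lambda>\<omega>. f (X t \<omega>)) - expectation (\<lambda>\<omega>. f (Y t \<omega>))\<bar>"
      by (intro tendsto_intros lim1 lim2)
    then show "\<bar>expectation (\<lambda>\<omega>. f (X t \<omega>)) - expectation (\<lambda>\<omega>. f (Y t \<omega>))\<bar> \<le> ?C * (S * K0) * \<delta> powr (\<gamma> * \<alpha>)"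
      using ev by (rule tendsto_upperbound) simp
  qed
qed

end

section \<open>From continuous to measurable test functions\<close>

text \<open>The functions \<open>1 - real n * infdist x C\<close>, cut off at zero, are continuous
  with values in \<open>{0..1}\<close> and decrease to the indicator of \<open>C\<close>.
  Nonemptiness matters since \<open>infdist\<close> to the empty set is zero.\<close>

lemma closed_measure_diff_le:
  fixes \<mu> \<nu> :: "'a::metric_space measure"
  assumes \<mu>: "finite_measure \<mu>" "sets \<mu> = sets borel" and \<nu>: "finite_measure \<nu>" "sets \<nu> = sets borel"
    and K: "\<And>g. continuous_on UNIV g \<Longrightarrow> (\<And>x. \<bar>g x\<bar> \<le> 1) \<Longrightarrow> \<bar>(\<integral>x. g x \<partial>\<mu>) - (\<integral>x. g x \<partial>\<nu>)\<bar> \<le> (K::real)"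
    and C: "closed C" "C \<noteq> {}"
  shows "\<bar>measure \<mu> C - measure \<nu> C\<bar> \<le> K"
proof -
  define g where "g n x = max 0 (1 - real n * infdist x C)" for n :: nat and x
  have cont: "continuous_on UNIV (g n)" for n
    unfolding g_def[abs_def] by (intro continuous_intros)
  have g01: "0 \<le> g n x" "g n x \<le> 1" for n x
    by (auto simp: g_def infdist_nonneg)
  have lim: "(\<lambda>n. g n x) \<longlonglongrightarrow> indicator C x" for x
  proof (cases "x \<in> C")
    case True
    then show ?thesis
      by (simp add: g_def)
  next
    case False
    then have pos: "infdist x C > 0"
      using C infdist_pos_not_in_closed by blast
    obtain m where m: "1 / infdist x C < real m"
      using reals_Archimedean2 by blast
    have "g n x = 0" if "n \<ge> m" for n
    proof -
      have "1 < real m * infdist x C"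
        using m pos by (simp add: field_simps)
      also have "\<dots> \<le> real n * infdist x C"
        using that pos by (intro mult_right_mono) auto
      finally show ?thesis
        by (simp add: g_def)
    qed
    then have "\<forall>\<^sub>F n in sequentially. g n x = 0"
      by (auto simp: eventually_sequentially)
    then show ?thesis
      using False by (simp add: tendsto_eventually)
  qed
  have conv: "(\<lambda>n. \<integral>x. g n x \<partial>\<rho>) \<longlonglongrightarrow> measure \<rho> C" if \<rho>: "finite_measure \<rho>" "sets \<rho> = sets borel" for \<rho>
  proof -
    interpret finite_measure \<rho>
      by fact
    have "(\<lambda>n. \<integral>x. g n x \<partial>\<rho>) \<longlonglongrightarrow> (\<integral>x. indicator C x \<partial>\<rho>)"
    proof (rule integral_dominated_convergence[where w = "\<lambda>_. 1"])
      show "g n \<in> borel_measurable \<rho>" for n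
        using borel_measurable_continuous_onI[OF cont] measurable_cong_sets[OF \<rho>(2) refl] by auto
      show "indicator C \<in> borel_measurable \<rho>"
        using C \<rho>(2) by (intro borel_measurable_indicator) auto
    qed (use lim g01 in auto)
    moreover have "C \<inter> space \<rho> = C"
      using sets_eq_imp_space_eq[OF \<rho>(2)] by simp
    ultimately show ?thesis
      by simp
  qed
  have "(\<lambda>n. \<bar>(\<integral>x. g n x \<partial>\<mu>) - (\<integral>x. g n x \<partial>\<nu>)\<bar>) \<longlonglongrightarrow> \<bar>measure \<mu> C - measure \<nu> C\<bar>"
    by (intro tendsto_intros conv \<mu> \<nu>)
  then show ?thesis
    by (rule Lim_bounded[where M = 0]) (use K[OF cont] g01 in auto)
qed

text \<open>Inner regularity approximates \<open>B\<close> from inside by compact sets, one for each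
  measure. Their union is closed, lies in \<open>B\<close> and serves both measures at once, so the
  bound for closed sets carries over up to \<open>\<epsilon>\<close>.\<close>

lemma borel_measure_diff_le:
  fixes \<mu> \<nu> :: "'a::{second_countable_topology, complete_space} measure"
  assumes \<mu>: "finite_measure \<mu>" "sets \<mu> = sets borel" and \<nu>: "finite_measure \<nu>" "sets \<nu> = sets borel"
    and K: "\<And>g. continuous_on UNIV g \<Longrightarrow> (\<And>x. \<bar>g x\<bar> \<le> 1) \<Longrightarrow> \<bar>(\<integral>x. g x \<partial>\<mu>) - (\<integral>x. g x \<partial>\<nu>)\<bar> \<le> (K::real)"
    and B: "B \<in> sets borel"
  shows "\<bar>measure \<mu> B - measure \<nu> B\<bar> \<le> K"
proof (rule field_le_epsilon)
  fix \<epsilon> :: real assume \<epsilon>: "\<epsilon> > 0"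
  have approx: "\<exists>C. C \<subseteq> B \<and> compact C \<and> measure \<rho> B - \<epsilon> \<le> measure \<rho> C"
    if \<rho>: "finite_measure \<rho>" "sets \<rho> = sets borel" for \<rho> :: "'a measure"
  \<comment> \<open>Below zero the empty set suffices; otherwise the level embeds faithfully into
    \<open>ennreal\<close> and lies strictly below the supremum.\<close>
  proof (cases "measure \<rho> B - \<epsilon> < 0")
    case True
    then show ?thesis
      by (intro exI[of _ "{}"]) auto
  next
    case False
    interpret finite_measure \<rho>
      by fact
    have "emeasure \<rho> B = (SUP C\<in>{C. C \<subseteq> B \<and> compact C}. emeasure \<rho> C)"
      using emeasure_finite B by (intro inner_regular \<rho>(2)) auto
    moreover have "ennreal (measure \<rho> B - \<epsilon>) < emeasure \<rho> B"
      using False \<epsilon> by (simp add: emeasure_eq_measure ennreal_less_iff)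
    ultimately obtain C where C: "C \<subseteq> B" "compact C" "ennreal (measure \<rho> B - \<epsilon>) < emeasure \<rho> C"
      by (auto simp: less_SUP_iff)
    then have "measure \<rho> B - \<epsilon> \<le> measure \<rho> C"
      using False by (simp add: emeasure_eq_measure ennreal_less_iff)
    then show ?thesis
      using C by blast
  qed
  obtain C1 where C1: "C1 \<subseteq> B" "compact C1" "measure \<mu> B - \<epsilon> \<le> measure \<mu> C1"
    using approx[OF \<mu>] by blast
  obtain C2 where C2: "C2 \<subseteq> B" "compact C2" "measure \<nu> B - \<epsilon> \<le> measure \<nu> C2"
    using approx[OF \<nu>] by blast
  have cl: "closed (C1 \<union> C2)"
    using C1 C2 by (intro closed_Un compact_imp_closed)
  have K0: "0 \<le> K"
    using K[of "\<lambda>_. 0"] by simp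
  have diff: "\<bar>measure \<mu> (C1 \<union> C2) - measure \<nu> (C1 \<union> C2)\<bar> \<le> K"
    using closed_measure_diff_le[OF \<mu> \<nu> K cl] K0 by (cases "C1 \<union> C2 = {}") auto
  have mono: "measure \<rho> D \<le> measure \<rho> D'"
    if "finite_measure \<rho>" "sets \<rho> = sets borel" "D \<subseteq> D'" "D' \<in> sets borel" for \<rho> :: "'a measure" and D D'
    using that by (intro finite_measure.finite_measure_mono) auto
  have "measure \<mu> C1 \<le> measure \<mu> (C1 \<union> C2)" "measure \<mu> (C1 \<union> C2) \<le> measure \<mu> B"
    "measure \<nu> C2 \<le> measure \<nu> (C1 \<union> C2)" "measure \<nu> (C1 \<union> C2) \<le> measure \<nu> B"
    using C1 C2 cl B by (auto intro!: mono \<mu> \<nu>)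
  then show "\<bar>measure \<mu> B - measure \<nu> B\<bar> \<le> K + \<epsilon>"
    using diff C1(3) C2(3) by linarith
qed

text \<open>The layer cake formula for \<open>g\<close> with values in $[0,1]$, discretised at the levels \<open>i/n\<close>.\<close>

lemma integral_diff_le_layers:
  fixes \<mu> \<nu> :: "'a measure" and g :: "'a \<Rightarrow> real"
  assumes \<mu>: "prob_space \<mu>" and \<nu>: "prob_space \<nu>" and sets: "sets \<nu> = sets \<mu>"
    and K: "\<And>B. B \<in> sets \<mu> \<Longrightarrow> \<bar>measure \<mu> B - measure \<nu> B\<bar> \<le> K"
    and g: "g \<in> borel_measurable \<mu>" "\<And>x. 0 \<le> g x" "\<And>x. g x \<le> 1"
  shows "\<bar>(\<integral>x. g x \<partial>\<mu>) - (\<integral>x. g x \<partial>\<nu>)\<bar> \<le> K"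
proof -
  have space: "space \<nu> = space \<mu>"
    using sets by (rule sets_eq_imp_space_eq)
  have le: "\<bar>(\<integral>x. g x \<partial>\<mu>) - (\<integral>x. g x \<partial>\<nu>)\<bar> \<le> K + 2 / real n" if n: "n > 0" for n :: nat
  proof -
    define L where "L i = {x\<in>space \<mu>. real i \<le> real n * g x}" for i
    \<comment> \<open>The sum starts at 1, so \<open>s x\<close> is the floor of
      \<open>real n * g x\<close> divided by \<open>n\<close> and differs from \<open>g x\<close> by
      at most \<open>1 / real n\<close>. This error occurs once for each measure.\<close>
    define s where "s x = (\<Sum>i=1..n. indicator (L i) x) / real n" for x
    have L: "L i \<in> sets \<mu>" for i
      unfolding L_def using g(1) by measurable
    have s: "\<bar>g x - s x\<bar> \<le> 1 / real n" if x: "x \<in> space \<mu>" for x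
    proof -
      let ?k = "nat \<lfloor>real n * g x\<rfloor>"
      have "real n * g x \<le> real n * 1"
        using g(3) by (intro mult_left_mono) auto
      then have k: "?k \<le> n" "real ?k \<le> real n * g x" "real n * g x < real ?k + 1"
        using g(2)[of x] by (auto simp: nat_le_iff floor_le_iff)
      have "(\<Sum>i=1..n. indicator (L i) x) = (\<Sum>i\<in>{1..n}. if i \<le> ?k then 1 else 0 :: real)"
        using x g(2)[of x] by (intro sum.cong) (auto simp: L_def indicator_def le_nat_iff le_floor_iff)
      also have "\<dots> = real (card {i\<in>{1..n}. i \<le> ?k})"
        by (simp add: sum.If_cases Int_def)
      also have "{i\<in>{1..n}. i \<le> ?k} = {1..?k}"
        using k(1) by auto
      finally have "s x = real ?k / real n"
        by (simp add: s_def)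
      then have "g x - s x = (real n * g x - real ?k) / real n"
        using n by (simp add: diff_divide_distrib)
      then have "\<bar>g x - s x\<bar> = \<bar>real n * g x - real ?k\<bar> / real n"
        by (simp add: abs_divide)
      also have "\<bar>real n * g x - real ?k\<bar> \<le> 1"
        using k by linarith
      then have "\<bar>real n * g x - real ?k\<bar> / real n \<le> 1 / real n"
        by (intro divide_right_mono) auto
      finally show ?thesis .
    qed
    have int_s: "\<bar>(\<integral>x. g x \<partial>\<rho>) - (\<Sum>i=1..n. measure \<rho> (L i)) / real n\<bar> \<le> 1 / real n"
      if \<rho>: "prob_space \<rho>" "sets \<rho> = sets \<mu>" for \<rho> :: "'a measure"
    proof -
      interpret prob_space \<rho>
        by fact
      have sp: "space \<rho> = space \<mu>"
        using \<rho>(2) by (rule sets_eq_imp_space_eq)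
      have L': "L i \<in> sets \<rho>" "L i \<inter> space \<rho> = L i" for i
        using L[of i] \<rho>(2) by (auto simp: L_def sp)
      have gm: "g \<in> borel_measurable \<rho>"
        using g(1) measurable_cong_sets[OF \<rho>(2) refl] by auto
      have ig: "integrable \<rho> g"
        using g gm by (intro integrable_const_bound[where B = 1]) auto
      have iL: "integrable \<rho> (indicator (L i) :: 'a \<Rightarrow> real)" for i
        using L' by (intro integrable_real_indicator) (auto simp: emeasure_eq_measure)
      have ig': "integrable \<rho> s"
        unfolding s_def[abs_def] using iL by (intro integrable_divide_zero Bochner_Integration.integrable_sum) auto
      have es: "(\<integral>x. s x \<partial>\<rho>) = (\<Sum>i=1..n. measure \<rho> (L i)) / real n"
        unfolding s_def using iL L' by (simp add: Bochner_Integration.integral_sum)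
      have "\<bar>(\<integral>x. g x \<partial>\<rho>) - (\<integral>x. s x \<partial>\<rho>)\<bar> = \<bar>\<integral>x. g x - s x \<partial>\<rho>\<bar>"
        using ig ig' by simp
      also have "\<dots> \<le> (\<integral>x. \<bar>g x - s x\<bar> \<partial>\<rho>)"
        by (rule integral_abs_bound)
      also have "\<dots> \<le> (\<integral>x. 1 / real n \<partial>\<rho>)"
        using ig ig' s sp by (intro integral_mono) auto
      finally show ?thesis
        by (simp add: es prob_space)
    qed
    have "\<bar>(\<Sum>i=1..n. measure \<mu> (L i)) - (\<Sum>i=1..n. measure \<nu> (L i))\<bar> \<le> (\<Sum>i=1..n. \<bar>measure \<mu> (L i) - measure \<nu> (L i)\<bar>)"
      by (simp add: sum_subtractf[symmetric])
    also have "\<dots> \<le> real n * K"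
      using sum_bounded_above[of "{1..n}" "\<lambda>i. \<bar>measure \<mu> (L i) - measure \<nu> (L i)\<bar>" K] K[OF L] by simp
    finally have "\<bar>(\<Sum>i=1..n. measure \<mu> (L i)) / real n - (\<Sum>i=1..n. measure \<nu> (L i)) / real n\<bar> \<le> K"
      using n by (simp add: diff_divide_distrib[symmetric] divide_le_eq mult.commute)
    then show ?thesis
      using int_s[OF \<mu> refl] int_s[OF \<nu> sets] by linarith
  qed
  have "(\<lambda>n. K + 2 / real n) \<longlonglongrightarrow> K + 0"
    by (intro tendsto_intros lim_const_over_n)
  then show ?thesis
    by (intro tendsto_lowerbound[of "\<lambda>n. K + 2 / real n" K sequentially])
      (use le in \<open>auto simp: eventually_sequentially intro!: exI[of _ 1]\<close>)
qed

text \<open>The affine image \<open>(f x + c) / (2 * c)\<close> has values in \<open>{0..1}\<close>,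
  where the layer formula applies. Constants integrate to the same value under both probability
  measures, which leaves the factor \<open>2 * c\<close>.\<close>

theorem bounded_measurable_diff_le:
  fixes \<mu> \<nu> :: "'a::{second_countable_topology, complete_space} measure" and f :: "'a \<Rightarrow> real"
  assumes \<mu>: "prob_space \<mu>" "sets \<mu> = sets borel" and \<nu>: "prob_space \<nu>" "sets \<nu> = sets borel"
    and K: "\<And>g. continuous_on UNIV g \<Longrightarrow> (\<And>x. \<bar>g x\<bar> \<le> 1) \<Longrightarrow> \<bar>(\<integral>x. g x \<partial>\<mu>) - (\<integral>x. g x \<partial>\<nu>)\<bar> \<le> K"
    and f: "f \<in> borel_measurable borel" "\<And>x. \<bar>f x\<bar> \<le> c"
  shows "\<bar>(\<integral>x. f x \<partial>\<mu>) - (\<integral>x. f x \<partial>\<nu>)\<bar> \<le> 2 * c * K"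
proof (cases "c = 0")
  case True
  then have "f x = 0" for x
    using f(2)[of x] by simp
  then show ?thesis
    using True by simp
next
  case False
  then have c: "c > 0"
    using f(2)[of undefined] by linarith
  interpret \<mu>: prob_space \<mu>
    by fact
  interpret \<nu>: prob_space \<nu>
    by fact
  define g where "g x = (f x + c) / (2 * c)" for x
  have g01: "0 \<le> g x" "g x \<le> 1" for x
    using f(2)[of x] c by (auto simp: g_def field_simps abs_le_iff)
  have gm: "g \<in> borel_measurable borel"
    unfolding g_def[abs_def] using f(1) by measurable
  have le: "\<bar>(\<integral>x. g x \<partial>\<mu>) - (\<integral>x. g x \<partial>\<nu>)\<bar> \<le> K"
  proof (rule integral_diff_le_layers[OF \<mu>(1) \<nu>(1)])
    show "\<bar>measure \<mu> B - measure \<nu> B\<bar> \<le> K" if "B \<in> sets \<mu>" for B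
      using that \<mu>(2) by (intro borel_measure_diff_le[OF \<mu>.finite_measure_axioms \<mu>(2) \<nu>.finite_measure_axioms \<nu>(2) K]) auto
    show "g \<in> borel_measurable \<mu>"
      using gm measurable_cong_sets[OF \<mu>(2) refl] by auto
  qed (use \<mu> \<nu> g01 in auto)
  have int: "(\<integral>x. f x \<partial>\<rho>) = 2 * c * (\<integral>x. g x \<partial>\<rho>) - c" if \<rho>: "prob_space \<rho>" "sets \<rho> = sets borel" for \<rho>
  proof -
    interpret prob_space \<rho>
      by fact
    have "g \<in> borel_measurable \<rho>"
      using gm measurable_cong_sets[OF \<rho>(2) refl] by auto
    then have "integrable \<rho> g"
      using g01 by (intro integrable_const_bound[where B = 1]) auto
    moreover have "f = (\<lambda>x. 2 * c * g x - c)"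
      using c by (auto simp: g_def)
    ultimately show ?thesis
      by (simp add: prob_space)
  qed
  have "\<bar>(\<integral>x. f x \<partial>\<mu>) - (\<integral>x. f x \<partial>\<nu>)\<bar> = 2 * c * \<bar>(\<integral>x. g x \<partial>\<mu>) - (\<integral>x. g x \<partial>\<nu>)\<bar>"
    unfolding int[OF \<mu>] int[OF \<nu>] using c by (simp add: abs_mult flip: right_diff_distrib)
  then show ?thesis
    using mult_left_mono[OF le, of "2 * c"] c by simp
qed

theorem theorem2p1:
  fixes b :: "real ^ 'd \<Rightarrow> real ^ 'd"
    and Z :: "(real \<Rightarrow> real ^ 'd) \<Rightarrow> real ^ 'd"
    and \<sigma> :: "real ^ 'd ^ 'd"
    and \<xi> :: "real \<Rightarrow> real ^ 'd"
    and \<tau> L1 C \<beta> \<alpha> L2 L3 \<kappa> T :: real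
    and M :: "'a measure" and F :: "real \<Rightarrow> 'a measure"
    and W X :: "real \<Rightarrow> 'a \<Rightarrow> real ^ 'd"
    and XE :: "real \<Rightarrow> real \<Rightarrow> 'a \<Rightarrow> real ^ 'd"
  assumes "\<tau> > 0"
    and "invertible \<sigma>"
    and "\<xi> \<in> mspace (path_space \<tau>)"
    and "\<And>x y. norm (b x - b y) \<le> L1 * norm (x - y)"
    and "C > 0"
    and "\<And>x. 2 * (x \<bullet> b x) \<le> C + \<beta> * (norm x)\<^sup>2"
    and "\<alpha> \<in> {0<..1}"
    and "\<And>\<zeta> \<eta>. \<zeta> \<in> mspace (path_space \<tau>) \<Longrightarrow> \<eta> \<in> mspace (path_space \<tau>) \<Longrightarrow>
           norm (Z \<zeta> - Z \<eta>) \<le> L2 * mdist (path_space \<tau>) \<zeta> \<eta> powr \<alpha>"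
    and "L3 > 0"
    and "\<And>s t. s \<in> {-\<tau>..0} \<Longrightarrow> t \<in> {-\<tau>..0} \<Longrightarrow> norm (\<xi> t - \<xi> s) \<le> L3 * \<bar>t - s\<bar>"
    and "weak_solution M F W \<tau> b Z \<sigma> \<xi> X"
    and "\<And>\<delta>. admissible_stepsize \<tau> \<delta> \<Longrightarrow> euler_maruyama M F W \<tau> b Z \<sigma> \<xi> \<delta> (XE \<delta>)"
    and "\<kappa> \<in> {0<..<\<alpha> / 2}"
    and "T > 0"
    and "2 * (hs_norm \<sigma>)\<^sup>2 * (hs_norm (matrix_inv \<sigma>))\<^sup>2 *
           ((4 * L1\<^sup>2 + L2\<^sup>2) * indicator {1} \<alpha> + L1\<^sup>2 * indicator {0<..<1} \<alpha>)
         < exp (- (1 + \<beta> * T)) / T\<^sup>2"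
  shows "\<exists>C1 > 0. \<forall>f \<in> borel_measurable borel. \<forall>t \<in> {0..T}. \<forall>\<delta>.
           bounded (range f) \<longrightarrow> admissible_stepsize \<tau> \<delta> \<longrightarrow>
           \<bar>prob_space.expectation M (\<lambda>\<omega>. f (X t \<omega>)) - prob_space.expectation M (\<lambda>\<omega>. f (XE \<delta> t \<omega>))\<bar>
             \<le> C1 * (SUP x. \<bar>f x\<bar>) * \<delta> powr \<kappa>"
proof -
  \<comment> \<open>The exponent for \<open>W\<close> is dictated by
    \<open>\<gamma> * \<alpha> = \<kappa>\<close>, since \<open>Z\<close> raises path errors to the
    power \<open>\<alpha>\<close>; the condition \<open>\<kappa> < \<alpha> / 2\<close> is precisely
    \<open>\<gamma> < 1 / 2\<close>.\<close>
  define \<gamma> where "\<gamma> = \<kappa> / \<alpha>"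
  have alpha: "0 < \<alpha>" "\<alpha> \<le> 1" and kappa: "0 < \<kappa>" "\<kappa> < \<alpha> / 2"
    using assms(7,13) by auto
  have exponent: "0 < \<gamma>" "\<gamma> < 1 / 2" "\<gamma> * \<alpha> = \<kappa>"
    using alpha kappa by (auto simp: \<gamma>_def field_simps)
  have fps: "filtered_prob_space M F" and bm: "brownian_motion M F W"
    and sol: "additive_noise_solution M F W \<tau> (\<lambda>x s. b (x s) + Z (segment \<tau> x s)) \<sigma> \<xi> X"
    using assms(11) by (auto simp: weak_solution_def)
  obtain H where H: "H \<in> borel_measurable M" "\<And>\<omega>. 0 \<le> H \<omega>" "integrable M (\<lambda>\<omega>. (H \<omega>)\<^sup>2)"
    "AE \<omega> in M. \<forall>s\<in>{0..T}. \<forall>r\<in>{0..T}. norm (W s \<omega> - W r \<omega>) \<le> H \<omega> * \<bar>s - r\<bar> powr \<gamma>"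
    using brownian_motion_hoelder[OF fps bm assms(14) exponent(1,2)] by blast
  \<comment> \<open>The constants are given without a sign, while the locale fixes them nonnegative;
    absolute values only enlarge the bounds.\<close>
  interpret D: delay_drift b Z \<tau> "\<bar>L1\<bar>" "\<bar>L2\<bar>" \<alpha>
  proof
    show "norm (b x - b y) \<le> \<bar>L1\<bar> * norm (x - y)" for x y
      by (rule order_trans[OF assms(4)]) (simp add: mult_right_mono)
    show "norm (Z \<zeta> - Z \<eta>) \<le> \<bar>L2\<bar> * mdist (path_space \<tau>) \<zeta> \<eta> powr \<alpha>"
      if "\<zeta> \<in> mspace (path_space \<tau>)" "\<eta> \<in> mspace (path_space \<tau>)" for \<zeta> \<eta>
      by (rule order_trans[OF assms(8)[OF that]]) (simp add: mult_right_mono)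
  qed (use assms(1) alpha in auto)
  have drift: "D.drift = (\<lambda>x s. b (x s) + Z (segment \<tau> x s))"
    by (intro ext) (simp add: D.drift_def)
  interpret em_comparison b Z \<tau> "\<bar>L1\<bar>" "\<bar>L2\<bar>" \<alpha> \<xi> \<sigma> T \<gamma> L3 M F W X H
  proof
    show "additive_noise_solution M F W \<tau> D.drift \<sigma> \<xi> X"
      unfolding drift by (rule sol)
  qed (use assms exponent fps bm H in auto)
  obtain K where K: "K \<ge> 0" and tv:
    "\<And>\<delta> m Y f t. 0 < \<delta> \<Longrightarrow> \<delta> \<le> 1 \<Longrightarrow> \<tau> = real m * \<delta> \<Longrightarrow> m > 0 \<Longrightarrow>
      euler_maruyama M F W \<tau> b Z \<sigma> \<xi> \<delta> Y \<Longrightarrow> continuous_on UNIV f \<Longrightarrow> (\<And>x. \<bar>f x\<bar> \<le> (1::real)) \<Longrightarrow>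
      t \<in> {0..T} \<Longrightarrow>
      \<bar>expectation (\<lambda>\<omega>. f (X t \<omega>)) - expectation (\<lambda>\<omega>. f (Y t \<omega>))\<bar> \<le> K * \<delta> powr (\<gamma> * \<alpha>)"
    by (rule em_tv_continuous) blast
  show ?thesis
  \<comment> \<open>The factor 2 stems from the passage to measurable test functions; the summand 1
    makes the constant positive even if \<open>K = 0\<close>.\<close>
  proof (intro exI[of _ "2 * K + 1"] conjI ballI allI impI)
    show "0 < 2 * K + 1"
      using K by simp
    fix f :: "real ^ 'd \<Rightarrow> real" and t \<delta>
    assume f: "f \<in> borel_measurable borel" and t: "t \<in> {0..T}" and bounded: "bounded (range f)"
      and adm: "admissible_stepsize \<tau> \<delta>"
    define c where "c = (SUP x. \<bar>f x\<bar>)"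
    obtain a where "\<And>x. \<bar>f x\<bar> \<le> a"
      using bounded unfolding bounded_iff by auto
    then have bdd: "bdd_above (range (\<lambda>x. \<bar>f x\<bar>))"
      by (rule bdd_aboveI2)
    have fc: "\<bar>f x\<bar> \<le> c" for x
      unfolding c_def using bdd by (intro cSUP_upper) auto
    have c0: "0 \<le> c"
      using fc[of undefined] by linarith
    obtain m :: nat where \<delta>: "0 < \<delta>" "\<delta> \<le> 1" and m: "m > 0" "\<tau> = real m * \<delta>"
      using adm by (auto simp: admissible_stepsize_def)
    have em: "euler_maruyama M F W \<tau> b Z \<sigma> \<xi> \<delta> (XE \<delta>)"
      using adm by (rule assms(12))
    have [measurable]: "X t \<in> borel_measurable M"
      using t by (intro F_measurable_M[OF X_adapted]) auto
    have [measurable]: "XE \<delta> t \<in> borel_measurable M"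
      using em t by (intro F_measurable_M[of _ t])
        (simp add: euler_maruyama_def additive_noise_solution_def adapted_process_def)
    have "\<bar>(\<integral>x. f x \<partial>distr M borel (X t)) - (\<integral>x. f x \<partial>distr M borel (XE \<delta> t))\<bar> \<le> 2 * c * (K * \<delta> powr \<kappa>)"
    proof (rule bounded_measurable_diff_le)
      show "prob_space (distr M borel (X t))" "prob_space (distr M borel (XE \<delta> t))"
        by (rule prob_space_distr, measurable)+
      fix g :: "real ^ 'd \<Rightarrow> real" assume g: "continuous_on UNIV g" "\<And>x. \<bar>g x\<bar> \<le> 1"
      have [measurable]: "g \<in> borel_measurable borel"
        using g(1) by (rule borel_measurable_continuous_onI)
      show "\<bar>(\<integral>x. g x \<partial>distr M borel (X t)) - (\<integral>x. g x \<partial>distr M borel (XE \<delta> t))\<bar> \<le> K * \<delta> powr \<kappa>"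
        using tv[OF \<delta> m(2,1) em g t] by (simp add: integral_distr exponent(3))
    qed (use f fc in auto)
    then have "\<bar>expectation (\<lambda>\<omega>. f (X t \<omega>)) - expectation (\<lambda>\<omega>. f (XE \<delta> t \<omega>))\<bar> \<le> 2 * c * (K * \<delta> powr \<kappa>)"
      using f by (simp add: integral_distr)
    also have "\<dots> = 2 * K * (c * \<delta> powr \<kappa>)"
      by simp
    also have "\<dots> \<le> (2 * K + 1) * (c * \<delta> powr \<kappa>)"
      using c0 by (intro mult_right_mono) auto
    finally show "\<bar>expectation (\<lambda>\<omega>. f (X t \<omega>)) - expectation (\<lambda>\<omega>. f (XE \<delta> t \<omega>))\<bar>
        \<le> (2 * K + 1) * (SUP x. \<bar>f x\<bar>) * \<delta> powr \<kappa>"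
      by (simp add: c_def mult.assoc)
  qed
qed

end
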